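(* Let $\nu$ and $\mu$ be two complex numbers with $\operatorname{Re}\nu<1$ and $\operatorname{Re}\mu<\min[1-\operatorname{Re}\nu,\,2+\operatorname{Re}\nu]$. Then, for $\operatorname{Re}p>0$, $x>0$, $|\arg y|<\pi$, $y>0$, $$ \begin{aligned} &\exp\left(\tfrac12 p(y-x)\right)D_\mu\left(2^{1/2}y^{1/2}p^{1/2}\right)\left\{D_\nu\left(-2^{1/2}x^{1/2}p^{1/2}\right)-D_\nu\left(2^{1/2}x^{1/2}p^{1/2}\right)\right\}\\ &=\frac{2^{(\mu-\nu)/2}\sqrt\pi\,y^{-1/2}}{\Gamma\left[(1-\mu+\nu)/2\right]\Gamma[-\nu]}\int_0^x e^{-pt}\,t^{-(1+\mu-\nu)/2}(x-t)^{-(1+\nu)/2}(y+t)^{(1+\mu)/2}\\ &\qquad\times\left\{{}_2F_1\left(-\frac{1+\mu}{2},\frac{1+\nu}{2};\frac{1-\mu+\nu}{2};\frac{t(x-y-t)}{(x-t)(y+t)}\right)\right.\\ &\qquad\quad\left.+\frac{\mu t}{(1-\mu+\nu)(y+t)}\,{}_2F_1\left(\frac{1-\mu}{2},\frac{1+\nu}{2};\frac{3-\mu+\nu}{2};\frac{t(x-y-t)}{(x-t)(y+t)}\right)\right\}dt\\ &\quad+\frac{2^{(4+\mu+\nu)/2}\sqrt\pi\,x^{1/2}}{\Gamma\left[-(1+\mu)/2\right]\Gamma[-\nu/2]}\int_x^\infty e^{-pt}\,t^{(\nu-1)/2}(t-x)^{-(2+\mu+\nu)/2}(y-x+t)^{\mu/2}\\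 &\qquad\times\left\{{}_2F_1\left(-\frac{\mu}{2},\frac{1-\nu}{2};\frac32;\frac{xy}{t(y-x+t)}\right)\right.\\ &\qquad\quad\left.-\frac{\mu(t-x)}{(1+\mu)(y-x+t)}\,{}_2F_1\left(\frac{2-\mu}{2},\frac{1-\nu}{2};\frac32;\frac{xy}{t(y-x+t)}\right)\right\}dt . \end{aligned} $$
   Context: $\Gamma[\cdot]$ is the gamma function, with $1/\Gamma$ taken to be $0$ at the nonpositive integers. ${}_2F_1(a,b;c;z)$ is the Gaussian hypergeometric function. $D_\nu(z)$ is Whittaker's parabolic cylinder function of order $\nu$ and argument $z$, given by $$D_\nu(z)=2^{\nu/2}e^{-z^2/4}\left\{\frac{\Gamma[1/2]}{\Gamma[(1-\nu)/2]}\Phi\left(-\frac{\nu}{2};\frac12;\frac{z^2}{2}\right)+\frac{z}{2^{1/2}}\frac{\Gamma[-1/2]}{\Gamma[-\nu/2]}\Phi\left(\frac{1-\nu}{2};\frac32;\frac{z^2}{2}\right)\right\},$$ where $\Phi(a;b;z)=\sum_{n\ge0}\frac{(a)_n}{(b)_n}\frac{z^n}{n!}$ is Kummer's confluent hypergeometric function. All powers are principal values.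
   Formalization: The identity is proved where both integrals converge (shown for Re μ < min[-Re ν, 1+Re ν]), since they diverge on part of the printed range, e.g. ν=-0.3, μ=0.9; at μ=-1, where the right side is 0·∞, it is stated as a limit in μ. *)

theory Defs
  imports "HOL-Complex_Analysis.Complex_Analysis"
begin

definition kummer_Phi :: "complex \<Rightarrow> complex \<Rightarrow> complex \<Rightarrow> complex" where
  "kummer_Phi a b z = (\<Sum>n. pochhammer a n / pochhammer b n * (z ^ n / fact n))"

text \<open>
  The reciprocal gamma function \<^const>\<open>rGamma\<close> vanishes at the nonpositive integers, so it
  renders every quotient by a gamma value below.
\<close>

definition parabolic_D :: "complex \<Rightarrow> complex \<Rightarrow> complex" where
  "parabolic_D \<nu> z =
     2 powr (\<nu> / 2) * exp (- (z ^ 2) / 4) *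
       (Gamma (1 / 2) * rGamma ((1 - \<nu>) / 2) * kummer_Phi (- \<nu> / 2) (1 / 2) (z ^ 2 / 2)
        + z / 2 powr (1 / 2) * (Gamma (- (1 / 2)) * rGamma (- \<nu> / 2))
          * kummer_Phi ((1 - \<nu>) / 2) (3 / 2) (z ^ 2 / 2))"

text \<open>
  The principal branch of the Gauss hypergeometric function: the hypergeometric series at 0 is
  continued analytically along the segment from 0 to \<open>z\<close>, i.e. to some convex open set that
  contains both points. This is well defined, since two such sets meet in a convex, hence connected,
  set, and it covers all \<open>z\<close> outside the cut \<open>[1, \<infinity>)\<close>, because there the segment has a convex
  neighbourhood that avoids the cut. The integrands below have real \<open>z < 1\<close>, with \<open>z\<close> unbounded below,
  so that the series alone would not suffice. If \<open>c\<close> is a nonpositive integer, \<open>2F1\<close> is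
  mathematically undefined and the value is meaningless.
\<close>

definition hyp2F1 :: "complex \<Rightarrow> complex \<Rightarrow> complex \<Rightarrow> complex \<Rightarrow> complex" where
  "hyp2F1 a b c z = (THE w. \<exists>S f. open S \<and> convex S \<and> 0 \<in> S \<and> z \<in> S \<and>
      f holomorphic_on S \<and> f has_fps_expansion fps_hypergeo [a, b] [c] 1 \<and> w = f z)"

definition integrand1 :: "complex \<Rightarrow> complex \<Rightarrow> complex \<Rightarrow> real \<Rightarrow> real \<Rightarrow> real \<Rightarrow> complex" where
  "integrand1 \<nu> \<mu> p x y t =
     exp (- p * of_real t) * of_real t powr (- (1 + \<mu> - \<nu>) / 2)
     * of_real (x - t) powr (- (1 + \<nu>) / 2) * of_real (y + t) powr ((1 + \<mu>) / 2)
     * (hyp2F1 (- (1 + \<mu>) / 2) ((1 + \<nu>) / 2) ((1 - \<mu> + \<nu>) / 2)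
          (of_real (t * (x - y - t) / ((x - t) * (y + t))))
        + \<mu> * of_real t / ((1 - \<mu> + \<nu>) * of_real (y + t))
          * hyp2F1 ((1 - \<mu>) / 2) ((1 + \<nu>) / 2) ((3 - \<mu> + \<nu>) / 2)
              (of_real (t * (x - y - t) / ((x - t) * (y + t)))))"

definition integrand2 :: "complex \<Rightarrow> complex \<Rightarrow> complex \<Rightarrow> real \<Rightarrow> real \<Rightarrow> real \<Rightarrow> complex" where
  "integrand2 \<nu> \<mu> p x y t =
     exp (- p * of_real t) * of_real t powr ((\<nu> - 1) / 2)
     * of_real (t - x) powr (- (2 + \<mu> + \<nu>) / 2) * of_real (y - x + t) powr (\<mu> / 2)
     * (hyp2F1 (- \<mu> / 2) ((1 - \<nu>) / 2) (3 / 2) (of_real (x * y / (t * (y - x + t))))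
        - \<mu> * of_real (t - x) / ((1 + \<mu>) * of_real (y - x + t))
          * hyp2F1 ((2 - \<mu>) / 2) ((1 - \<nu>) / 2) (3 / 2) (of_real (x * y / (t * (y - x + t)))))"

definition lhs :: "complex \<Rightarrow> complex \<Rightarrow> complex \<Rightarrow> real \<Rightarrow> real \<Rightarrow> complex" where
  "lhs \<nu> \<mu> p x y =
     exp (1 / 2 * p * of_real (y - x))
     * parabolic_D \<mu> (2 powr (1 / 2) * of_real y powr (1 / 2) * p powr (1 / 2))
     * (parabolic_D \<nu> (- (2 powr (1 / 2)) * of_real x powr (1 / 2) * p powr (1 / 2))
        - parabolic_D \<nu> (2 powr (1 / 2) * of_real x powr (1 / 2) * p powr (1 / 2)))"

text \<open>
  At \<open>\<mu> = -1\<close> the formula below is of the form \<open>0 \<cdot> \<infinity>\<close> (the factor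
  \<open>1/\<Gamma>(-(1 + \<mu>)/2)\<close> times the coefficient \<open>\<mu>/(1 + \<mu>)\<close>); there it is meaningful only through
  its limit in \<open>\<mu>\<close>.
\<close>

definition rhs :: "complex \<Rightarrow> complex \<Rightarrow> complex \<Rightarrow> real \<Rightarrow> real \<Rightarrow> complex" where
  "rhs \<nu> \<mu> p x y =
     2 powr ((\<mu> - \<nu>) / 2) * of_real (sqrt pi) * of_real y powr (- (1 / 2))
       * rGamma ((1 - \<mu> + \<nu>) / 2) * rGamma (- \<nu>)
       * (LINT t:{0<..<x}|lborel. integrand1 \<nu> \<mu> p x y t)
     + 2 powr ((4 + \<mu> + \<nu>) / 2) * of_real (sqrt pi) * of_real x powr (1 / 2)
       * rGamma (- (1 + \<mu>) / 2) * rGamma (- \<nu> / 2)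
       * (LINT t:{x<..}|lborel. integrand2 \<nu> \<mu> p x y t)"

text \<open>
  The exponents of \<open>t\<close> and of \<open>\<bar>t - x\<bar>\<close> make the first integral diverge at \<open>0\<close> when
  \<open>Re \<mu> \<ge> 1 + Re \<nu>\<close>, and both integrals diverge at \<open>x\<close> when \<open>Re (\<mu> + \<nu>) \<ge> 0\<close>
  (with \<open>Re \<nu> < 1\<close> and \<open>Re \<mu> < 1 + Re \<nu>\<close>).
\<close>

definition integrals_converge ::
    "complex \<Rightarrow> complex \<Rightarrow> complex \<Rightarrow> real \<Rightarrow> real \<Rightarrow> bool" where
  "integrals_converge \<nu> \<mu> p x y \<longleftrightarrow>
     set_integrable lborel {0<..<x} (integrand1 \<nu> \<mu> p x y) \<and>
     set_integrable lborel {x<..} (integrand2 \<nu> \<mu> p x y)"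

end

theory Submission
  imports Defs "HOL-Probability.Distributions"
begin

text \<open>
  In the difference of the two \<open>D\<^sub>\<nu>\<close> only the odd part survives, a single confluent function
  of \<open>p x\<close>, which is an Euler integral over \<open>[0, x]\<close>. The factor \<open>D\<^sub>\<mu>\<close> is, up to an
  exponential and a power of \<open>p\<close>, a Laplace integral over \<open>[0, \<infinity>)\<close> of Tricomi type. The product of
  the two is the Laplace transform of a convolution. For \<open>t < x\<close> and for \<open>t > x\<close>, a Moebius
  substitution onto \<open>[0, 1]\<close> turns the inner integral of the convolution into Euler's integral
  for \<open>2F1\<close>. This needs \<open>-2 < Re \<nu>\<close> and \<open>Re \<mu> < -1\<close>. The other parameters are reached by
  analytic continuation, for which the integrands are dominated locally uniformly in the
  parameters. Finally, the behaviour of the integrands at \<open>0\<close> and at \<open>x\<close> shows that they are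
  integrable only if \<open>Re \<mu> < 1 + Re \<nu>\<close> and \<open>Re \<mu> < - Re \<nu>\<close>.
\<close>

section \<open>The hypergeometric series and Pfaff's transformation\<close>

text \<open>The Laplace integral of Tricomi type leaves over one factor p. Integration by parts
  removes it, and the product rule applied to s^(a - 1/2) (y + s)^(-a), where a = -\<mu>/2, is the
  origin of the two hypergeometric functions in each brace; the boundary term at 0 is what asks for
  Re \<mu> < -1. The four exponents of every inner integral then sum to -2, exactly the degree at
  which a Moebius substitution leaves no power of its denominator. As t approaches x, the arguments
  of \<open>hyp2F1\<close> tend to minus infinity from below x and to 1 from above x, and
  continuation needs bounds there that are locally uniform in the parameters. They all come from one
  comparison of Gauss coefficients with the coefficients of (1 - z)^(-s), s > Re (a + b - c),
  carried to the negative axis by Pfaff's transformation. A path of continuation may pass through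
  \<mu> = -1, so it is a regularised right-hand side that is continued. The divergence arguments are
  needed because the theorem allows parameters outside the region reached by continuation, even some
  at which a third hypergeometric parameter is a nonpositive integer.\<close>

definition gauss_coeff :: "complex \<Rightarrow> complex \<Rightarrow> complex \<Rightarrow> nat \<Rightarrow> complex" where
  "gauss_coeff a b c n = pochhammer a n * pochhammer b n / (pochhammer c n * fact n)"

definition gauss_series :: "complex \<Rightarrow> complex \<Rightarrow> complex \<Rightarrow> complex \<Rightarrow> complex" where
  "gauss_series a b c z = (\<Sum>n. gauss_coeff a b c n * z ^ n)"

lemma fps_hypergeo_nth_gauss: "fps_nth (fps_hypergeo [a, b] [c] 1) n = gauss_coeff a b c n"
  by (simp add: gauss_coeff_def)

lemma gauss_coeff_0 [simp]: "gauss_coeff a b c 0 = 1"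
  by (simp add: gauss_coeff_def)

lemma gauss_coeff_Suc:
  "gauss_coeff a b c (Suc n) =
     gauss_coeff a b c n * ((a + of_nat n) * (b + of_nat n) / ((c + of_nat n) * of_nat (Suc n)))"
  by (simp add: gauss_coeff_def pochhammer_Suc divide_simps del: of_nat_Suc)

text \<open>The imaginary part adds only about \<open>(Im z)^2 / (2 * n)\<close> to the modulus of
  \<open>z + n\<close>. The threshold is where the cross term \<open>2 * e * (n + Re z)\<close> of
  the square \<open>(n + Re z + e)^2\<close> has outgrown \<open>M^2\<close>.\<close>

lemma norm_add_of_nat_le:
  assumes "norm z \<le> M" "e > 0" "real n \<ge> M + M\<^sup>2 / (2 * e)"
  shows "norm (z + of_nat n) \<le> real n + Re z + e"
proof -
  have Rz: "\<bar>Re z\<bar> \<le> M" "\<bar>Im z\<bar> \<le> M"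
    using assms(1) abs_Re_le_cmod abs_Im_le_cmod order_trans by blast+
  have "M\<^sup>2 / (2 * e) \<le> n + Re z" using assms(3) Rz by linarith
  hence le: "M\<^sup>2 \<le> 2 * e * (n + Re z)" using assms(2) by (simp add: field_simps)
  have "(norm (z + of_nat n))\<^sup>2 = (n + Re z)\<^sup>2 + (Im z)\<^sup>2"
    by (simp add: cmod_power2 add.commute)
  also have "(Im z)\<^sup>2 \<le> M\<^sup>2" using Rz by (metis abs_ge_zero power2_abs power_mono)
  also note le
  also have "(n + Re z)\<^sup>2 + 2 * e * (n + Re z) \<le> (n + Re z + e)\<^sup>2"
    by (simp add: power2_eq_square algebra_simps)
  finally have "(norm (z + of_nat n))\<^sup>2 \<le> (n + Re z + e)\<^sup>2" by simp
  moreover have "0 \<le> M\<^sup>2 / (2 * e)" using assms(2) by simp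
  hence "n + Re z + e \<ge> 0" using Rz assms(2,3) by linarith
  ultimately show ?thesis by (rule power2_le_imp_le)
qed

text \<open>Both sides are n^2 plus a linear term. The linear coefficients are essentially
  \<open>Re (a + b)\<close> and \<open>s + Re c\<close>, so the gap \<open>d\<close> decides for
  large n, uniformly on the bounded set \<open>K\<close>.\<close>

lemma gauss_coeff_ratio_eventually:
  assumes K: "\<And>a b c. (a, b, c) \<in> K \<Longrightarrow> norm a \<le> M \<and> norm b \<le> M \<and> norm c \<le> M"
    and Re: "\<And>a b c. (a, b, c) \<in> K \<Longrightarrow> Re (a + b - c) \<le> s - d" and d: "d > 0" and s: "s > 0"
  shows "\<exists>N. \<forall>n\<ge>N. \<forall>(a, b, c)\<in>K.
    norm (a + of_nat n) * norm (b + of_nat n) \<le> (s + real n) * norm (c + of_nat n)"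
proof -
  \<comment> \<open>The two factors on the left cost \<open>e\<close> each; of the gap
    \<open>d = 4 * e\<close> there remains \<open>2 * e * n\<close>, which absorbs the constant
    terms.\<close>
  define e where "e = d / 4"
  have e: "e > 0" using d by (simp add: e_def)
  obtain N :: nat where N: "real N \<ge> max (M + M\<^sup>2 / (2 * e)) (((M + e)\<^sup>2 + s * M) / (2 * e))"
    using real_arch_simple by blast
  have "norm (a + of_nat n) * norm (b + of_nat n) \<le> (s + real n) * norm (c + of_nat n)"
    if n: "n \<ge> N" and abc: "(a, b, c) \<in> K" for n a b c
  proof -
    note M = K[OF abc]
    have M0: "M \<ge> 0" using M norm_ge_zero order_trans by blast
    have n1: "real n \<ge> M + M\<^sup>2 / (2 * e)" using N n by (simp add: max_def split: if_splits)
    have "real n \<ge> ((M + e)\<^sup>2 + s * M) / (2 * e)" using N n by (simp add: max_def split: if_splits)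
    hence n2: "2 * e * n \<ge> (M + e)\<^sup>2 + s * M" using e by (simp add: field_simps)
    have R: "\<bar>Re a\<bar> \<le> M" "\<bar>Re b\<bar> \<le> M" "\<bar>Re c\<bar> \<le> M"
      using M abs_Re_le_cmod order_trans by blast+
    have la: "norm (a + of_nat n) \<le> n + Re a + e" and lb: "norm (b + of_nat n) \<le> n + Re b + e"
      using M e n1 by (auto intro!: norm_add_of_nat_le)
    have "norm (a + of_nat n) * norm (b + of_nat n) \<le> (n + Re a + e) * (n + Re b + e)"
      using la lb by (intro mult_mono order_trans[OF norm_ge_zero la]) auto
    also have "\<dots> = n * n + n * (Re a + Re b + 2 * e) + (Re a + e) * (Re b + e)"
      by (simp add: algebra_simps)
    also have "(Re a + e) * (Re b + e) \<le> (M + e)\<^sup>2"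
    proof -
      have "\<bar>Re a + e\<bar> * \<bar>Re b + e\<bar> \<le> (M + e) * (M + e)"
        using R e by (intro mult_mono) auto
      thus ?thesis unfolding power2_eq_square abs_mult[symmetric] by linarith
    qed
    also have "real n * (Re a + Re b + 2 * e) \<le> n * (s + Re c - 2 * e)"
      using Re[OF abc] by (intro mult_left_mono) (auto simp: e_def)
    also have "n * n + n * (s + Re c - 2 * e) + (M + e)\<^sup>2 \<le> (s + n) * (n + Re c)"
    proof -
      have "- (s * M) \<le> s * Re c" using mult_left_mono[of "-M" "Re c" s] R s by simp
      thus ?thesis using n2 by (simp add: algebra_simps)
    qed
    also have "\<dots> \<le> (s + n) * norm (c + of_nat n)"
      using complex_Re_le_cmod[of "c + of_nat n"] s
          by (intro mult_left_mono) (auto simp: add.commute)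
    finally show ?thesis by simp
  qed
  then show ?thesis by (intro exI[of _ N]) auto
qed

text \<open>The numbers \<open>pochhammer s n / fact n\<close> are the coefficients of (1 - z)^(-s),
  with consecutive ratio (s + n) / (n + 1). Beyond some \<open>N\<close> the Gauss coefficients grow
  no faster, and \<open>C\<close> takes care of the initial ones. The last hypothesis bounds these,
  since boundedness of \<open>K\<close> does not keep \<open>c\<close> away from the poles.\<close>

lemma gauss_coeff_bound:
  assumes K: "\<And>a b c. (a, b, c) \<in> K \<Longrightarrow> norm a \<le> M \<and> norm b \<le> M \<and> norm c \<le> M"
    and Re: "\<And>a b c. (a, b, c) \<in> K \<Longrightarrow> Re (a + b - c) \<le> s - d" and d: "d > 0" and s: "s > 0"
    and B: "\<And>n. \<exists>B. \<forall>(a, b, c)\<in>K. norm (gauss_coeff a b c n) \<le> B"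
  shows "\<exists>C\<ge>0. \<forall>(a, b, c)\<in>K. \<forall>n. norm (gauss_coeff a b c n) \<le> C * (pochhammer s n / fact n)"
proof -
  obtain N where N: "\<And>n a b c. n \<ge> N \<Longrightarrow> (a, b, c) \<in> K \<Longrightarrow>
    norm (a + of_nat n) * norm (b + of_nat n) \<le> (s + real n) * norm (c + of_nat n)"
  proof -
    obtain N where "\<forall>n\<ge>N. \<forall>(a, b, c)\<in>K.
        norm (a + of_nat n) * norm (b + of_nat n) \<le> (s + real n) * norm (c + of_nat n)"
      using gauss_coeff_ratio_eventually[OF K Re d s] by (rule exE)
    then show thesis by (intro that) auto
  qed
  define p where "p n = pochhammer s n / fact n" for n
  have p: "p n > 0" for n using s by (simp add: p_def pochhammer_pos)
  have p0: "0 \<le> p n" for n using p[of n] by simp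
  have pSuc: "p (Suc n) = p n * ((s + n) / Suc n)" for n
    by (simp add: p_def pochhammer_Suc field_simps)
  obtain B where B: "\<And>n a b c. (a, b, c) \<in> K \<Longrightarrow> norm (gauss_coeff a b c n) \<le> B n"
  proof -
    from B have "\<forall>n. \<exists>B. \<forall>(a, b, c)\<in>K. norm (gauss_coeff a b c n) \<le> B" by blast
    then obtain B where "\<forall>n. \<forall>(a, b, c)\<in>K. norm (gauss_coeff a b c n) \<le> B n"
      by (rule choice[THEN exE])
    then show thesis by (intro that) auto
  qed
  define C where "C = (\<Sum>n\<le>N. \<bar>B n\<bar> / p n)"
  have init: "norm (gauss_coeff a b c n) \<le> C * p n" if "(a, b, c) \<in> K" "n \<le> N" for a b c n
  proof -
    have "norm (gauss_coeff a b c n) \<le> \<bar>B n\<bar> / p n * p n"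
      using B[OF that(1), of n] p[of n] by simp
    also have "\<bar>B n\<bar> / p n \<le> C" unfolding C_def
      by (rule member_le_sum) (use that p0 in auto)
    finally show ?thesis using p[of n] by simp
  qed
  have "norm (gauss_coeff a b c n) \<le> C * p n" if "(a, b, c) \<in> K" for a b c n
  proof (cases "n \<le> N")
    case False
    then have "N \<le> n" by simp
    then show ?thesis
    proof (induction n rule: dec_induct)
      case base
      then show ?case using init that by simp
    next
      case (step n)
      have C: "0 \<le> C" unfolding C_def by (intro sum_nonneg) (use p0 in auto)
      have "norm (gauss_coeff a b c (Suc n)) = norm (gauss_coeff a b c n) *
         (norm (a + of_nat n) * norm (b + of_nat n) / (norm (c + of_nat n) * Suc n))"
        by (simp only: gauss_coeff_Suc norm_mult norm_divide norm_of_nat)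
      also have "norm (a + of_nat n) * norm (b + of_nat n) / (norm (c + of_nat n) * Suc n) \<le>
          (s + n) / Suc n"
      \<comment> \<open>If \<open>c = - n\<close>, division by zero makes the quotient 0, so the
        estimate also covers degenerate \<open>c\<close>.\<close>
      proof (cases "c + of_nat n = 0")
        case False
        then show ?thesis using N[of n a b c] step that by (simp add: divide_simps mult.commute)
      qed (use s in simp)
      also have "norm (gauss_coeff a b c n) * ((s + n) / Suc n) \<le> C * p n * ((s + n) / Suc n)"
        using step s by (intro mult_right_mono) auto
      finally show ?case by (simp add: pSuc mult_left_mono mult.assoc)
    qed
  qed (use init that in auto)
  moreover have "C \<ge> 0" unfolding C_def by (intro sum_nonneg) (use p0 in auto)
  ultimately show ?thesis unfolding p_def by blast
qed

lemma binomial_series_pochhammer: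
  fixes s r :: real assumes "0 \<le> r" "r < 1"
  shows "(\<lambda>n. pochhammer s n / fact n * r ^ n) sums ((1 - r) powr (- s))"
proof -
  have "(\<lambda>n. ((- s) gchoose n) * (- r) ^ n) sums (1 + (- r)) powr (- s)"
    using assms by (intro gen_binomial_real) auto
  moreover have "((- s) gchoose n) * (- r) ^ n = pochhammer s n / fact n * r ^ n" for n
    by (simp add: gbinomial_pochhammer power_minus[of r])
  ultimately show ?thesis by simp
qed

lemma gauss_series_bound:
  assumes "C \<ge> 0" "\<And>n. norm (gauss_coeff a b c n) \<le> C * (pochhammer s n / fact n)" "norm z < 1"
  shows "norm (gauss_series a b c z) \<le> C * (1 - norm z) powr (- s)"
    and "summable (\<lambda>n. norm (gauss_coeff a b c n * z ^ n))"
proof -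
  have b: "norm (gauss_coeff a b c n * z ^ n) \<le> C * (pochhammer s n / fact n * norm z ^ n)" for n
    using mult_right_mono[OF assms(2)[of n], of "norm z ^ n"]
        by (simp add: norm_mult norm_power mult.assoc)
  have S: "(\<lambda>n. C * (pochhammer s n / fact n * norm z ^ n)) sums (C * (1 - norm z) powr (- s))"
    by (intro sums_mult binomial_series_pochhammer) (use assms in auto)
  show "norm (gauss_series a b c z) \<le> C * (1 - norm z) powr (- s)"
    unfolding gauss_series_def sums_unique[OF S]
    by (rule norm_suminf_le) (use S b in \<open>auto simp: sums_iff\<close>)
  show "summable (\<lambda>n. norm (gauss_coeff a b c n * z ^ n))"
    using S b by (auto intro: summable_comparison_test' simp: sums_iff)
qed

lemma gauss_coeff_bound_pointwise:
  assumes "s > 0" "s > Re (a + b - c)"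
  obtains C where "C \<ge> 0" "\<And>n. norm (gauss_coeff a b c n) \<le> C * (pochhammer s n / fact n)"
proof -
  have "\<exists>C\<ge>0. \<forall>(a, b, c)\<in>{(a, b, c)}. \<forall>n. norm (gauss_coeff a b c n) \<le> C *
      (pochhammer s n / fact n)"
    by (rule gauss_coeff_bound[where M = "norm a + norm b + norm c" and d = "s - Re (a + b - c)"])
       (use assms in auto)
  then show thesis using that by auto
qed

lemma gauss_series_summable:
  assumes "norm z < 1" shows "summable (\<lambda>n. norm (gauss_coeff a b c n * z ^ n))"
proof -
  define s where "s = \<bar>Re (a + b - c)\<bar> + 1"
  obtain C where "C \<ge> 0" "\<And>n. norm (gauss_coeff a b c n) \<le> C * (pochhammer s n / fact n)"
    by (rule gauss_coeff_bound_pointwise[of s a b c]) (auto simp: s_def)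
  from gauss_series_bound(2)[OF this assms] show ?thesis .
qed

lemma gauss_series_eq_eval_fps: "gauss_series a b c z = eval_fps (fps_hypergeo [a, b] [c] 1) z"
  unfolding gauss_series_def eval_fps_def fps_hypergeo_nth_gauss ..

lemma fps_conv_radius_hypergeo: "fps_conv_radius (fps_hypergeo [a, b] [c] 1 :: complex fps) \<ge> 1"
  unfolding fps_conv_radius_def
  by (rule conv_radius_geI_ex')
     (auto simp: fps_hypergeo_nth_gauss simp del: fps_hypergeo_nth
         intro!: summable_norm_cancel[OF gauss_series_summable])

lemma gauss_series_has_fps_expansion:
  "gauss_series a b c has_fps_expansion fps_hypergeo [a, b] [c] 1"
  unfolding gauss_series_eq_eval_fps[abs_def]
  using fps_conv_radius_hypergeo[of a b c]
      by (intro eval_fps_has_fps_expansion) (auto intro: less_le_trans[of 0 1])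

lemma ball_subset_hypergeo:
    "ball (0::complex) 1 \<subseteq> eball 0 (fps_conv_radius (fps_hypergeo [a, b] [c] 1 :: complex fps))"
proof
  fix z :: complex assume "z \<in> ball 0 1"
  then have "ereal (norm z) < 1" by (simp add: one_ereal_def)
  then show "z \<in> eball 0 (fps_conv_radius (fps_hypergeo [a, b] [c] 1 :: complex fps))"
    using less_le_trans[OF _ fps_conv_radius_hypergeo[of a b c]] by simp
qed

lemma gauss_series_holomorphic [holomorphic_intros]:
  "g holomorphic_on S \<Longrightarrow> (\<And>z. z \<in> S \<Longrightarrow> norm (g z) < 1) \<Longrightarrow>
      (\<lambda>z. gauss_series a b c (g z)) holomorphic_on S"
  unfolding gauss_series_eq_eval_fps
  by (rule holomorphic_on_compose_gen[of g S "eval_fps _" "ball 0 1", unfolded o_def])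
     (auto intro!: holomorphic_on_eval_fps ball_subset_hypergeo)

section \<open>The principal branch as the unique continuation on a convex set\<close>

lemma hyp2F1_eqI:
  assumes S: "open S" "convex S" "0 \<in> S" "z \<in> S" and f: "f holomorphic_on S"
    and F: "f has_fps_expansion fps_hypergeo [a, b] [c] 1"
  shows "hyp2F1 a b c z = f z"
  unfolding hyp2F1_def
proof (rule the_equality)
  show "\<exists>S g. open S \<and> convex S \<and> 0 \<in> S \<and> z \<in> S \<and> g holomorphic_on S \<and>
      g has_fps_expansion fps_hypergeo [a, b] [c] 1 \<and> f z = g z"
    using assms by blast
next
  fix w assume "\<exists>S g. open S \<and> convex S \<and> 0 \<in> S \<and> z \<in> S \<and> g holomorphic_on S \<and>
      g has_fps_expansion fps_hypergeo [a, b] [c] 1 \<and> w = g z"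
  then obtain T g where T: "open T" "convex T" "0 \<in> T" "z \<in> T" and g: "g holomorphic_on T"
    and G: "g has_fps_expansion fps_hypergeo [a, b] [c] 1" and w: "w = g z" by blast
  have "eventually (\<lambda>z. f z = g z) (nhds 0)"
    using F G unfolding has_fps_expansion_def by (auto elim: eventually_elim2)
  then obtain U where U: "open U" "0 \<in> U" "\<And>z. z \<in> U \<Longrightarrow> f z = g z"
    unfolding eventually_nhds by blast
  \<comment> \<open>Near 0 both functions sum the same series, and the identity theorem carries the
    equality through the convex set \<open>S \<inter> T\<close>, which contains 0 and
    \<open>z\<close>.\<close>
  have "f z = g z"
  proof (rule analytic_continuation_open[of "U \<inter> (S \<inter> T)" "S \<inter> T" f g])
    show "connected (S \<inter> T)" using S T by (intro convex_connected convex_Int)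
    show "f holomorphic_on S \<inter> T" "g holomorphic_on S \<inter> T"
      using f g by (auto intro: holomorphic_on_subset)
    show "U \<inter> (S \<inter> T) \<noteq> {}" using U S T by blast
  qed (use U S T in auto)
  then show "w = f z" using w by simp
qed

lemma hyp2F1_eq_gauss_series:
  assumes "norm z < 1" shows "hyp2F1 a b c z = gauss_series a b c z"
  by (rule hyp2F1_eqI[of "ball 0 1"])
     (use assms in \<open>auto intro!: holomorphic_intros gauss_series_has_fps_expansion\<close>)

section \<open>Pfaff's transformation, first for formal power series\<close>

definition fps_one_minus_powr :: "complex \<Rightarrow> complex fps" where
  "fps_one_minus_powr a = Abs_fps (\<lambda>n. pochhammer a n / fact n)"

lemma fps_one_minus_powr_0: "fps_one_minus_powr 0 = 1"
  by (auto simp: fps_one_minus_powr_def fps_eq_iff pochhammer_0_left)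

lemma fps_one_minus_powr_mult:
  "fps_one_minus_powr a * fps_one_minus_powr b = fps_one_minus_powr (a + b)"
proof (rule fps_ext)
  fix n
  have "(fps_one_minus_powr a * fps_one_minus_powr b) $ n =
     (\<Sum>k\<le>n. pochhammer a k / fact k * (pochhammer b (n - k) / fact (n - k)))"
    by (simp add: fps_mult_nth fps_one_minus_powr_def atLeast0AtMost)
  also have "\<dots> = (\<Sum>k\<le>n. of_nat (n choose k) * pochhammer a k * pochhammer b (n - k)) / fact n"
    unfolding sum_divide_distrib by (intro sum.cong refl) (simp add: binomial_fact field_simps)
  also have "\<dots> = fps_one_minus_powr (a + b) $ n"
    by (simp add: pochhammer_binomial_sum fps_one_minus_powr_def)
  finally show "(fps_one_minus_powr a * fps_one_minus_powr b) $ n = fps_one_minus_powr (a + b) $ n"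
      .
qed

lemma fps_one_minus_powr_power: "fps_one_minus_powr a ^ k = fps_one_minus_powr (of_nat k * a)"
  by (induction k) (auto simp: fps_one_minus_powr_0 fps_one_minus_powr_mult algebra_simps)

lemma one_minus_powr_has_fps_expansion:
  "(\<lambda>z. (1 - z) powr (- a)) has_fps_expansion fps_one_minus_powr a"
proof (rule has_fps_expansionI)
  have "(\<lambda>n. fps_one_minus_powr a $ n * z ^ n) sums (1 - z) powr (- a)" if "norm z < 1"
      for z :: complex
  proof -
    have "(\<lambda>n. ((- a) gchoose n) * (- z) ^ n) sums (1 + (- z)) powr (- a)"
      using that by (intro gen_binomial_complex) auto
    moreover have "((- a) gchoose n) * (- z) ^ n = fps_one_minus_powr a $ n * z ^ n" for n
      by (simp add: gbinomial_pochhammer power_minus[of z] fps_one_minus_powr_def)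
    ultimately show ?thesis by simp
  qed
  moreover have "eventually (\<lambda>z::complex. z \<in> ball 0 1) (nhds 0)"
    by (intro eventually_nhds_in_open) auto
  ultimately show "eventually (\<lambda>z. (\<lambda>n. fps_one_minus_powr a $ n * z ^ n) sums (1 - z) powr (- a))
      (nhds 0)"
    by (auto elim: eventually_mono)
qed

text \<open>Pfaff's transformation on the level of coefficients amounts to the Chu--Vandermonde sum.\<close>

lemma fps_hypergeo_Pfaff:
  assumes c: "c \<notin> \<int>\<^sub>\<le>\<^sub>0"
  shows "fps_one_minus_powr a *
      (fps_hypergeo [a, c - b] [c] 1 oo (- (fps_X * fps_one_minus_powr 1))) =
    fps_hypergeo [a, b] [c] 1"
proof (rule fps_ext)
  fix n
  let ?G = "- (fps_X * fps_one_minus_powr 1)" and ?q = "gauss_coeff a (c - b) c"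
  have Gz: "(?G ^ k) $ j = 0" if "j < k" for j k
    using startsby_zero_power_prefix[of ?G k] that by simp
  \<comment> \<open>\<open>?G\<close> is the formal version of z / (z - 1) = - z / (1 - z), so its
    powers times a binomial series are again shifted binomial series.\<close>
  have G: "fps_one_minus_powr a * ?G ^ k = fps_const ((-1) ^ k) *
      (fps_X ^ k * fps_one_minus_powr (a + of_nat k))" for k
  proof -
    have "?G ^ k = (- 1) ^ k * (fps_X ^ k * fps_one_minus_powr (of_nat k))"
      by (subst power_minus) (simp add: power_mult_distrib fps_one_minus_powr_power)
    moreover have "(- 1) ^ k = fps_const ((-1) ^ k :: complex)"
      by (simp add: fps_const_power[symmetric] fps_const_neg[symmetric])
    ultimately show ?thesis
      by (simp add: fps_one_minus_powr_mult[symmetric] mult_ac)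
  qed
  have "(fps_one_minus_powr a * (fps_hypergeo [a, c - b] [c] 1 oo ?G)) $ n =
    (\<Sum>j=0..n. fps_one_minus_powr a $ j * (\<Sum>k=0..n-j. ?q k * (?G ^ k) $ (n - j)))"
    by (simp add: fps_mult_nth fps_compose_nth fps_hypergeo_nth_gauss del: fps_hypergeo_nth)
  \<comment> \<open>The added inner terms vanish because \<open>?G ^ k\<close> starts in degree k;
    over a rectangular range the two sums can be exchanged.\<close>
  also have "\<dots> = (\<Sum>j=0..n. fps_one_minus_powr a $ j * (\<Sum>k=0..n. ?q k * (?G ^ k) $ (n - j)))"
    by (intro sum.cong refl arg_cong2[of _ _ _ _ "(*)"] sum.mono_neutral_left) (auto simp: Gz)
  also have "\<dots> = (\<Sum>k=0..n. ?q k * (\<Sum>j=0..n. fps_one_minus_powr a $ j * (?G ^ k) $ (n - j)))"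
    unfolding sum_distrib_left by (subst sum.swap) (simp add: mult_ac)
  also have "\<dots> = (\<Sum>k=0..n. ?q k * (fps_one_minus_powr a * ?G ^ k) $ n)"
    by (simp add: fps_mult_nth)
  also have "\<dots> = (\<Sum>k=0..n. ?q k * ((-1) ^ k * (pochhammer (a + of_nat k) (n - k) / fact (n - k))))"
    unfolding G by (intro sum.cong refl) (simp add: fps_X_power_mult_nth fps_one_minus_powr_def)
  also have "\<dots> = (\<Sum>k=0..n. pochhammer a n / fact n *
      ((pochhammer (c - b) k * pochhammer (- (of_nat n)) k) /
      (of_nat (fact k) * pochhammer c k)))"
  proof (intro sum.cong refl)
    fix k assume k: "k \<in> {0..n}"
    have 1: "pochhammer a k * pochhammer (a + of_nat k) (n - k) = pochhammer a n"
      using k by (simp add: pochhammer_product[of k n a])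
    have "pochhammer (- of_nat n :: complex) k = (-1) ^ k * pochhammer (of_nat (n - k) + 1) k"
      using k by (simp add: pochhammer_minus of_nat_diff)
    also have "pochhammer (of_nat (n - k) + 1 :: complex) k = fact n / fact (n - k)"
      using pochhammer_product[of "n - k" n "1 :: complex"] k
      by (simp add: pochhammer_fact[symmetric] add.commute field_simps)
    finally have 2: "pochhammer (- of_nat n :: complex) k = (-1) ^ k * (fact n / fact (n - k))" .
    show "?q k * ((-1) ^ k * (pochhammer (a + of_nat k) (n - k) / fact (n - k))) =
      pochhammer a n / fact n * ((pochhammer (c - b) k * pochhammer (- (of_nat n)) k) /
          (of_nat (fact k) * pochhammer c k))"
      unfolding 2 1[symmetric] gauss_coeff_def by (simp add: field_simps)
  qed
  also have "\<dots> = pochhammer a n / fact n * (pochhammer (c - (c - b)) n / pochhammer c n)"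
    unfolding sum_distrib_left[symmetric]
  proof (subst Vandermonde_pochhammer)
    show "\<forall>i\<in>{0..<n}. c \<noteq> - of_nat i" using c minus_of_nat_in_nonpos_Ints by auto
  qed simp
  also have "\<dots> = fps_hypergeo [a, b] [c] 1 $ n"
    by simp
  finally show "(fps_one_minus_powr a * (fps_hypergeo [a, c - b] [c] 1 oo ?G)) $ n =
      fps_hypergeo [a, b] [c] 1 $ n" .
qed

text \<open>The condition says that z is closer to 0 than to 1.\<close>

lemma Pfaff_argument_norm:
  assumes "Re z < 1 / 2" shows "norm (z / (z - 1)) < 1"
proof -
  have "(norm z)\<^sup>2 < (norm (z - 1))\<^sup>2"
    unfolding cmod_power2 using assms by (simp add: power2_eq_square algebra_simps)
  then have "norm z < norm (z - 1)" by (rule power_less_imp_less_base) simp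
  then show ?thesis by (cases "z = 1") (auto simp: norm_divide)
qed

lemma Pfaff_has_fps_expansion:
  assumes c: "c \<notin> \<int>\<^sub>\<le>\<^sub>0"
  shows "(\<lambda>z. (1 - z) powr (- a) * gauss_series a (c - b) c (z / (z - 1))) has_fps_expansion
    fps_hypergeo [a, b] [c] 1"
proof -
  \<comment> \<open>The argument z / (z - 1) is written with \<open>powr\<close> to match the formal
    composition. The two forms agree off z = 1, hence near 0.\<close>
  have "(\<lambda>z::complex. - (z * (1 - z) powr (- 1))) has_fps_expansion -
      (fps_X * fps_one_minus_powr 1)"
    by (intro fps_expansion_intros one_minus_powr_has_fps_expansion)
  then have "(gauss_series a (c - b) c \<circ> (\<lambda>z. - (z * (1 - z) powr (- 1)))) has_fps_expansion
      (fps_hypergeo [a, c - b] [c] 1 oo (- (fps_X * fps_one_minus_powr 1)))"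
    by (intro has_fps_expansion_compose gauss_series_has_fps_expansion) auto
  from has_fps_expansion_mult[OF one_minus_powr_has_fps_expansion[of a] this]
  have "(\<lambda>z. (1 - z) powr (- a) * gauss_series a (c - b) c (- (z * (1 - z) powr (- 1))))
      has_fps_expansion
    fps_hypergeo [a, b] [c] 1"
    by (simp add: fps_hypergeo_Pfaff[OF c] o_def)
  moreover have "- (z * (1 - z) powr (- 1)) = z / (z - 1)" if "z \<noteq> 1" for z :: complex
  proof -
    have "(1 - z) powr (- 1) = inverse (1 - z)" using that by (simp only: powr_minus powr_to_1)
    moreover have "- (z * inverse (1 - z)) = z / (z - 1)"
      by (metis divide_inverse minus_diff_eq minus_divide_right)
    ultimately show ?thesis by simp
  qed
  moreover have "eventually (\<lambda>z::complex. z \<noteq> 1) (nhds 0)"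
    by (rule t1_space_nhds) simp
  ultimately show ?thesis
    unfolding has_fps_expansion_def by (auto elim: eventually_elim2)
qed

lemma Pfaff_holomorphic:
  "(\<lambda>z. (1 - z) powr (- a) * gauss_series a (c - b) c (z / (z - 1))) holomorphic_on {z. Re z < 1 /
      2}"
  by (intro holomorphic_intros Pfaff_argument_norm) (auto simp: complex_nonpos_Reals_iff)

text \<open>The half-plane is open, convex and contains 0, and the right-hand side continues the
  series there. In this way values on the whole negative axis become values of a convergent
  series.\<close>

theorem hyp2F1_Pfaff:
  assumes c: "c \<notin> \<int>\<^sub>\<le>\<^sub>0" and z: "Re z < 1 / 2"
  shows "hyp2F1 a b c z = (1 - z) powr (- a) * gauss_series a (c - b) c (z / (z - 1))"
  by (rule hyp2F1_eqI[OF _ _ _ _ Pfaff_holomorphic Pfaff_has_fps_expansion[OF c]])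
     (use z in \<open>auto intro: open_halfspace_Re_lt convex_halfspace_Re_lt simp
         del: less_divide_eq_numeral1\<close>)

text \<open>The union contains every real number below 1, hence all arguments that occur in the
  integrands.\<close>

lemma hyp2F1_holomorphic:
  assumes c: "c \<notin> \<int>\<^sub>\<le>\<^sub>0"
  shows "hyp2F1 a b c holomorphic_on (ball 0 1 \<union> {z. Re z < 1 / 2})"
proof (rule holomorphic_on_Un)
  show "hyp2F1 a b c holomorphic_on ball 0 1"
    by (rule holomorphic_transform[of "gauss_series a b c"])
       (auto intro!: holomorphic_intros simp: hyp2F1_eq_gauss_series)
  show "hyp2F1 a b c holomorphic_on {z. Re z < 1 / 2}"
    by (rule holomorphic_transform[OF Pfaff_holomorphic]) (use hyp2F1_Pfaff[OF c] in auto)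
qed (auto intro: open_halfspace_Re_lt simp del: less_divide_eq_numeral1)

section \<open>Dependence on the parameters\<close>

lemma Re_pos_not_nonpos_Ints: "Re c > 0 \<Longrightarrow> c \<notin> \<int>\<^sub>\<le>\<^sub>0"
  by (auto elim!: nonpos_Ints_cases)

lemma pochhammer_nonzero_Re_pos: "Re c > 0 \<Longrightarrow> pochhammer c n \<noteq> 0"
  by (auto simp: pochhammer_eq_0_iff)

text \<open>An arbitrary filter serves two purposes: \<open>nhds\<close> yields the locally uniform
  bounds behind holomorphy in the parameters, and constant sequences yield pointwise bounds.\<close>

lemma gauss_coeff_bound_filter:
  assumes a: "(a \<longlongrightarrow> a0) F" and b: "(b \<longlongrightarrow> b0) F" and c: "(c \<longlongrightarrow> c0) F"
    and c0: "Re c0 > 0" and s: "s > 0" "s > Re (a0 + b0 - c0)"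
  shows "\<exists>C\<ge>0. eventually (\<lambda>x. \<forall>n. norm (gauss_coeff (a x) (b x) (c x) n) \<le> C *
      (pochhammer s n / fact n)) F"
proof -
  define M where "M = norm a0 + norm b0 + norm c0 + 1"
  define d where "d = (s - Re (a0 + b0 - c0)) / 2"
  have d: "d > 0" using s by (simp add: d_def)
  \<comment> \<open>\<open>Re c0 / 2 \<le> Re c\<close> keeps \<open>c\<close> away from the poles
    and so bounds every single coefficient; the other conditions feed the uniform ratio
    estimate.\<close>
  define K where "K = {(a, b, c). norm a \<le> M \<and> norm b \<le> M \<and> norm c \<le> M \<and> Re c0 / 2 \<le> Re c \<and>
      Re (a + b - c) \<le> s - d}"
  have B: "\<exists>B. \<forall>(a, b, c)\<in>K. norm (gauss_coeff a b c n) \<le> B" for n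
  proof (induction n)
    case 0
    show ?case by (intro exI[of _ 1]) auto
  next
    case (Suc n)
    then obtain B where B: "\<And>a b c. (a, b, c) \<in> K \<Longrightarrow> norm (gauss_coeff a b c n) \<le> B" by fast
    have "norm (gauss_coeff a b c (Suc n)) \<le> B * ((M + n) * (M + n) / (Re c0 / 2 * 1))"
        if "(a, b, c) \<in> K" for a b c
    proof -
      have *: "norm a \<le> M" "norm b \<le> M" "Re c0 / 2 \<le> Re c" using that by (auto simp: K_def)
      have "norm (a + of_nat n) \<le> M + n" "norm (b + of_nat n) \<le> M + n"
        using * norm_triangle_ineq[of a "of_nat n"] norm_triangle_ineq[of b "of_nat n"] by auto
      moreover have "Re c0 / 2 \<le> norm (c + of_nat n)"
        using * complex_Re_le_cmod[of "c + of_nat n"] by simp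
      moreover have "1 \<le> norm (of_nat (Suc n) :: complex)" unfolding norm_of_nat by simp
      moreover have "0 \<le> B" using B[OF that] norm_ge_zero order_trans by blast
      moreover have "0 \<le> M + n" by (simp add: M_def)
      ultimately show ?thesis unfolding gauss_coeff_Suc norm_mult norm_divide
        using c0 B[OF that] by (intro mult_mono frac_le) auto
    qed
    then show ?case by blast
  qed
  obtain C where C: "C \<ge> 0" "\<forall>(a, b, c)\<in>K. \<forall>n. norm (gauss_coeff a b c n) \<le> C *
      (pochhammer s n / fact n)"
    using gauss_coeff_bound[of K M s d] B d s(1) unfolding K_def by blast
  have "eventually (\<lambda>x. norm (a x) < M) F" "eventually (\<lambda>x. norm (b x) < M) F"
      "eventually (\<lambda>x. norm (c x) < M) F"
    using order_tendstoD(2)[OF tendsto_norm[OF a]] order_tendstoD(2)[OF tendsto_norm[OF b]]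
        order_tendstoD(2)[OF tendsto_norm[OF c]]
    by (auto simp: M_def add_strict_increasing2 add_pos_nonneg)
  moreover have "eventually (\<lambda>x. Re c0 / 2 < Re (c x)) F"
    using order_tendstoD(1)[OF tendsto_Re[OF c], of "Re c0 / 2"] c0 by simp
  moreover have "((\<lambda>x. Re (a x + b x - c x)) \<longlongrightarrow> Re (a0 + b0 - c0)) F"
    by (intro tendsto_intros a b c)
  then have "eventually (\<lambda>x. Re (a x + b x - c x) < s - d) F"
    by (rule order_tendstoD) (use s in \<open>simp add: d_def field_simps\<close>)
  ultimately have "eventually (\<lambda>x. (a x, b x, c x) \<in> K) F"
    by eventually_elim (auto simp: K_def)
  then have "eventually (\<lambda>x. \<forall>n. norm (gauss_coeff (a x) (b x) (c x) n) \<le> C *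
      (pochhammer s n / fact n)) F"
    by eventually_elim (use C in auto)
  with C(1) show ?thesis by blast
qed

lemma gauss_series_bound_filter:
  assumes "(a \<longlongrightarrow> a0) F" "(b \<longlongrightarrow> b0) F" "(c \<longlongrightarrow> c0) F"
    "Re c0 > 0" "s > 0" "s > Re (a0 + b0 - c0)"
  shows "\<exists>C\<ge>0. eventually (\<lambda>x. \<forall>z. norm z < 1 \<longrightarrow>
    norm (gauss_series (a x) (b x) (c x) z) \<le> C * (1 - norm z) powr (- s)) F"
proof -
  obtain C where "C \<ge> 0" "eventually (\<lambda>x. \<forall>n. norm (gauss_coeff (a x) (b x) (c x) n) \<le> C *
      (pochhammer s n / fact n)) F"
    using gauss_coeff_bound_filter[OF assms] by blast
  from this(2) have "eventually (\<lambda>x. \<forall>z. norm z < 1 \<longrightarrow>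
      norm (gauss_series (a x) (b x) (c x) z) \<le> C * (1 - norm z) powr (- s)) F"
    by eventually_elim (use gauss_series_bound(1)[OF \<open>C \<ge> 0\<close>] in blast)
  with \<open>C \<ge> 0\<close> show ?thesis by blast
qed

text \<open>The strict inequalities for \<open>s\<close> leave room for the parameters to move and
  dominate the logarithm that occurs at 1 when a + b = c.\<close>

lemma hyp2F1_bound_near_1:
  assumes "(a \<longlongrightarrow> a0) F" "(b \<longlongrightarrow> b0) F" "(c \<longlongrightarrow> c0) F"
    "Re c0 > 0" "s > 0" "s > Re (a0 + b0 - c0)"
  shows "\<exists>C\<ge>0. eventually (\<lambda>x. \<forall>z\<in>{0..<1::real}.
    norm (hyp2F1 (a x) (b x) (c x) (of_real z)) \<le> C * (1 - z) powr (- s)) F"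
proof -
  obtain C where C: "C \<ge> 0" "eventually (\<lambda>x. \<forall>z. norm z < 1 \<longrightarrow>
    norm (gauss_series (a x) (b x) (c x) z) \<le> C * (1 - norm z) powr (- s)) F"
    using gauss_series_bound_filter[OF assms] by blast
  from C(2) have "eventually (\<lambda>x. \<forall>z\<in>{0..<1::real}.
      norm (hyp2F1 (a x) (b x) (c x) (of_real z)) \<le> C * (1 - z) powr (- s)) F"
  proof eventually_elim
    case (elim x)
    show ?case
    proof
      fix z :: real assume z: "z \<in> {0..<1}"
      then show "norm (hyp2F1 (a x) (b x) (c x) (of_real z)) \<le> C * (1 - z) powr (- s)"
        using elim[rule_format, of "of_real z"] by (simp add: hyp2F1_eq_gauss_series)
    qed
  qed
  with C(1) show ?thesis by blast
qed

lemma norm_of_real_powr: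
  "x > 0 \<Longrightarrow> norm (complex_of_real x powr a) = x powr Re a"
  by (simp add: norm_powr_real_powr)

text \<open>Towards minus infinity the function in general grows like the larger of
  \<open>(- z) powr (- Re a)\<close> and \<open>(- z) powr (- Re b)\<close>. Pfaff's transformation
  sends z to w with 1 - w = 1 / (1 - z), so a singularity of order s at w = 1 becomes growth of
  order s - Re a in z.\<close>

lemma hyp2F1_bound_neg:
  assumes a: "(a \<longlongrightarrow> a0) F" and b: "(b \<longlongrightarrow> b0) F" and c: "(c \<longlongrightarrow> c0) F"
    and c0: "Re c0 > 0" and e: "e > - Re a0" "e > - Re b0" and R: "0 \<le> R" "R < 1"
  shows "\<exists>C\<ge>0. eventually (\<lambda>x. \<forall>z\<le>R.
    norm (hyp2F1 (a x) (b x) (c x) (of_real z)) \<le> C * (1 - z) powr e) F"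
proof -
  \<comment> \<open>\<open>r\<close> is the margin by which \<open>Re (a x)\<close> may fall below
    \<open>Re a0\<close>; within it \<open>s - Re (a x)\<close> stays below \<open>e\<close>. The
    two terms of the minimum give s > 0 and s > Re (a0 - b0).\<close>
  define r where "r = min (e + Re a0) (e + Re b0) / 2"
  define s where "s = e + Re a0 - r"
  have r: "r > 0" "r < e + Re a0" "r < e + Re b0" using e by (auto simp: r_def min_def field_simps)
  have s: "s > 0" "s > Re (a0 + (c0 - b0) - c0)" using r by (auto simp: s_def)
  obtain C1 where C1: "C1 \<ge> 0" "eventually (\<lambda>x. \<forall>z. norm z < 1 \<longrightarrow>
    norm (gauss_series (a x) (c x - b x) (c x) z) \<le> C1 * (1 - norm z) powr (- s)) F"
    using gauss_series_bound_filter[OF a tendsto_diff[OF c b] c c0 s] by blast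
  define s' where "s' = \<bar>Re (a0 + b0 - c0)\<bar> + 1"
  have s': "s' > 0" "s' > Re (a0 + b0 - c0)" by (auto simp: s'_def)
  obtain C2 where C2: "C2 \<ge> 0" "eventually (\<lambda>x. \<forall>z\<in>{0..<1::real}.
    norm (hyp2F1 (a x) (b x) (c x) (of_real z)) \<le> C2 * (1 - z) powr (- s')) F"
    using hyp2F1_bound_near_1[OF a b c c0 s'] by blast
  \<comment> \<open>Between 0 and \<open>R\<close> the argument stays away from 1, and
    \<open>m\<close> bounds \<open>(1 - z) powr e\<close> from below for either sign of
    \<open>e\<close>.\<close>
  define m where "m = min 1 ((1 - R) powr e)"
  have m: "m > 0" using R by (auto simp: m_def)
  define C3 where "C3 = C2 * (1 - R) powr (- s') / m"
  have C3: "C3 \<ge> 0" using C2 m by (simp add: C3_def)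
  have "eventually (\<lambda>x. Re a0 - r < Re (a x)) F"
    using order_tendstoD(1)[OF tendsto_Re[OF a], of "Re a0 - r"] r by simp
  moreover have "eventually (\<lambda>x. 0 < Re (c x)) F"
    using order_tendstoD(1)[OF tendsto_Re[OF c], of 0] c0 by simp
  ultimately have "eventually (\<lambda>x. \<forall>z\<le>R.
    norm (hyp2F1 (a x) (b x) (c x) (of_real z)) \<le> (C1 + C3) * (1 - z) powr e) F"
    using C1(2) C2(2)
  proof eventually_elim
    case (elim x)
    show ?case
    proof (intro allI impI)
      fix z assume z: "z \<le> R"
      show "norm (hyp2F1 (a x) (b x) (c x) (of_real z)) \<le> (C1 + C3) * (1 - z) powr e"
      proof (cases "z \<le> 0")
        case True
        let ?w = "complex_of_real z / (of_real z - 1)"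
        have w: "?w = of_real (z / (z - 1))" by simp
        have nw: "norm ?w = z / (z - 1)" unfolding w norm_of_real using True
          by (intro abs_of_nonneg divide_nonpos_nonpos) auto
        have w1: "1 - z / (z - 1) = 1 / (1 - z)" using True by (simp add: field_simps)
        have "hyp2F1 (a x) (b x) (c x) (of_real z) =
          (1 - of_real z) powr (- a x) * gauss_series (a x) (c x - b x) (c x) ?w"
          by (rule hyp2F1_Pfaff) (use True elim(2) in \<open>auto simp: Re_pos_not_nonpos_Ints\<close>)
        then have "norm (hyp2F1 (a x) (b x) (c x) (of_real z)) =
            norm (of_real (1 - z) powr (- a x)) * norm (gauss_series (a x) (c x - b x) (c x) ?w)"
          by (simp add: norm_mult)
        also have "norm (of_real (1 - z) powr (- a x)) = (1 - z) powr (- Re (a x))"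
          using True by (subst norm_of_real_powr) auto
        also have "norm (gauss_series (a x) (c x - b x) (c x) ?w) \<le> C1 * (1 - norm ?w) powr (- s)"
          using elim(3)[rule_format, of ?w] Pfaff_argument_norm[of "of_real z"] True by simp
        also have "(1 - norm ?w) powr (- s) = (1 - z) powr s"
          unfolding nw w1 using True by (simp add: powr_minus powr_divide field_simps)
        also have "(1 - z) powr (- Re (a x)) * (C1 * (1 - z) powr s) = C1 *
            (1 - z) powr (s - Re (a x))"
          by (simp add: powr_add[symmetric] mult.left_commute)
        also have "\<dots> \<le> (C1 + C3) * (1 - z) powr e"
          using elim(1) C1(1) C3 True by (intro mult_mono powr_mono) (auto simp: s_def)
        finally show ?thesis by (simp add: mult_left_mono)
      next
        case False
        have "norm (hyp2F1 (a x) (b x) (c x) (of_real z)) \<le> C2 * (1 - z) powr (- s')"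
          using elim(4) z R False by auto
        also have "(1 - z) powr (- s') \<le> (1 - R) powr (- s')"
          using z R s' False by (intro powr_mono2') auto
        also have "C2 * (1 - R) powr (- s') = C3 * m" using m by (simp add: C3_def)
        also have "m \<le> (1 - z) powr e"
        proof (cases "e \<ge> 0")
          case True
          then have "(1 - R) powr e \<le> (1 - z) powr e" using z R by (intro powr_mono2) auto
          then show ?thesis by (simp add: m_def min.coboundedI2)
        next
          case e: False
          then have "1 powr e \<le> (1 - z) powr e" using z R False by (intro powr_mono2') auto
          then show ?thesis by (simp add: m_def min.coboundedI1)
        qed
        also have "C3 * (1 - z) powr e \<le> (C1 + C3) * (1 - z) powr e"
          using C1(1) by (intro mult_right_mono) auto
        finally show ?thesis using C2(1) C3 by (simp add: mult_left_mono)
      qed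
    qed
  qed
  with C1(1) C3 show ?thesis by (intro exI[of _ "C1 + C3"]) auto
qed

lemma pochhammer_holomorphic [holomorphic_intros]:
  "f holomorphic_on L \<Longrightarrow> (\<lambda>x. pochhammer (f x) n) holomorphic_on L"
  unfolding pochhammer_prod by (intro holomorphic_intros)

text \<open>The partial sums are rational expressions in the parameters, and the common majorant
  from \<open>gauss_coeff_bound_filter\<close> allows the M-test on a small disc.\<close>

lemma gauss_series_param_holomorphic:
  assumes L: "open L" and hol: "a holomorphic_on L" "b holomorphic_on L" "c holomorphic_on L"
    and c: "\<And>x. x \<in> L \<Longrightarrow> Re (c x) > 0" and z: "norm z < 1"
  shows "(\<lambda>x. gauss_series (a x) (b x) (c x) z) holomorphic_on L"
proof (rule holomorphic_uniform_sequence[OF L])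
  fix n show "(\<lambda>x. \<Sum>i<n. gauss_coeff (a x) (b x) (c x) i * z ^ i) holomorphic_on L"
    unfolding gauss_coeff_def
    by (intro holomorphic_intros hol) (auto simp: pochhammer_nonzero_Re_pos c)
next
  fix x assume x: "x \<in> L"
  have lim: "(f \<longlongrightarrow> f x) (nhds x)" if "f holomorphic_on L" for f :: "complex \<Rightarrow> complex"
    using that x L holomorphic_on_imp_continuous_on continuous_on_eq_continuous_at
    by (metis isCont_def tendsto_at_iff_tendsto_nhds)
  define s where "s = \<bar>Re (a x + b x - c x)\<bar> + 1"
  obtain C where C: "C \<ge> 0" "eventually (\<lambda>x. \<forall>n. norm (gauss_coeff (a x) (b x) (c x) n) \<le> C *
      (pochhammer s n / fact n)) (nhds x)"
    using gauss_coeff_bound_filter[OF hol[THEN lim] c[OF x], of s] by (fastforce simp: s_def)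
  have "eventually (\<lambda>x. x \<in> L) (nhds x)" using L x by (rule eventually_nhds_in_open)
  with C(2) have "eventually (\<lambda>x. x \<in> L \<and> (\<forall>n. norm (gauss_coeff (a x) (b x) (c x) n) \<le> C *
      (pochhammer s n / fact n))) (nhds x)"
    by eventually_elim auto
  then obtain d where d: "d > 0" "\<And>y. dist y x \<le> d \<Longrightarrow> y \<in> L \<and>
      (\<forall>n. norm (gauss_coeff (a y) (b y) (c y) n) \<le> C * (pochhammer s n / fact n))"
    unfolding eventually_nhds_metric_le by blast
  have S: "summable (\<lambda>n. C * (pochhammer s n / fact n * norm z ^ n))"
    using binomial_series_pochhammer[of "norm z" s] z by (intro summable_mult) (auto simp: sums_iff)
  have "uniform_limit (cball x d) (\<lambda>n x. \<Sum>i<n. gauss_coeff (a x) (b x) (c x) i * z ^ i)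
      (\<lambda>x. gauss_series (a x) (b x) (c x) z) sequentially"
    unfolding gauss_series_def
  proof (rule Weierstrass_m_test[OF _ S])
    fix n y assume "y \<in> cball x d"
    then have "norm (gauss_coeff (a y) (b y) (c y) n) \<le> C * (pochhammer s n / fact n)"
      using d(2)[of y] by (simp add: dist_commute)
    from mult_right_mono[OF this, of "norm z ^ n"]
    show "norm (gauss_coeff (a y) (b y) (c y) n * z ^ n) \<le> C *
        (pochhammer s n / fact n * norm z ^ n)"
      by (simp add: norm_mult norm_power mult.assoc)
  qed
  moreover have "cball x d \<subseteq> L" using d(2) by (auto simp: dist_commute)
  ultimately show "\<exists>d>0. cball x d \<subseteq> L \<and>
      uniform_limit (cball x d) (\<lambda>n x. \<Sum>i<n. gauss_coeff (a x) (b x) (c x) i * z ^ i)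
      (\<lambda>x. gauss_series (a x) (b x) (c x) z) sequentially"
    using d(1) by blast
qed

lemma hyp2F1_param_holomorphic:
  fixes z :: real
  assumes L: "open L" and hol: "a holomorphic_on L" "b holomorphic_on L" "c holomorphic_on L"
    and c: "\<And>x. x \<in> L \<Longrightarrow> Re (c x) > 0" and z: "z < 1"
  shows "(\<lambda>x. hyp2F1 (a x) (b x) (c x) (of_real z)) holomorphic_on L"
proof (cases "z > -1")
  case True
  then have "norm (complex_of_real z) < 1" using z by simp
  then show ?thesis
    by (simp add: hyp2F1_eq_gauss_series gauss_series_param_holomorphic[OF L hol c])
next
  case False
  have "(\<lambda>x. (1 - of_real z) powr (- a x) * gauss_series (a x) (c x - b x) (c x) (of_real z /
      (of_real z - 1))) holomorphic_on L"
    by (intro holomorphic_intros gauss_series_param_holomorphic L hol c Pfaff_argument_norm)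
        (use False in auto)
  then show ?thesis
    by (rule holomorphic_transform) (use False c in \<open>auto simp: hyp2F1_Pfaff
        Re_pos_not_nonpos_Ints\<close>)
qed

lemma hyp2F1_continuous_on_real:
  assumes "c \<notin> \<int>\<^sub>\<le>\<^sub>0"
  shows "continuous_on {..<1::real} (\<lambda>z. hyp2F1 a b c (of_real z))"
  by (rule continuous_on_compose2[OF holomorphic_on_imp_continuous_on[OF
      hyp2F1_holomorphic[OF assms]]])
     (auto intro!: continuous_intros simp: abs_if split: if_splits)

lemma set_borel_measurable_lborel_continuous:
  fixes f :: "real \<Rightarrow> 'a::real_normed_vector"
  assumes "S \<in> sets borel" "continuous_on S f"
  shows "set_borel_measurable lborel S f"
  using borel_measurable_continuous_on_indicator[OF assms] by (simp add: set_borel_measurable_def)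

lemma set_integrable_real_bound:
  fixes f :: "'a \<Rightarrow> complex" and h :: "'a \<Rightarrow> real"
  assumes "set_integrable M S h" "set_borel_measurable M S f" "\<And>t. t \<in> S \<Longrightarrow> norm (f t) \<le> h t"
  shows "set_integrable M S f"
proof (rule set_integrable_bound[OF assms(1,2)], rule AE_I2, rule impI)
  fix t assume "t \<in> S"
  with assms(3)[OF this] show "norm (f t) \<le> norm (h t)" by simp
qed

text \<open>Difference quotients are dominated by Cauchy's inequality, so no bound on the derivative of
  the integrand is needed.\<close>

lemma holomorphic_parametric_integral:
  fixes f :: "complex \<Rightarrow> 'a \<Rightarrow> complex"
  assumes L: "open L"
    and hol: "\<And>t. t \<in> S \<Longrightarrow> (\<lambda>x. f x t) holomorphic_on L"
    and meas: "\<And>x. x \<in> L \<Longrightarrow> set_borel_measurable M S (f x)"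
    and bound: "\<And>x. x \<in> L \<Longrightarrow> \<exists>h::'a \<Rightarrow> real. set_integrable M S h \<and>
      eventually (\<lambda>y. \<forall>t\<in>S. norm (f y t) \<le> h t) (nhds x)"
  shows "(\<lambda>x. LINT t:S|M. f x t) holomorphic_on L"
  unfolding holomorphic_on_open[OF L]
proof
  fix x assume x: "x \<in> L"
  obtain h :: "'a \<Rightarrow> real" where h: "set_integrable M S h"
    "eventually (\<lambda>y. \<forall>t\<in>S. norm (f y t) \<le> h t) (nhds x)"
    using bound[OF x] by blast
  have "eventually (\<lambda>y. y \<in> L) (nhds x)" using L x by (rule eventually_nhds_in_open)
  with h(2) have "eventually (\<lambda>y. y \<in> L \<and> (\<forall>t\<in>S. norm (f y t) \<le> h t)) (nhds x)"
    by eventually_elim auto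
  then obtain r where r: "r > 0" "\<And>y. dist y x \<le> r \<Longrightarrow> y \<in> L \<and> (\<forall>t\<in>S. norm (f y t) \<le> h t)"
    unfolding eventually_nhds_metric_le by blast
  have deriv: "((\<lambda>x. f x t) has_field_derivative deriv (\<lambda>x. f x t) y) (at y)" if "t \<in> S" "y \<in> L"
      for t y
    using hol[OF that(1)] L that(2) by (rule holomorphic_derivI)
  \<comment> \<open>The circle of radius r / 2 about y stays within distance r of x, where
    \<open>h\<close> dominates.\<close>
  have dbound: "norm (deriv (\<lambda>x. f x t) y) \<le> h t / (r / 2)" if t: "t \<in> S" and y: "dist y x \<le> r / 2"
      for t y
  proof -
    have near: "dist z x \<le> r" if "dist y z \<le> r / 2" for z
    proof -
      have "dist z x \<le> dist y z + dist y x" by (rule dist_triangle3)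
      then show ?thesis using that y by linarith
    qed
    then have sub: "cball y (r / 2) \<subseteq> L" using r(2) by auto
    have "norm ((deriv ^^ 1) (\<lambda>x. f x t) y) \<le> fact 1 * h t / (r / 2) ^ 1"
    proof (rule Cauchy_inequality)
      show "(\<lambda>x. f x t) holomorphic_on ball y (r / 2)"
        using hol[OF t] sub ball_subset_cball
            by (rule holomorphic_on_subset[OF _ subset_trans[rotated]])
      show "continuous_on (cball y (r / 2)) (\<lambda>x. f x t)"
        using hol[OF t] sub by (meson continuous_on_subset holomorphic_on_imp_continuous_on)
      show "norm (f z t) \<le> h t" if "norm (y - z) = r / 2" for z
        using r(2)[of z] near[of z] that t by (simp add: dist_norm)
    qed (use r in simp)
    then show ?thesis by simp
  qed
  have lip: "norm ((f y t - f x t) / (y - x)) \<le> h t / (r / 2)" if t: "t \<in> S"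
      and y: "dist y x \<le> r / 2" "y \<noteq> x" for t y
  proof -
    have "norm (f y t - f x t) \<le> h t / (r / 2) * norm (y - x)"
    proof (rule field_differentiable_bound[of "cball x (r / 2)" "\<lambda>x. f x t" "deriv (\<lambda>x. f x t)"])
      fix z assume "z \<in> cball x (r / 2)"
      then have z: "dist z x \<le> r / 2" by (simp add: dist_commute)
      then show "norm (deriv (\<lambda>x. f x t) z) \<le> h t / (r / 2)" by (rule dbound[OF t])
      have "z \<in> L" using r(2)[of z] z r(1) by simp
      then show "((\<lambda>x. f x t) has_field_derivative deriv (\<lambda>x. f x t) z) (at z within cball x (r /
          2))"
        using deriv[OF t] has_field_derivative_at_within by blast
    qed (use y r in \<open>auto simp: dist_commute\<close>)
    then show ?thesis using y(2) by (simp add: norm_divide field_simps)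
  qed
  have fint: "set_integrable M S (f y)" if "dist y x \<le> r" for y
    by (rule set_integrable_real_bound[OF h(1) meas]) (use r(2) that in auto)
  define D where "D = (LINT t:S|M. deriv (\<lambda>x. f x t) x)"
  have "((\<lambda>x. LINT t:S|M. f x t) has_field_derivative D) (at x)"
    unfolding has_field_derivative_iff tendsto_at_iff_sequentially o_def
  proof (intro allI impI)
    fix X assume X: "\<forall>i. X i \<in> UNIV - {x}" "X \<longlonglongrightarrow> x"
    have "eventually (\<lambda>n. dist (X n) x < r / 2) sequentially"
      using X(2) r(1) by (intro tendstoD) auto
    then obtain N where N: "\<And>n. n \<ge> N \<Longrightarrow> dist (X n) x < r / 2"
      unfolding eventually_sequentially by blast
    \<comment> \<open>The shift of the index puts all points into the small disc, where
      \<open>lip\<close> applies.\<close>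
    define q where "q n t = (f (X (n + N)) t - f x t) / (X (n + N) - x)" for n t
    have Xn: "dist (X (n + N)) x \<le> r / 2" "X (n + N) \<noteq> x" for n
      using N[of "n + N"] X(1) by auto
    have qint: "set_integrable M S (q n)" for n
      unfolding q_def using fint[of "X (n + N)"] fint[of x] Xn[of n] r(1)
      by (intro set_integrable_divide set_integral_diff) auto
    have lim: "(\<lambda>n. q n t) \<longlonglongrightarrow> deriv (\<lambda>x. f x t) x" if "t \<in> S" for t
      using deriv[OF that x] LIMSEQ_ignore_initial_segment[OF X(2), of N] Xn(2)
      unfolding has_field_derivative_iff tendsto_at_iff_sequentially o_def q_def by auto
    have "(\<lambda>n. LINT t:S|M. q n t) \<longlonglongrightarrow> D"
      unfolding D_def set_lebesgue_integral_def
    proof (rule integral_dominated_convergence[where w = "\<lambda>t. indicator S t *\<^sub>R (h t / (r / 2))"])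
      show q: "(\<lambda>t. indicator S t *\<^sub>R q n t) \<in> borel_measurable M" for n
        using qint[of n] unfolding set_integrable_def by auto
      have lim': "(\<lambda>n. indicator S t *\<^sub>R q n t) \<longlonglongrightarrow> indicator S t *\<^sub>R deriv (\<lambda>x. f x t) x" for t
        by (cases "t \<in> S") (auto intro: lim)
      show "(\<lambda>t. indicator S t *\<^sub>R deriv (\<lambda>x. f x t) x) \<in> borel_measurable M"
        by (rule borel_measurable_LIMSEQ_metric[OF q]) (rule lim')
      show "AE t in M. (\<lambda>n. indicator S t *\<^sub>R q n t) \<longlonglongrightarrow> indicator S t *\<^sub>R deriv (\<lambda>x. f x t) x"
        using lim' by (intro AE_I2)
      show "integrable M (\<lambda>t. indicator S t *\<^sub>R (h t / (r / 2)))"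
        using set_integrable_divide[OF h(1), of "r / 2"] r(1) unfolding set_integrable_def by auto
      show "AE t in M. norm (indicator S t *\<^sub>R q n t) \<le> indicator S t *\<^sub>R (h t / (r / 2))" for n
      proof (rule AE_I2)
        fix t show "norm (indicator S t *\<^sub>R q n t) \<le> indicator S t *\<^sub>R (h t / (r / 2))"
          using lip[of t, OF _ Xn(1)[of n] Xn(2)[of n]] by (cases "t \<in> S") (auto simp: q_def)
      qed
    qed
    moreover have "(LINT t:S|M. q n t) = ((LINT t:S|M. f (X (n + N)) t) - (LINT t:S|M. f x t)) /
        (X (n + N) - x)" for n
      unfolding q_def using fint[of "X (n + N)"] fint[of x] Xn[of n] r(1)
          by (simp add: set_integral_diff)
    ultimately have "(\<lambda>n. ((LINT t:S|M. f (X (n + N)) t) - (LINT t:S|M. f x t)) /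
        (X (n + N) - x)) \<longlonglongrightarrow> D"
      by simp
    then show "(\<lambda>n. ((LINT t:S|M. f (X n) t) - (LINT t:S|M. f x t)) / (X n - x)) \<longlonglongrightarrow> D"
      by (rule LIMSEQ_offset)
  qed
  then show "\<exists>D. ((\<lambda>x. LINT t:S|M. f x t) has_field_derivative D) (at x)" by blast
qed

section \<open>Substitution and convolution\<close>

text \<open>The underlying change of variables concerns absolute integrability for the completed
  measure; continuity gives Borel measurability, which carries it to \<open>lborel\<close>. The
  equation of values includes the divergent case, where both integrals are 0 by convention.\<close>

lemma set_integral_substitution_real:
  fixes f :: "real \<Rightarrow> complex" and g g' :: "real \<Rightarrow> real"
  assumes S: "S \<in> sets borel" and gS: "g ` S \<in> sets borel"
    and der: "\<And>s. s \<in> S \<Longrightarrow> (g has_field_derivative g' s) (at s)"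
    and inj: "inj_on g S" and f: "continuous_on (g ` S) f" and g': "continuous_on S g'"
  shows "set_integrable lborel (g ` S) f \<longleftrightarrow> set_integrable lborel S (\<lambda>s. \<bar>g' s\<bar> *\<^sub>R f (g s))"
    and "(LINT t:g ` S|lborel. f t) = (LINT s:S|lborel. \<bar>g' s\<bar> *\<^sub>R f (g s))"
proof -
  have g: "continuous_on S g"
    using der by (meson DERIV_continuous continuous_at_imp_continuous_on)
  have c: "continuous_on S (\<lambda>s. \<bar>g' s\<bar> *\<^sub>R f (g s))"
    by (intro continuous_intros g' continuous_on_compose2[OF f g]) auto
  have eq: "set_integrable lborel A h \<longleftrightarrow> h absolutely_integrable_on A" 
    and eq': "(LINT t:A|lborel. h t) = (LINT t:A|lebesgue. h t)"
    if "A \<in> sets borel" "continuous_on A h" for h :: "real \<Rightarrow> complex" and A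
  proof -
    have m: "(\<lambda>x. indicator A x *\<^sub>R h x) \<in> lborel \<rightarrow>\<^sub>M borel"
      using borel_measurable_continuous_on_indicator[OF that] by simp
    show "set_integrable lborel A h \<longleftrightarrow> h absolutely_integrable_on A"
      unfolding set_integrable_def integrable_completion[OF m] ..
    show "(LINT t:A|lborel. h t) = (LINT t:A|lebesgue. h t)"
      unfolding set_lebesgue_integral_def integral_completion[OF m] ..
  qed
  have S': "S \<in> sets lebesgue" using S by simp
  have main: "(\<lambda>s. \<bar>g' s\<bar> *\<^sub>R f (g s)) absolutely_integrable_on S \<and>
      integral S (\<lambda>s. \<bar>g' s\<bar> *\<^sub>R f (g s)) = b
      \<longleftrightarrow> f absolutely_integrable_on g ` S \<and> integral (g ` S) f = b" for b
    by (rule has_absolute_integral_change_of_variables_real[OF S' _ inj])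
       (rule has_field_derivative_at_within, rule der)
  have iff: "f absolutely_integrable_on g ` S \<longleftrightarrow> (\<lambda>s. \<bar>g' s\<bar> *\<^sub>R f (g s)) absolutely_integrable_on S"
    using main[of "integral S (\<lambda>s. \<bar>g' s\<bar> *\<^sub>R f (g s))"] main[of "integral (g ` S) f"] by argo
  then show "set_integrable lborel (g ` S) f \<longleftrightarrow> set_integrable lborel S (\<lambda>s. \<bar>g' s\<bar> *\<^sub>R f (g s))"
    by (simp only: eq[OF gS f] eq[OF S c])
  show "(LINT t:g ` S|lborel. f t) = (LINT s:S|lborel. \<bar>g' s\<bar> *\<^sub>R f (g s))"
  proof (cases "f absolutely_integrable_on g ` S")
    case True
    then show ?thesis using iff main
      unfolding eq'[OF gS f] eq'[OF S c] by (simp only: set_lebesgue_integral_eq_integral) metis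
  next
    case False
    then have "\<not> integrable lebesgue (\<lambda>x. indicator (g ` S) x *\<^sub>R f x)"
      "\<not> integrable lebesgue (\<lambda>x. indicator S x *\<^sub>R (\<bar>g' x\<bar> *\<^sub>R f (g x)))"
      using iff unfolding set_integrable_def by blast+
    then show ?thesis
      unfolding eq'[OF gS f] eq'[OF S c] unfolding set_lebesgue_integral_def
          by (simp only: not_integrable_integral_eq not_False_eq_True)
  qed
qed

lemma lborel_pair_integrable_product:
  fixes f g :: "real \<Rightarrow> complex"
  assumes f[measurable]: "integrable lborel f" and g[measurable]: "integrable lborel g"
  shows "integrable (lborel \<Otimes>\<^sub>M lborel) (\<lambda>(u, t). f (t - u) * g u)"
proof (rule lborel_pair.Fubini_integrable)
  have [measurable]: "f \<in> borel_measurable borel" "g \<in> borel_measurable borel" using f g by auto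
  show "(\<lambda>(u, t). f (t - u) * g u) \<in> borel_measurable (lborel \<Otimes>\<^sub>M lborel)"
    by measurable
  have "(LINT t|lborel. norm (f (t - u) * g u)) = (LINT t|lborel. norm (f t)) * norm (g u)" for u
    using lborel_integral_real_affine[of 1 "\<lambda>t. norm (f t)" "-u"] by (simp add: norm_mult)
  then show "integrable lborel (\<lambda>u. LINT t|lborel. norm (case (u, t) of (u, t) \<Rightarrow> f (t - u) * g u))"
    using g by simp
  show "AE u in lborel. integrable lborel (\<lambda>t. case (u, t) of (u, t) \<Rightarrow> f (t - u) * g u)"
    using lborel_integrable_real_affine[OF f, of 1 "- _"] by (intro AE_I2) simp
qed

text \<open>Fubini and translation invariance. For functions with a factor
  \<open>exp (- p * s)\<close> this is the convolution theorem of the Laplace transform.\<close>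

lemma integral_convolution:
  fixes f g :: "real \<Rightarrow> complex"
  assumes f: "integrable lborel f" and g: "integrable lborel g"
  shows "integrable lborel (\<lambda>t. LINT u|lborel. f (t - u) * g u)"
    and "(LINT t|lborel. LINT u|lborel. f (t - u) * g u) = (LINT t|lborel. f t) *
        (LINT u|lborel. g u)"
proof -
  note I = lborel_pair_integrable_product[OF f g]
  show "integrable lborel (\<lambda>t. LINT u|lborel. f (t - u) * g u)"
    using lborel_pair.integrable_snd[OF I] by simp
  have "(LINT t|lborel. LINT u|lborel. f (t - u) * g u) = (LINT u|lborel. LINT t|lborel. f (t - u) *
      g u)"
    using lborel_pair.Fubini_integral[OF I] by simp
  also have "(\<lambda>u. LINT t|lborel. f (t - u) * g u) = (\<lambda>u. (LINT t|lborel. f t) * g u)"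
  proof
    fix u show "(LINT t|lborel. f (t - u) * g u) = (LINT t|lborel. f t) * g u"
      using lborel_integral_real_affine[of 1 f "-u"] by simp
  qed
  finally show "(LINT t|lborel. LINT u|lborel. f (t - u) * g u) = (LINT t|lborel. f t) *
      (LINT u|lborel. g u)"
    by simp
qed

section \<open>Beta, Gamma and Euler integrals\<close>

lemma of_real_powr_eq_exp: "x > 0 \<Longrightarrow> complex_of_real x powr a = exp (a * of_real (ln x))"
  by (simp add: powr_def Ln_of_real)

lemma of_real_powr_mult:
  "x > 0 \<Longrightarrow> y > 0 \<Longrightarrow> complex_of_real (x * y) powr a = of_real x powr a * of_real y powr a"
  by (simp add: of_real_powr_eq_exp ln_mult exp_add[symmetric] algebra_simps del: of_real_mult)

lemma continuous_on_of_real_powr [continuous_intros]: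
  "continuous_on S f \<Longrightarrow> (\<And>t. t \<in> S \<Longrightarrow> f t > 0) \<Longrightarrow> continuous_on S (\<lambda>t. complex_of_real (f t) powr a)"
  by (intro continuous_on_powr_complex continuous_intros) (force simp: less_imp_le)+

lemma Gamma_integral_lborel:
  assumes "Re a > 0" "c > 0"
  shows "set_integrable lborel {0<..} (\<lambda>t. of_real t powr (a - 1) * exp (- of_real (c * t)))"
    and "(LINT t:{0<..}|lborel. of_real t powr (a - 1) * exp (- of_real (c * t))) = Gamma a *
        of_real c powr (- a)"
proof -
  have c: "continuous_on {0<..} (\<lambda>t. complex_of_real t powr (a - 1) * exp (- of_real (c * t)))"
      for c
    by (intro continuous_intros) auto
  note m = borel_measurable_continuous_on_indicator[OF _ c]
  have E: "exp (- of_real (c * t)) = inverse (complex_of_real (exp (c * t)))" for c t :: real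
    by (simp only: exp_minus exp_of_real)
  show 1: "set_integrable lborel {0<..} (\<lambda>t. of_real t powr (a - 1) * exp (- of_real (c * t)))"
    using absolutely_integrable_Gamma_integral[OF assms] m[of c]
    unfolding set_integrable_def E divide_inverse by (simp add: integrable_completion)
  have base: "(LINT t:{0<..}|lborel. of_real t powr (a - 1) * exp (- complex_of_real t)) = Gamma a"
  proof -
    have I: "(\<lambda>t. of_real t powr (a - 1) * exp (- complex_of_real t)) absolutely_integrable_on
        {0<..}"
      using absolutely_integrable_Gamma_integral[OF assms(1), of 1]
          by (simp add: exp_minus divide_inverse exp_of_real)
    have "(LINT t:{0<..}|lborel. of_real t powr (a - 1) * exp (- complex_of_real t)) =
      (LINT t:{0<..}|lebesgue. of_real t powr (a - 1) * exp (- complex_of_real t))"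
      using m[of 1] unfolding set_lebesgue_integral_def by (simp add: integral_completion)
    also have "\<dots> = integral {0<..} (\<lambda>t. of_real t powr (a - 1) * exp (- complex_of_real t))"
      using I by (rule set_lebesgue_integral_eq_integral)
    also have "\<dots> = Gamma a"
      using Gamma_integral_complex'[OF assms(1)]
      by (simp add: exp_minus divide_inverse exp_of_real has_integral_iff)
    finally show ?thesis .
  qed
  have im: "(*) (1 / c) ` {0<..} = {0<..}"
  proof (intro equalityI subsetI)
    fix x :: real assume "x \<in> {0<..}"
    then show "x \<in> (*) (1 / c) ` {0<..}" using assms(2) by (intro image_eqI[of _ _ "c * x"]) auto
  qed (use assms(2) in auto)
  have inj: "inj_on ((*) (1 / c)) {0<..}" using assms(2) by (auto intro!: inj_onI)
  have "(LINT t:{0<..}|lborel. of_real t powr (a - 1) * exp (- of_real (c * t))) =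
    (LINT s:{0<..}|lborel. \<bar>1 / c\<bar> *\<^sub>R (of_real (1 / c * s) powr (a - 1) * exp
        (- of_real (c * (1 / c * s)))))"
    using set_integral_substitution_real(2)[of "{0<..}" "(*) (1 / c)" "\<lambda>_. 1 / c"
        "\<lambda>t. of_real t powr (a - 1) * exp (- of_real (c * t))"]
      assms(2) c[of c] inj unfolding im by (auto intro!: derivative_eq_intros)
  also have "\<dots> = (LINT s:{0<..}|lborel. of_real c powr (- a) *
      (of_real s powr (a - 1) * exp (- complex_of_real s)))"
  proof (intro set_lebesgue_integral_cong, simp, intro allI impI)
    fix s :: real assume s: "s \<in> {0<..}"
    have 1: "of_real (1 / c * s) powr (a - 1) = of_real (1 / c) powr (a - 1) *
        complex_of_real s powr (a - 1)"
      using s assms by (intro of_real_powr_mult) auto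
    have "\<bar>1 / c\<bar> *\<^sub>R of_real (1 / c) powr (a - 1) = complex_of_real (1 / c) powr a"
      using assms(2) powr_add[of "complex_of_real (1 / c)" "a - 1" 1]
          by (simp add: scaleR_conv_of_real mult.commute)
    also have "complex_of_real (1 / c) powr a = of_real c powr (- a)"
      using assms(2) by (simp add: of_real_powr_eq_exp ln_div del: of_real_divide)
    finally have 2: "\<bar>1 / c\<bar> *\<^sub>R of_real (1 / c) powr (a - 1) = of_real c powr (- a)" .
    have 3: "c * (1 / c * s) = s" using assms(2) by simp
    show "\<bar>1 / c\<bar> *\<^sub>R (of_real (1 / c * s) powr (a - 1) * exp (- of_real (c * (1 / c * s)))) =
      of_real c powr (- a) * (of_real s powr (a - 1) * exp (- complex_of_real s))"
      unfolding 1 3 2[symmetric] by (simp only: mult_scaleR_left mult.assoc)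
  qed
  also have "\<dots> = of_real c powr (- a) * Gamma a"
    by (simp only: set_integral_mult_right base)
  finally show "(LINT t:{0<..}|lborel. of_real t powr (a - 1) * exp (- of_real (c * t))) = Gamma a *
      of_real c powr (- a)"
    by (simp only: mult.commute)
qed

lemma Beta_integral_integrable:
  assumes "Re a > 0" "Re b > 0"
  shows "set_integrable lborel {0<..<1} (\<lambda>v. of_real v powr (a - 1) * of_real (1 - v) powr (b - 1))"
proof (rule set_integrable_real_bound)
  show "set_integrable lborel {0<..<1} (\<lambda>v. v powr (Re a - 1) * (1 - v) powr (Re b - 1))"
    using integrable_Beta[OF assms] by (rule set_integrable_subset) auto
  show "set_borel_measurable lborel {0<..<1} (\<lambda>v. of_real v powr (a - 1) *
      of_real (1 - v) powr (b - 1))"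
    by (rule set_borel_measurable_lborel_continuous)
       (auto intro!: continuous_intros simp del: of_real_diff)
qed (auto simp: norm_mult norm_of_real_powr simp del: of_real_diff)

lemma Beta_integral_scaled:
  fixes a b :: complex
  assumes t: "t > 0"
  shows "(LINT u:{0<..<t}|lborel. of_real u powr (a - 1) * of_real (t - u) powr (b - 1)) =
    of_real t powr (a + b - 1) * (LINT v:{0<..<1}|lborel. of_real v powr (a - 1) * of_real (1 - v)
        powr (b - 1))"
proof -
  have im: "(*) t ` {0<..<1} = {0<..<t}"
  proof (intro equalityI subsetI)
    fix x :: real assume "x \<in> {0<..<t}"
    then show "x \<in> (*) t ` {0<..<1}" using t by (intro image_eqI[of _ _ "x / t"]) auto
  qed (use t in auto)
  have inj: "inj_on ((*) t) {0<..<1}" using t by (auto intro!: inj_onI)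
  have "(LINT u:{0<..<t}|lborel. of_real u powr (a - 1) * of_real (t - u) powr (b - 1)) =
    (LINT v:{0<..<1}|lborel. \<bar>t\<bar> *\<^sub>R (of_real (t * v) powr (a - 1) * of_real (t - t * v) powr
        (b - 1)))"
    unfolding im[symmetric]
    by (rule set_integral_substitution_real(2))
        (use t inj in \<open>auto simp: im intro!: derivative_eq_intros continuous_intros simp
        del: of_real_diff of_real_mult\<close>)
  also have "\<dots> = (LINT v:{0<..<1}|lborel. of_real t powr (a + b - 1) *
      (of_real v powr (a - 1) * of_real (1 - v) powr (b - 1)))"
  proof (intro set_lebesgue_integral_cong, simp, intro allI impI)
    fix v :: real assume v: "v \<in> {0<..<1}"
    have 1: "t - t * v = t * (1 - v)" by (simp add: algebra_simps)
    have "of_real t * (of_real t powr (a - 1) * of_real t powr (b - 1)) =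
        complex_of_real t powr (a + b - 1)"
      using powr_add[of "complex_of_real t" 1 "a - 1"] powr_add[of "complex_of_real t" a "b - 1"] t
      by (simp add: algebra_simps)
    then show "\<bar>t\<bar> *\<^sub>R (of_real (t * v) powr (a - 1) * of_real (t - t * v) powr (b - 1)) =
      of_real t powr (a + b - 1) * (of_real v powr (a - 1) * of_real (1 - v) powr (b - 1))"
      unfolding 1 using v t
      by (simp add: of_real_powr_mult scaleR_conv_of_real mult_ac del: of_real_mult of_real_diff)
  qed
  finally show ?thesis by simp
qed

text \<open>The functions t^(c - 1) exp (- t) on the half-line are closed under convolution up to
  the constant \<open>B\<close>; comparing total masses gives Gamma a * Gamma b = B * Gamma (a +
  b).\<close>

theorem Beta_integral_complex:
  assumes a: "Re a > 0" and b: "Re b > 0"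
  shows "(LINT v:{0<..<1}|lborel. of_real v powr (a - 1) * of_real (1 - v) powr (b - 1)) = Beta a b"
proof -
  define f where "f c t = indicator {0<..} t *\<^sub>R (of_real t powr (c - 1) *
      exp (- complex_of_real t))" for c t
  define B where "B = (LINT v:{0<..<1}|lborel. of_real v powr (a - 1) *
      of_real (1 - v) powr (b - 1))"
  have f: "integrable lborel (f c)" "(LINT t|lborel. f c t) = Gamma c" if "Re c > 0" for c
    using Gamma_integral_lborel[OF that, of 1]
        unfolding f_def set_integrable_def set_lebesgue_integral_def by auto
  have ab: "Re (a + b) > 0" using a b by simp
  have inner: "(LINT u|lborel. f b (t - u) * f a u) = B * f (a + b) t" for t
  proof (cases "t > 0")
    case True
    have "f b (t - u) * f a u = indicator {0<..<t} u *\<^sub>R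
        (exp (- of_real t) * (of_real u powr (a - 1) * of_real (t - u) powr (b - 1)))" for u
      by (auto simp: f_def indicator_def exp_minus exp_diff field_simps)
    then have "(LINT u|lborel. f b (t - u) * f a u) = (LINT u:{0<..<t}|lborel.
        exp (- of_real t) * (of_real u powr (a - 1) * of_real (t - u) powr (b - 1)))"
      by (simp only: set_lebesgue_integral_def)
    also have "\<dots> = exp (- of_real t) * (LINT u:{0<..<t}|lborel. of_real u powr (a - 1) *
        of_real (t - u) powr (b - 1))"
      by (rule set_integral_mult_right)
    also have "\<dots> = exp (- of_real t) * (of_real t powr (a + b - 1) * B)"
      unfolding B_def Beta_integral_scaled[OF True] ..
    finally show ?thesis using True by (simp add: f_def mult_ac)
  next
    case False
    then have "(\<lambda>u. f b (t - u) * f a u) = (\<lambda>u. 0)" by (auto simp: f_def indicator_def)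
    then show ?thesis using False by (simp only: integral_zero) (simp add: f_def)
  qed
  have "Gamma b * Gamma a = (LINT t|lborel. LINT u|lborel. f b (t - u) * f a u)"
    using integral_convolution(2)[OF f(1)[OF b] f(1)[OF a]] f(2)[OF a] f(2)[OF b] by simp
  also have "\<dots> = B * Gamma (a + b)" unfolding inner using f(2)[OF ab] by simp
  finally have "B = Beta a b"
    using ab Gamma_nonzero[OF Re_pos_not_nonpos_Ints[OF ab]] by (simp add: Beta_def field_simps)
  then show ?thesis by (simp add: B_def)
qed

lemma Gamma_shift:
  assumes "Re a > 0" shows "Gamma (a + of_nat n) = Gamma a * pochhammer a n"
  using pochhammer_Gamma[OF Re_pos_not_nonpos_Ints[OF assms], of n]
      Gamma_nonzero[OF Re_pos_not_nonpos_Ints[OF assms]]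
  by (simp add: field_simps)

text \<open>Common source of Euler's integral (binomial series) and Kummer's integral (exponential
  series). Absolute convergence at v = 1 dominates the whole interval, and the n-th term integrates
  to a multiple of Beta (a + n) b.\<close>

lemma Beta_integral_power_series:
  assumes a: "Re a > 0" and b: "Re b > 0" and q: "summable (\<lambda>n. norm (q n))"
  shows "(LINT v:{0<..<1}|lborel. of_real v powr (a - 1) * of_real (1 - v) powr (b - 1) *
      (\<Sum>n. q n * of_real v ^ n)) =
    Beta a b * (\<Sum>n. q n * (pochhammer a n / pochhammer (a + b) n))"
proof -
  let ?w = "\<lambda>v. of_real v powr (a - 1) * of_real (1 - v) powr (b - 1) :: complex"
  define f where "f n v = indicator {0<..<1} v *\<^sub>R (?w v * (q n * of_real v ^ n))" for n
      and v :: real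
  have eq: "f n v = q n *
      (indicator {0<..<1} v *\<^sub>R (of_real v powr (a + of_nat n - 1) * of_real (1 - v) powr (b - 1)))"
      for n v
  proof (cases "v \<in> {0<..<1}")
    case True
    then have "of_real v powr (a + of_nat n - 1) = of_real v powr (a - 1) * complex_of_real v ^ n"
      using powr_add[of "complex_of_real v" "a - 1" "of_nat n"] powr_nat'[of "complex_of_real v" n]
      by (auto simp: algebra_simps powr_nat)
    then show ?thesis by (simp add: f_def)
  qed (simp add: f_def)
  have an: "Re (a + of_nat n) > 0" for n using a by simp
  have int: "integrable lborel (f n)" for n
    unfolding eq using Beta_integral_integrable[OF an[of n] b]
    unfolding set_integrable_def by (rule integrable_mult_right)
  have val: "(LINT v|lborel. f n v) = Beta a b * (q n * (pochhammer a n / pochhammer (a + b) n))"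
      for n
  proof -
    have "(LINT v|lborel. f n v) = q n * Beta (a + of_nat n) b"
      unfolding eq integral_mult_right_zero Beta_integral_complex[OF an[of n] b, symmetric]
          set_lebesgue_integral_def ..
    also have "Beta (a + of_nat n) b = Beta a b * (pochhammer a n / pochhammer (a + b) n)"
      using a b Gamma_shift[of a n] Gamma_shift[of "a + b" n] by (simp add: Beta_def add_ac)
    finally show ?thesis by simp
  qed
  define W where "W = (LINT v:{0<..<1}|lborel. norm (?w v))"
  have wi: "integrable lborel (\<lambda>v. indicator {0<..<1} v *\<^sub>R norm (?w v))"
    using set_integrable_norm[OF Beta_integral_integrable[OF a b]] unfolding set_integrable_def .
  have nf: "norm (f n v) \<le> norm (q n) * (indicator {0<..<1} v *\<^sub>R norm (?w v))" for n v
  proof (cases "v \<in> {0<..<1}")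
    case True
    then have "norm (complex_of_real v ^ n) \<le> 1" by (simp add: norm_power power_le_one)
    then have "norm (?w v) * (norm (q n) * norm (complex_of_real v ^ n)) \<le> norm (?w v) *
        (norm (q n) * 1)"
      by (intro mult_left_mono) auto
    then show ?thesis using True by (simp add: f_def norm_mult mult_ac)
  qed (simp add: f_def)
  have "(\<lambda>n. LINT v|lborel. f n v) sums (LINT v|lborel. (\<Sum>n. f n v))"
  proof (rule sums_integral[OF int])
    show "AE v in lborel. summable (\<lambda>n. norm (f n v))"
      by (intro AE_I2 summable_comparison_test'[OF summable_mult2[OF q]]) (use nf in simp)
    have "(LINT v|lborel. norm (f n v)) \<le> norm (q n) * W" for n
      using integral_mono[OF integrable_norm[OF int[of n]]
          integrable_mult_right[OF wi, of "norm (q n)"] nf]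
      by (simp add: W_def set_lebesgue_integral_def)
    then show "summable (\<lambda>n. LINT v|lborel. norm (f n v))"
      by (intro summable_comparison_test'[OF summable_mult2[OF q, of W]]) simp
  qed
  also have "(LINT v|lborel. (\<Sum>n. f n v)) =
      (LINT v:{0<..<1}|lborel. ?w v * (\<Sum>n. q n * of_real v ^ n))"
    unfolding set_lebesgue_integral_def
  proof (intro Bochner_Integration.integral_cong refl)
    fix v :: real
    show "(\<Sum>n. f n v) = indicator {0<..<1} v *\<^sub>R (?w v * (\<Sum>n. q n * of_real v ^ n))"
    proof (cases "v \<in> {0<..<1}")
      case True
      have "summable (\<lambda>n. q n * of_real v ^ n)"
      proof (rule summable_comparison_test'[OF q])
        show "norm (q n * of_real v ^ n) \<le> norm (q n)" for n
          using True by (simp add: norm_mult norm_power power_le_one mult_left_le)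
      qed
      from suminf_mult[OF this, of "?w v"] show ?thesis using True by (simp add: f_def)
    qed (simp add: f_def)
  qed
  finally have S: "(\<lambda>n. Beta a b * (q n * (pochhammer a n / pochhammer (a + b) n))) sums
      (LINT v:{0<..<1}|lborel. ?w v * (\<Sum>n. q n * of_real v ^ n))"
    unfolding val .
  have nz: "Beta a b \<noteq> 0"
    unfolding Beta_def using a b by (auto simp: Gamma_eq_zero_iff Re_pos_not_nonpos_Ints)
  from sums_unique[OF sums_mult_D[OF S nz]] nz show ?thesis by (simp add: field_simps)
qed

lemma Euler_integral_integrable:
  assumes "Re b > 0" "Re d > 0" "z < 1"
  shows "set_integrable lborel {0<..<1}
    (\<lambda>v. of_real v powr (b - 1) * of_real (1 - v) powr (d - 1) * of_real (1 - z * v) powr (- a))"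
proof -
  have pos: "1 - z * v > 0" if "v \<in> {0..1}" for v
  proof (cases "z \<le> 0")
    case True
    then have "z * v \<le> 0" using that by (simp add: mult_nonpos_nonneg)
    then show ?thesis by simp
  next
    case False
    then have "z * v \<le> z * 1" using that by (intro mult_left_mono) auto
    then show ?thesis using assms(3) by simp
  qed
  have c: "continuous_on {0..1} (\<lambda>v. complex_of_real (1 - z * v) powr (- a))"
    by (intro continuous_intros pos) auto
  obtain K where "\<forall>w\<in>(\<lambda>v. complex_of_real (1 - z * v) powr (- a)) ` {0..1}. norm w \<le> K"
    using compact_imp_bounded[OF compact_continuous_image[OF c]] unfolding bounded_iff by blast
  then have K: "\<And>v. v \<in> {0..1} \<Longrightarrow> norm (complex_of_real (1 - z * v) powr (- a)) \<le> K" by blast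
  show ?thesis
  proof (rule set_integrable_real_bound)
    show "set_integrable lborel {0<..<1} (\<lambda>v. norm (complex_of_real v powr (b - 1) *
        of_real (1 - v) powr (d - 1)) * K)"
      by (intro set_integrable_mult_left set_integrable_norm Beta_integral_integrable assms)
    show "set_borel_measurable lborel {0<..<1}
      (\<lambda>v. of_real v powr (b - 1) * of_real (1 - v) powr (d - 1) * of_real (1 - z * v) powr (- a))"
      by (rule set_borel_measurable_lborel_continuous)
         (auto intro!: continuous_intros pos simp del: of_real_diff of_real_mult)
    show "norm (of_real v powr (b - 1) * of_real (1 - v) powr (d - 1) *
        of_real (1 - z * v) powr (- a))
       \<le> norm (complex_of_real v powr (b - 1) * of_real (1 - v) powr (d - 1)) * K" if "v \<in>
           {0<..<1}" for v
      using K[of v] that by (subst norm_mult, intro mult_left_mono) auto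
  qed
qed

lemma Euler_integral_ball:
  assumes b: "Re b > 0" and d: "Re d > 0" and z: "\<bar>z\<bar> < 1"
  shows "(LINT v:{0<..<1}|lborel. of_real v powr (b - 1) * of_real (1 - v) powr (d - 1) *
      of_real (1 - z * v) powr (- a)) =
    Beta b d * gauss_series a b (b + d) (of_real z)"
proof -
  define q where "q n = pochhammer a n / fact n * of_real z ^ n" for n
  \<comment> \<open>Binomial coefficients are Gauss coefficients with b = c = 1, which makes
    \<open>gauss_series_summable\<close> applicable.\<close>
  have q': "q n = gauss_coeff a 1 1 n * of_real z ^ n" for n
    by (simp add: q_def gauss_coeff_def pochhammer_fact[symmetric])
  have q: "summable (\<lambda>n. norm (q n))"
    unfolding q' using z by (intro gauss_series_summable) simp
  have "(LINT v:{0<..<1}|lborel. of_real v powr (b - 1) * of_real (1 - v) powr (d - 1) *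
      of_real (1 - z * v) powr (- a)) =
     (LINT v:{0<..<1}|lborel. of_real v powr (b - 1) * of_real (1 - v) powr (d - 1) *
         (\<Sum>n. q n * of_real v ^ n))"
  proof (intro set_lebesgue_integral_cong, simp, intro allI impI)
    fix v :: real assume v: "v \<in> {0<..<1}"
    have "\<bar>z * v\<bar> \<le> \<bar>z\<bar> * 1" unfolding abs_mult using v by (intro mult_left_mono) auto
    then have "norm (complex_of_real (z * v)) < 1" using z by (simp only: norm_of_real)
    then have "(\<lambda>n. ((- a) gchoose n) * (- complex_of_real (z * v)) ^ n) sums (1 +
        (- complex_of_real (z * v))) powr (- a)"
      by (intro gen_binomial_complex) auto
    moreover have "((- a) gchoose n) * (- complex_of_real (z * v)) ^ n = q n * of_real v ^ n" for n
      by (simp add: gbinomial_pochhammer power_minus[of "_ * _"] q_def power_mult_distrib)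
    ultimately have "complex_of_real (1 - z * v) powr (- a) = (\<Sum>n. q n * of_real v ^ n)"
      by (simp add: sums_iff)
    then show "of_real v powr (b - 1) * of_real (1 - v) powr (d - 1) *
        of_real (1 - z * v) powr (- a) =
      of_real v powr (b - 1) * of_real (1 - v) powr (d - 1) * (\<Sum>n. q n * of_real v ^ n)" by simp
  qed
  also have "\<dots> = Beta b d * (\<Sum>n. q n * (pochhammer b n / pochhammer (b + d) n))"
    by (rule Beta_integral_power_series[OF b d q])
  also have "(\<lambda>n. q n * (pochhammer b n / pochhammer (b + d) n)) =
      (\<lambda>n. gauss_coeff a b (b + d) n * of_real z ^ n)"
    by (auto simp: q_def gauss_coeff_def field_simps)
  finally show ?thesis by (simp add: gauss_series_def)
qed

text \<open>For \<open>z \<le> -1\<close> the reflection of v to 1 - v gives 1 - z (1 - v) = (1 - z)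
  (1 - w v), where w = z / (z - 1) lies in the unit disc. The outcome is Pfaff's form of
  \<open>hyp2F1\<close>, reached without continuation in z.\<close>

theorem Euler_integral:
  assumes b: "Re b > 0" and d: "Re d > 0" and z: "z < 1"
  shows "(LINT v:{0<..<1}|lborel. of_real v powr (b - 1) * of_real (1 - v) powr (d - 1) *
      of_real (1 - z * v) powr (- a)) =
    Beta b d * hyp2F1 a b (b + d) (of_real z)"
proof (cases "z > -1")
  case True
  then have "\<bar>z\<bar> < 1" using z by simp
  then show ?thesis using Euler_integral_ball[OF b d, of z a] by (simp add: hyp2F1_eq_gauss_series)
next
  case False
  define w where "w = z / (z - 1)"
  have w: "\<bar>w\<bar> < 1"
  proof -
    have "w = 1 - 1 / (1 - z)" using False by (simp add: w_def field_simps)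
    moreover have "0 < 1 / (1 - z)" "1 / (1 - z) < 1" using False by auto
    ultimately show ?thesis by linarith
  qed
  have c: "continuous_on {0<..<1} (\<lambda>v. of_real v powr (b - 1) * of_real (1 - v) powr (d - 1) *
      complex_of_real (1 - z * v) powr (- a))"
  proof -
    have "z * v \<le> 0" if "v \<in> {0<..<1}" for v using that False by (intro mult_nonpos_nonneg) auto
    then have "1 - z * v > 0" if "v \<in> {0<..<1}" for v using that by force
    then show ?thesis by (auto intro!: continuous_intros simp del: of_real_diff of_real_mult)
  qed
  have im: "(-) 1 ` {0<..<1} = {0<..<1::real}"
  proof (intro equalityI subsetI)
    fix x :: real assume "x \<in> {0<..<1}"
    then show "x \<in> (-) 1 ` {0<..<1}" by (intro image_eqI[of _ _ "1 - x"]) auto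
  qed auto
  have "(LINT v:{0<..<1}|lborel. of_real v powr (b - 1) * of_real (1 - v) powr (d - 1) *
      of_real (1 - z * v) powr (- a)) =
    (LINT v:{0<..<1}|lborel. \<bar>- 1\<bar> *\<^sub>R (of_real (1 - v) powr (b - 1) * of_real (1 - (1 - v)) powr
        (d - 1) * of_real (1 - z * (1 - v)) powr (- a)))"
    by (rule set_integral_substitution_real(2)[of "{0<..<1}" "(-) 1" "\<lambda>_. -1"
        "\<lambda>v. of_real v powr (b - 1) * of_real (1 - v) powr (d - 1) *
            of_real (1 - z * v) powr (- a)", unfolded im])
       (use c in \<open>auto intro!: derivative_eq_intros simp: inj_on_def\<close>)
  also have "\<dots> = (LINT v:{0<..<1}|lborel. of_real (1 - z) powr (- a) *
     (of_real v powr (d - 1) * of_real (1 - v) powr (b - 1) * of_real (1 - w * v) powr (- a)))"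
  proof (intro set_lebesgue_integral_cong, simp, intro allI impI)
    fix v :: real assume v: "v \<in> {0<..<1}"
    have eq: "1 - z * (1 - v) = (1 - z) * (1 - w * v)" using False by (simp add: w_def field_simps)
    have "w * v \<le> \<bar>w\<bar> * 1" using v by (intro mult_mono) auto
    then have "1 - w * v > 0" using w by simp
    then show "\<bar>- 1\<bar> *\<^sub>R (of_real (1 - v) powr (b - 1) * of_real (1 - (1 - v)) powr (d - 1) *
        of_real (1 - z * (1 - v)) powr (- a)) =
      of_real (1 - z) powr (- a) * (of_real v powr (d - 1) * of_real (1 - v) powr (b - 1) * of_real
          (1 - w * v) powr (- a))"
      unfolding eq using False by (subst of_real_powr_mult) auto
  qed
  also have "\<dots> = of_real (1 - z) powr (- a) * (Beta d b * gauss_series a d (d + b) (of_real w))"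
    using Euler_integral_ball[OF d b w, of a] by simp
  also have "\<dots> = Beta b d * hyp2F1 a b (b + d) (of_real z)"
  proof (subst hyp2F1_Pfaff)
    show "b + d \<notin> \<int>\<^sub>\<le>\<^sub>0" using b d by (intro Re_pos_not_nonpos_Ints) simp
  qed (use False in \<open>auto simp: w_def Beta_commute add.commute mult_ac\<close>)
  finally show ?thesis .
qed

section \<open>Kummer's function and the Tricomi integral\<close>

text \<open>Each quotient |a + n| / |c + n| is at most \<open>norm a / Re c + 1\<close>. Geometric
  growth is harmless against the factorial in Kummer's series.\<close>

lemma pochhammer_ratio_bound:
  assumes c: "Re c > 0" and M: "norm a / Re c + 1 \<le> M"
  shows "norm (pochhammer a n / pochhammer c n) \<le> M ^ n"
proof (induction n)
  case (Suc n)
  have "norm (a + of_nat n) \<le> M * norm (c + of_nat n)"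
  proof -
    have "norm (a + of_nat n) \<le> norm a + n"
      using norm_triangle_ineq[of a "of_nat n"] by simp
    also have "\<dots> \<le> (norm a / Re c + 1) * (Re c + n)"
      using c by (simp add: field_simps)
    also have "\<dots> \<le> M * norm (c + of_nat n)"
      using M c complex_Re_le_cmod[of "c + of_nat n"] order_trans[OF _ M, of 0]
      by (intro mult_mono) auto
    finally show ?thesis .
  qed
  moreover have "Re (c + of_nat n) > 0" using c by simp
  then have "c + of_nat n \<noteq> 0" by (intro notI) simp
  ultimately have "norm ((a + of_nat n) / (c + of_nat n)) \<le> M"
    by (simp add: norm_divide divide_le_eq)
  with Suc.IH have "norm (pochhammer a n / pochhammer c n) *
      norm ((a + of_nat n) / (c + of_nat n)) \<le> M ^ n * M"
    using order_trans[OF _ M, of 0] c by (intro mult_mono) auto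
  then show ?case by (simp add: pochhammer_Suc norm_mult norm_divide mult.commute)
qed simp

lemma exp_bound_summable: "summable (\<lambda>n. (M * W) ^ n / fact n :: real)"
  using summable_exp[of "M * W"] by (simp add: divide_inverse mult.commute)

lemma kummer_term_bound:
  assumes "Re c > 0" "norm a / Re c + 1 \<le> M" "norm z \<le> W"
  shows "norm (pochhammer a n / pochhammer c n * (z ^ n / fact n)) \<le> (M * W) ^ n / fact n"
proof -
  have "norm (pochhammer a n / pochhammer c n * (z ^ n / fact n)) =
    norm (pochhammer a n / pochhammer c n) * (norm z ^ n / fact n)"
    by (simp only: norm_mult norm_divide norm_power norm_fact)
  also have "\<dots> \<le> M ^ n * (W ^ n / fact n)"
    using pochhammer_ratio_bound[OF assms(1,2), of n] assms(3) order_trans[OF _ assms(2), of 0]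
        assms(1)
    by (intro mult_mono divide_right_mono power_mono) auto
  finally show ?thesis by (simp add: power_mult_distrib)
qed

lemma kummer_summable:
  assumes "Re c > 0"
  shows "summable (\<lambda>n. norm (pochhammer a n / pochhammer c n * (z ^ n / fact n)))"
  by (rule summable_comparison_test'[OF exp_bound_summable])
     (use kummer_term_bound[OF assms order_refl order_refl] in auto)

lemma kummer_Phi_holomorphic [holomorphic_intros]:
  assumes L: "open L" and hol: "a holomorphic_on L" "w holomorphic_on L" and c: "Re c > 0"
  shows "(\<lambda>x. kummer_Phi (a x) c (w x)) holomorphic_on L"
proof (rule holomorphic_uniform_sequence[OF L])
  fix n show "(\<lambda>x. \<Sum>i<n. pochhammer (a x) i / pochhammer c i * (w x ^ i / fact i)) holomorphic_on L"
    by (intro holomorphic_intros hol) (auto simp: pochhammer_nonzero_Re_pos c)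
next
  fix x assume x: "x \<in> L"
  have ev: "eventually (\<lambda>y. norm (f y) < norm (f x) + 1) (nhds x)" if "f holomorphic_on L"
      for f :: "complex \<Rightarrow> complex"
  proof -
    have "(f \<longlongrightarrow> f x) (nhds x)"
      using that x L holomorphic_on_imp_continuous_on continuous_on_eq_continuous_at
      by (metis isCont_def tendsto_at_iff_tendsto_nhds)
    from tendsto_norm[OF this] show ?thesis by (rule order_tendstoD) simp
  qed
  have "eventually (\<lambda>x. x \<in> L) (nhds x)" using L x by (rule eventually_nhds_in_open)
  then have "eventually (\<lambda>y. y \<in> L \<and> norm (a y) \<le> norm (a x) + 1 \<and> norm (w y) \<le> norm (w x) +
      1) (nhds x)"
    using ev[OF hol(1)] ev[OF hol(2)] by eventually_elim auto
  then obtain d where d: "d > 0" "\<And>y. dist y x \<le> d \<Longrightarrow> y \<in> L \<and> norm (a y) \<le> norm (a x) + 1 \<and>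
      norm (w y) \<le> norm (w x) + 1"
    unfolding eventually_nhds_metric_le by blast
  have "uniform_limit (cball x d) (\<lambda>n x. \<Sum>i<n. pochhammer (a x) i / pochhammer c i *
      (w x ^ i / fact i))
      (\<lambda>x. kummer_Phi (a x) c (w x)) sequentially"
    unfolding kummer_Phi_def
  proof (rule Weierstrass_m_test[OF _ exp_bound_summable])
    fix n y assume "y \<in> cball x d"
    then have "norm (a y) \<le> norm (a x) + 1" "norm (w y) \<le> norm (w x) + 1"
      using d(2)[of y] by (auto simp: dist_commute)
    then show "norm (pochhammer (a y) n / pochhammer c n * (w y ^ n / fact n)) \<le>
      (((norm (a x) + 1) / Re c + 1) * (norm (w x) + 1)) ^ n / fact n"
      using c by (intro kummer_term_bound) (auto intro: divide_right_mono)
  qed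
  moreover have "cball x d \<subseteq> L" using d(2) by (auto simp: dist_commute)
  ultimately show "\<exists>d>0. cball x d \<subseteq> L \<and> uniform_limit (cball x d)
      (\<lambda>n x. \<Sum>i<n. pochhammer (a x) i / pochhammer c i * (w x ^ i / fact i))
      (\<lambda>x. kummer_Phi (a x) c (w x)) sequentially"
    using d(1) by blast
qed

theorem Kummer_integral:
  assumes a: "Re a > 0" and d: "Re d > 0"
  shows "(LINT v:{0<..<1}|lborel. of_real v powr (a - 1) * of_real (1 - v) powr (d - 1) *
      exp (z * of_real v)) =
    Beta a d * kummer_Phi a (a + d) z"
proof -
  have e: "(\<lambda>n. z ^ n / fact n) sums exp z" for z :: complex
    using exp_converges[of z] by (simp add: scaleR_conv_of_real divide_inverse mult.commute)
  have q: "summable (\<lambda>n. norm (z ^ n / fact n))"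
    using summable_norm_exp[of z]
        by (simp add: norm_divide norm_mult norm_inverse norm_power divide_inverse mult.commute)
  have "exp (z * of_real v) = (\<Sum>n. z ^ n / fact n * of_real v ^ n)" for v :: real
    using e[of "z * of_real v"] by (simp add: sums_iff power_mult_distrib)
  then have "(LINT v:{0<..<1}|lborel. of_real v powr (a - 1) * of_real (1 - v) powr (d - 1) *
      exp (z * of_real v)) =
    Beta a d * (\<Sum>n. z ^ n / fact n * (pochhammer a n / pochhammer (a + d) n))"
    using Beta_integral_power_series[OF a d q] by simp
  then show ?thesis by (simp add: kummer_Phi_def mult.commute)
qed

text \<open>Termwise integration. The absolute moment of the n-th term is a Gamma value at
  \<open>Re a + n\<close>, which is why the first summability condition involves
  \<open>pochhammer\<close> at \<open>Re a\<close>.\<close>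

lemma Gamma_integral_power_series:
  assumes a: "Re a > 0" and q: "summable (\<lambda>n. norm (q n * pochhammer (of_real (Re a)) n))"
    and s: "\<And>t::real. t > 0 \<Longrightarrow> summable (\<lambda>n. norm (q n * of_real t ^ n))"
  shows "set_integrable lborel {0<..} (\<lambda>t. of_real t powr (a - 1) * exp (- of_real t) *
      (\<Sum>n. q n * of_real t ^ n))"
    and "(LINT t:{0<..}|lborel. of_real t powr (a - 1) * exp (- of_real t) *
        (\<Sum>n. q n * of_real t ^ n)) =
    Gamma a * (\<Sum>n. q n * pochhammer a n)"
proof -
  let ?w = "\<lambda>t. of_real t powr (a - 1) * exp (- of_real t) :: complex"
  let ?g = "\<lambda>b t. indicator {0<..} t *\<^sub>R (of_real t powr (b - 1) * exp (- of_real t)) :: complex"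
  define f where "f n t = indicator {0<..} t *\<^sub>R (?w t * (q n * of_real t ^ n))" for n and t :: real
  have eq: "f n t = q n * ?g (a + of_nat n) t" for n t
  proof (cases "t > 0")
    case True
    then have "of_real t powr (a + of_nat n - 1) = of_real t powr (a - 1) * complex_of_real t ^ n"
      using powr_add[of "complex_of_real t" "a - 1" "of_nat n"]
      by (auto simp: algebra_simps powr_nat)
    then show ?thesis by (simp add: f_def)
  qed (simp add: f_def)
  have g: "integrable lborel (?g b)" "(LINT t|lborel. ?g b t) = Gamma b" if "Re b > 0" for b
    using Gamma_integral_lborel[OF that, of 1]
        unfolding set_integrable_def set_lebesgue_integral_def by auto
  have an: "Re (a + of_nat n) > 0" for n using a by simp
  have int: "integrable lborel (f n)" for n
    unfolding eq using g(1)[OF an] by (rule integrable_mult_right)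
  have val: "(LINT t|lborel. f n t) = Gamma a * (q n * pochhammer a n)" for n
    unfolding eq integral_mult_right_zero g(2)[OF an] Gamma_shift[OF a] by simp
  have nrm: "(LINT t|lborel. norm (f n t)) = norm (Gamma (of_real (Re a) :: complex)) *
      norm (q n * pochhammer (of_real (Re a)) n)" for n
  proof -
    have "complex_of_real (norm (f n t)) = of_real (norm (q n)) * ?g (of_real (Re a) + of_nat n) t"
        for t
    proof (cases "t > 0")
      case True
      then have "norm (f n t) = norm (q n) * (t powr (Re a + n - 1) * exp (- t))"
        unfolding eq by (simp add: norm_mult norm_of_real_powr)
      moreover have "complex_of_real (t powr (Re a + n - 1) * exp (- t)) =
          of_real t powr (of_real (Re a) + of_nat n - 1) * exp (- of_real t)"
        using True powr_of_real[of t "Re a + n - 1"] by (simp add: exp_of_real[symmetric])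
      ultimately show ?thesis using True by simp
    qed (simp add: f_def)
    then have "complex_of_real (LINT t|lborel. norm (f n t)) = of_real (norm (q n)) *
        Gamma (of_real (Re a) + of_nat n)"
      unfolding integral_complex_of_real[symmetric] using g(2)[of "of_real (Re a) + of_nat n"] a
      by (simp only: integral_mult_right_zero) simp
    then have "norm (complex_of_real (LINT t|lborel. norm (f n t))) = norm (q n) *
        norm (Gamma (of_real (Re a) + of_nat n :: complex))"
      by (simp only: norm_mult norm_of_real abs_norm_cancel)
    then show ?thesis using Gamma_shift[of "of_real (Re a)" n] a
      by (simp add: norm_mult mult_ac integral_nonneg)
  qed
  have s1: "AE t in lborel. summable (\<lambda>n. norm (f n t))"
  proof (rule AE_I2)
    fix t show "summable (\<lambda>n. norm (f n t))"
    proof (cases "t > 0")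
      case True
      from summable_mult[OF s[OF True], of "norm (?w t)"] show ?thesis
        using True by (simp add: f_def norm_mult mult_ac)
    qed (simp add: f_def)
  qed
  have s2: "summable (\<lambda>n. LINT t|lborel. norm (f n t))"
    unfolding nrm by (intro summable_mult q)
  have suminf: "(\<Sum>n. f n t) = indicator {0<..} t *\<^sub>R (?w t * (\<Sum>n. q n * of_real t ^ n))" for t
  proof (cases "t > 0")
    case True
    from suminf_mult[OF summable_norm_cancel[OF s[OF True]], of "?w t"] show ?thesis using True
        by (simp add: f_def)
  qed (simp add: f_def)
  show "set_integrable lborel {0<..} (\<lambda>t. ?w t * (\<Sum>n. q n * of_real t ^ n))"
    using integrable_suminf[OF int s1 s2] unfolding set_integrable_def suminf .
  have S: "(\<lambda>n. Gamma a * (q n * pochhammer a n)) sums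
      (LINT t:{0<..}|lborel. ?w t * (\<Sum>n. q n * of_real t ^ n))"
    using sums_integral[OF int s1 s2] unfolding val suminf set_lebesgue_integral_def .
  have nz: "Gamma a \<noteq> 0" using a by (simp add: Gamma_eq_zero_iff Re_pos_not_nonpos_Ints)
  from sums_unique[OF sums_mult_D[OF S nz]] nz
  show "(LINT t:{0<..}|lborel. ?w t * (\<Sum>n. q n * of_real t ^ n)) = Gamma a *
      (\<Sum>n. q n * pochhammer a n)"
    by (simp add: field_simps)
qed

section \<open>Gaussian integrals and the heat kernel\<close>

lemma gaussian_integral_UNIV:
  "integrable lborel (\<lambda>w. complex_of_real (exp (- w\<^sup>2)))"
      "(LINT w|lborel. complex_of_real (exp (- w\<^sup>2))) = of_real (sqrt pi)"
proof -
  have "has_bochner_integral lborel (\<lambda>x::real. exp (- x\<^sup>2)) (2 *\<^sub>R (sqrt pi / 2))"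
    by (rule has_bochner_integral_even_function[OF gaussian_moment_0]) simp
  then have "has_bochner_integral lborel (\<lambda>w::real. exp (- w\<^sup>2)) (sqrt pi)" by simp
  then have "has_bochner_integral lborel (\<lambda>w. complex_of_real (exp (- w\<^sup>2))) (of_real (sqrt pi))"
    by (rule has_bochner_integral_of_real)
  then show "integrable lborel (\<lambda>w. complex_of_real (exp (- w\<^sup>2)))"
      "(LINT w|lborel. complex_of_real (exp (- w\<^sup>2))) = of_real (sqrt pi)"
    unfolding has_bochner_integral_iff by auto
qed

text \<open>The integrand is even under \<open>r \<mapsto> A / (B r)\<close>,
    and the average of the two forms is the Gaussian integral
  in \<open>w = B r - A / r\<close>.\<close>

lemma Cauchy_Schloemilch_gaussian:
  assumes A: "A > 0" and B: "B > 0"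
  shows "(LINT r:{0<..}|lborel. complex_of_real (exp (- (B * r - A / r)\<^sup>2))) =
      of_real (sqrt pi / (2 * B))"
proof -
  define I where "I r = exp (- (B * r - A / r)\<^sup>2)" for r
  have cI: "continuous_on {0<..} (\<lambda>r. complex_of_real (I r))"
    unfolding I_def by (intro continuous_intros) auto
  have im1: "(\<lambda>r. A / (B * r)) ` {0<..} = {0<..}"
  proof (intro equalityI subsetI)
    fix r :: real assume "r \<in> {0<..}"
    then show "r \<in> (\<lambda>r. A / (B * r)) ` {0<..}" using A B
        by (intro image_eqI[of _ _ "A / (B * r)"]) auto
  qed (use A B in auto)
  have "(LINT r:{0<..}|lborel. complex_of_real (I r)) =
      (LINT r:{0<..}|lborel. \<bar>- A / (B * r\<^sup>2)\<bar> *\<^sub>R complex_of_real (I (A / (B * r))))"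
    by (rule set_integral_substitution_real(2)[of "{0<..}" "\<lambda>r. A / (B * r)" "\<lambda>r. - A / (B * r\<^sup>2)"
          "\<lambda>r. complex_of_real (I r)", unfolded im1])
       (use A B cI in \<open>auto intro!: derivative_eq_intros continuous_intros simp: power2_eq_square
           inj_on_def\<close>)
  also have "\<dots> = (LINT r:{0<..}|lborel. complex_of_real (A / (B * r\<^sup>2) * I r))"
  proof (intro set_lebesgue_integral_cong, simp, intro allI impI)
    fix r :: real assume r: "r \<in> {0<..}"
    have "B * (A / (B * r)) - A / (A / (B * r)) = - (B * r - A / r)" using r A B
        by (simp add: field_simps)
    then have "I (A / (B * r)) = I r" unfolding I_def by (simp only: power2_minus)
    then show "\<bar>- A / (B * r\<^sup>2)\<bar> *\<^sub>R complex_of_real (I (A / (B * r))) =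
        complex_of_real (A / (B * r\<^sup>2) * I r)"
      using r A B by (simp add: scaleR_conv_of_real)
  qed
  finally have sym: "(LINT r:{0<..}|lborel. complex_of_real (I r)) =
      (LINT r:{0<..}|lborel. complex_of_real (A / (B * r\<^sup>2) * I r))" .
  have im2: "(\<lambda>r. B * r - A / r) ` {0<..} = UNIV"
  proof (intro equalityI subsetI)
    fix w :: real
    \<comment> \<open>The preimage of w is the positive root (w + d) / (2 B) of B r^2 - w r - A =
      0.\<close>
    define d where "d = sqrt (w\<^sup>2 + 4 * A * B)"
    have d2: "d\<^sup>2 = w\<^sup>2 + 4 * A * B" using A B by (simp add: d_def)
    have "\<bar>w\<bar> < d" unfolding d_def using A B by (intro real_less_rsqrt) auto
    then have r: "w + d > 0" by simp
    have "B * ((w + d) / (2 * B)) - A / ((w + d) / (2 * B)) = w"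
    proof -
      have "(d - w) * (w + d) = 4 * A * B"
        using d2 by (simp add: power2_eq_square algebra_simps)
      then have 1: "2 * A * B / (w + d) = (d - w) / 2" using r by (simp add: field_simps)
      have 2: "A / ((w + d) / (2 * B)) = 2 * A * B / (w + d)" by simp
      have 3: "B * ((w + d) / (2 * B)) = (w + d) / 2" using B by simp
      show ?thesis unfolding 3 2 1 by (simp add: field_simps)
    qed
    then show "w \<in> (\<lambda>r. B * r - A / r) ` {0<..}"
      using r B by (intro image_eqI[of _ _ "(w + d) / (2 * B)"]) auto
  qed auto
  have inj: "inj_on (\<lambda>r. B * r - A / r) {0<..}"
  proof (rule strict_mono_on_imp_inj_on, rule strict_mono_onI)
    fix r s :: real assume "r \<in> {0<..}" "s \<in> {0<..}" "r < s"
    then show "B * r - A / r < B * s - A / s" using A B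
      by (intro diff_strict_mono mult_strict_left_mono divide_strict_left_mono) auto
  qed
  have "set_integrable lborel ((\<lambda>r. B * r - A / r) ` {0<..}) (\<lambda>w. complex_of_real (exp (- w\<^sup>2))) \<longleftrightarrow>
      set_integrable lborel {0<..} (\<lambda>r. \<bar>B + A / r\<^sup>2\<bar> *\<^sub>R complex_of_real (I r))"
    "(LINT w:(\<lambda>r. B * r - A / r) ` {0<..}|lborel. complex_of_real (exp (- w\<^sup>2))) =
      (LINT r:{0<..}|lborel. \<bar>B + A / r\<^sup>2\<bar> *\<^sub>R complex_of_real (I r))"
    unfolding I_def
    by (rule set_integral_substitution_real; (rule inj)?;
        (auto simp: im2 power2_eq_square intro!: derivative_eq_intros continuous_intros)[1])+
  then have tot: "set_integrable lborel {0<..} (\<lambda>r. \<bar>B + A / r\<^sup>2\<bar> *\<^sub>R complex_of_real (I r))"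
    "(LINT r:{0<..}|lborel. \<bar>B + A / r\<^sup>2\<bar> *\<^sub>R complex_of_real (I r)) = of_real (sqrt pi)"
    using gaussian_integral_UNIV unfolding im2
        by (simp_all add: set_integrable_def set_lebesgue_integral_def)
  \<comment> \<open>The substitution gives integrability of the sum only. Its first summand is
    dominated by the sum, as both summands are positive, and the second then follows by
    subtraction.\<close>
  have i1: "set_integrable lborel {0<..} (\<lambda>r. complex_of_real (I r) * of_real B)"
  proof (rule set_integrable_bound[OF tot(1)])
    show "set_borel_measurable lborel {0<..} (\<lambda>r. complex_of_real (I r) * of_real B)"
      by (intro set_borel_measurable_lborel_continuous continuous_intros cI) auto
    show "AE r in lborel. r \<in> {0<..} \<longrightarrow> norm (complex_of_real (I r) * of_real B) \<le>
        norm (\<bar>B + A / r\<^sup>2\<bar> *\<^sub>R complex_of_real (I r))"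
      using A B by (intro AE_I2) (auto simp: norm_mult I_def)
  qed
  have "\<bar>B + A / r\<^sup>2\<bar> *\<^sub>R complex_of_real (I r) = complex_of_real (I r) * of_real B +
      complex_of_real (A / (B * r\<^sup>2) * I r) * of_real B" for r
    using A B by (simp add: scaleR_conv_of_real field_simps)
  then have tot': "set_integrable lborel {0<..} (\<lambda>r. complex_of_real (I r) * of_real B +
      complex_of_real (A / (B * r\<^sup>2) * I r) * of_real B)"
    "(LINT r:{0<..}|lborel. complex_of_real (I r) * of_real B +
        complex_of_real (A / (B * r\<^sup>2) * I r) * of_real B) = of_real (sqrt pi)"
    using tot by simp_all
  have i2: "set_integrable lborel {0<..} (\<lambda>r. complex_of_real (A / (B * r\<^sup>2) * I r) * of_real B)"
    using set_integral_diff(1)[OF tot'(1) i1] by simp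
  have "(LINT r:{0<..}|lborel. complex_of_real (I r)) * of_real B +
      (LINT r:{0<..}|lborel. complex_of_real (I r)) * of_real B = of_real (sqrt pi)"
    using tot'(2) unfolding set_integral_add(2)[OF i1 i2] set_integral_mult_left sym .
  then have "(LINT r:{0<..}|lborel. complex_of_real (I r)) * (2 * of_real B) = of_real (sqrt pi)"
    by (simp add: algebra_simps)
  then show ?thesis using B unfolding I_def by (simp add: field_simps)
qed

text \<open>With s = r^2 the exponent becomes - 2 A B - (B r - A / r)^2, and the weight s^(-1/2) ds
  becomes 2 dr.\<close>

lemma heat_kernel_integral:
  assumes A: "A > 0" and B: "B > 0"
  shows "(LINT s:{0<..}|lborel. complex_of_real (s powr (- 1 / 2) * exp (- (A\<^sup>2 / s) - B\<^sup>2 * s))) =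
    of_real (sqrt pi / B * exp (- 2 * A * B))"
proof -
  have im: "(\<lambda>r. r\<^sup>2) ` {0<..} = {0::real<..}"
  proof (intro equalityI subsetI)
    fix r :: real assume "r \<in> {0<..}"
    then show "r \<in> (\<lambda>r. r\<^sup>2) ` {0<..}" by (intro image_eqI[of _ _ "sqrt r"]) auto
  qed auto
  have inj: "inj_on (\<lambda>r. r\<^sup>2) {0::real<..}" by (auto intro!: inj_onI)
  have c: "continuous_on {0<..} (\<lambda>s. complex_of_real (s powr (- 1 / 2) *
      exp (- (A\<^sup>2 / s) - B\<^sup>2 * s)))"
    by (intro continuous_intros) auto
  have "(LINT s:{0<..}|lborel. complex_of_real (s powr (- 1 / 2) * exp (- (A\<^sup>2 / s) - B\<^sup>2 * s))) =
    (LINT r:{0<..}|lborel. \<bar>2 * r\<bar> *\<^sub>R complex_of_real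
        ((r\<^sup>2) powr (- 1 / 2) * exp (- (A\<^sup>2 / r\<^sup>2) - B\<^sup>2 * r\<^sup>2)))"
  proof (rule set_integral_substitution_real(2)[of "{0<..}" "\<lambda>r. r\<^sup>2" "\<lambda>r. 2 * r"
        "\<lambda>s. complex_of_real (s powr (- 1 / 2) * exp (- (A\<^sup>2 / s) - B\<^sup>2 * s))", unfolded im])
    show "((\<lambda>r. r\<^sup>2) has_field_derivative 2 * r) (at r)" for r :: real
      by (auto intro!: derivative_eq_intros)
    show "continuous_on {0<..} (\<lambda>r::real. 2 * r)" by (intro continuous_intros)
  qed (rule inj c | simp)+
  also have "\<dots> = (LINT r:{0<..}|lborel. of_real (2 * exp (- 2 * A * B)) *
      complex_of_real (exp (- (B * r - A / r)\<^sup>2)))"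
  proof (intro set_lebesgue_integral_cong, simp, intro allI impI)
    fix r :: real assume r: "r \<in> {0<..}"
    have "(r\<^sup>2) powr (- (1 / 2)) = 1 / r"
      unfolding powr_minus powr_half_sqrt[OF zero_le_power2] using r by (simp add: divide_inverse)
    then have "(r\<^sup>2) powr (- 1 / 2) = 1 / r" by simp
    moreover have "- (A\<^sup>2 / r\<^sup>2) - B\<^sup>2 * r\<^sup>2 = - 2 * A * B + - (B * r - A / r)\<^sup>2"
      unfolding power2_diff power_mult_distrib power_divide using r by simp
    then have "exp (- (A\<^sup>2 / r\<^sup>2) - B\<^sup>2 * r\<^sup>2) = exp (- 2 * A * B) * exp (- (B * r - A / r)\<^sup>2)"
      by (simp only: exp_add)
    ultimately show "\<bar>2 * r\<bar> *\<^sub>R complex_of_real ((r\<^sup>2) powr (- 1 / 2) *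
        exp (- (A\<^sup>2 / r\<^sup>2) - B\<^sup>2 * r\<^sup>2)) =
      of_real (2 * exp (- 2 * A * B)) * complex_of_real (exp (- (B * r - A / r)\<^sup>2))"
      using r by (simp add: scaleR_conv_of_real)
  qed
  also have "\<dots> = of_real (2 * exp (- 2 * A * B)) * of_real (sqrt pi / (2 * B))"
    using Cauchy_Schloemilch_gaussian[OF A B] by simp
  finally show ?thesis using B by (simp add: mult.commute)
qed

text \<open>This is cosh x - sinh x at x = 2 sqrt (l t), where (2n)! = 4^n (1/2)_n n! and (2n + 1)!
  = 4^n (3/2)_n n!. Hence the lower parameters 1/2 and 3/2 of the two Kummer functions in
  \<open>parabolic_D\<close>.\<close>

lemma exp_minus_2_sqrt_series:
  assumes "l > 0" "t > 0"
  shows "complex_of_real (exp (- 2 * sqrt (l * t))) =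
    (\<Sum>n. of_real l ^ n / (pochhammer (1 / 2) n * fact n) * of_real t ^ n)
    - 2 * of_real (sqrt l) * of_real t powr (1 / 2) *
      (\<Sum>n. of_real l ^ n / (pochhammer (3 / 2) n * fact n) * of_real t ^ n)"
proof -
  define x where "x = complex_of_real (2 * sqrt (l * t))"
  have x2: "x ^ (2 * n) = 4 ^ n * (of_real l ^ n * of_real t ^ n)" for n
  proof -
    have "x\<^sup>2 = of_real (4 * (l * t))" unfolding x_def of_real_power[symmetric] using assms by simp
    then show ?thesis by (simp add: power_mult power_mult_distrib)
  qed
  have f: "fact (2 * n) = (4 ^ n * pochhammer (1 / 2) n * fact n :: complex)" for n
    by (simp add: fact_double power_mult)
  have g: "fact (2 * n + 1) = (4 ^ n * pochhammer (3 / 2) n * fact n :: complex)" for n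
  proof -
    have "pochhammer (1 / 2) n * (1 / 2 + of_nat n) = (1 / 2) * pochhammer (3 / 2 :: complex) n"
      using pochhammer_Suc[of "1 / 2 :: complex" n] pochhammer_rec[of "1 / 2 :: complex" n] by simp
    moreover have "fact (2 * n + 1) = (2 * of_nat n + 1) * (fact (2 * n) :: complex)" by simp
    moreover have "(2 * of_nat n + 1 :: complex) = 2 * (1 / 2 + of_nat n)"
        by (simp add: algebra_simps)
    ultimately show ?thesis unfolding f by (simp only: mult_ac) simp
  qed
  have "(\<lambda>n. if even n then x ^ n /\<^sub>R fact n else 0) sums cosh x" by (rule cosh_converges)
  then have "(\<lambda>n. (if even (2 * n) then x ^ (2 * n) /\<^sub>R fact (2 * n) else 0)) sums cosh x"
    by (subst sums_mono_reindex[of "\<lambda>n. 2 * n"]) (auto simp: strict_mono_def elim!: evenE)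
  then have c: "(\<lambda>n. of_real l ^ n / (pochhammer (1 / 2) n * fact n) * of_real t ^ n) sums cosh x"
    by (simp add: x2 f scaleR_conv_of_real divide_simps)
  have "(\<lambda>n. if even n then 0 else x ^ n /\<^sub>R fact n) sums sinh x" by (rule sinh_converges)
  then have "(\<lambda>n. (if even (2 * n + 1) then 0 else x ^ (2 * n + 1) /\<^sub>R fact (2 * n + 1))) sums sinh
      x"
    by (subst sums_mono_reindex[of "\<lambda>n. 2 * n + 1"]) (auto simp: strict_mono_def elim!: oddE)
  then have s: "(\<lambda>n. x * (of_real l ^ n / (pochhammer (3 / 2) n * fact n) * of_real t ^ n)) sums
      sinh x"
    by (simp add: x2 g[simplified] scaleR_conv_of_real divide_simps)
  have "x \<noteq> 0" using assms by (simp add: x_def)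
  from sums_mult_D[OF s this] have e2: "(\<Sum>n. of_real l ^ n / (pochhammer (3 / 2) n * fact n) *
      of_real t ^ n) = sinh x / x"
    by (rule sums_unique[symmetric])
  have e1: "2 * of_real (sqrt l) * of_real t powr (1 / 2) = x"
    using assms powr_of_real[of t "1 / 2"] by (simp add: x_def real_sqrt_mult powr_half_sqrt)
  have e3: "complex_of_real (exp (- 2 * sqrt (l * t))) = exp (- x)"
    by (simp add: x_def exp_of_real[symmetric])
  show ?thesis
    unfolding e1 e2 e3 sums_unique[OF c, symmetric] using \<open>x \<noteq> 0\<close> cosh_minus_sinh[of x] by simp
qed

lemma kummer_denominator_summable:
  assumes "Re c > 0"
  shows "summable (\<lambda>n. norm (z ^ n / (pochhammer c n * fact n) * w ^ n))"
proof (rule summable_comparison_test'[OF kummer_summable[OF assms, of 1 "z * w"]])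
  fix n
  have "norm (z ^ n / (pochhammer c n * fact n) * w ^ n) * 1 \<le>
      norm (z ^ n / (pochhammer c n * fact n) * w ^ n) * fact n"
    by (intro mult_left_mono) (auto simp: fact_ge_1)
  also have "\<dots> = norm (pochhammer 1 n / pochhammer c n * ((z * w) ^ n / fact n))"
    by (simp add: norm_mult norm_divide norm_power pochhammer_fact[symmetric] power_mult_distrib)
  finally show "norm (norm (z ^ n / (pochhammer c n * fact n) * w ^ n)) \<le>
      norm (pochhammer 1 n / pochhammer c n * ((z * w) ^ n / fact n))"
    by simp
qed

text \<open>The Gamma integral is taken termwise in both series; the factor t^(1/2) in front of the
  odd one raises a to a + 1/2.\<close>

lemma Gamma_integral_exp_sqrt:
  assumes a: "Re a > 0" and l: "l > 0"
  shows "(LINT t:{0<..}|lborel. of_real t powr (a - 1) * exp (- of_real t) *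
      complex_of_real (exp (- 2 * sqrt (l * t)))) =
    Gamma a * kummer_Phi a (1 / 2) (of_real l) - 2 * of_real (sqrt l) *
        (Gamma (a + 1 / 2) * kummer_Phi (a + 1 / 2) (3 / 2) (of_real l))"
proof -
  define q where "q c n = complex_of_real l ^ n / (pochhammer c n * fact n)" for c n
  have main: "set_integrable lborel {0<..} (\<lambda>t. of_real t powr (b - 1) * exp (- of_real t) *
      (\<Sum>n. q c n * of_real t ^ n))"
      "(LINT t:{0<..}|lborel. of_real t powr (b - 1) * exp (- of_real t) *
          (\<Sum>n. q c n * of_real t ^ n)) =
        Gamma b * kummer_Phi b c (of_real l)" if "Re b > 0" "Re c > 0" for b c
  proof -
    have eq: "q c n * pochhammer b n = pochhammer b n / pochhammer c n * (of_real l ^ n / fact n)"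
        for b n
      by (simp add: q_def)
    have 1: "summable (\<lambda>n. norm (q c n * pochhammer (of_real (Re b)) n))"
      unfolding eq by (rule kummer_summable[OF that(2)])
    have 2: "summable (\<lambda>n. norm (q c n * of_real t ^ n))" for t :: real
      unfolding q_def by (rule kummer_denominator_summable[OF that(2)])
    show "set_integrable lborel {0<..} (\<lambda>t. of_real t powr (b - 1) * exp (- of_real t) *
        (\<Sum>n. q c n * of_real t ^ n))"
      by (rule Gamma_integral_power_series(1)[OF that(1) 1 2])
    show "(LINT t:{0<..}|lborel. of_real t powr (b - 1) * exp (- of_real t) *
        (\<Sum>n. q c n * of_real t ^ n)) =
        Gamma b * kummer_Phi b c (of_real l)"
      unfolding Gamma_integral_power_series(2)[OF that(1) 1 2] eq kummer_Phi_def ..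
  qed
  let ?f = "\<lambda>t. of_real t powr (a - 1) * exp (- of_real t) * (\<Sum>n. q (1 / 2) n * of_real t ^ n)"
  let ?g = "\<lambda>t. of_real t powr (a + 1 / 2 - 1) * exp (- of_real t) *
      (\<Sum>n. q (3 / 2) n * of_real t ^ n)"
  have "(LINT t:{0<..}|lborel. of_real t powr (a - 1) * exp (- of_real t) *
      complex_of_real (exp (- 2 * sqrt (l * t)))) =
    (LINT t:{0<..}|lborel. ?f t - 2 * of_real (sqrt l) * ?g t)"
  proof (intro set_lebesgue_integral_cong, simp, intro allI impI)
    fix t :: real assume t: "t \<in> {0<..}"
    have 1: "of_real t powr (a + 1 / 2 - 1) = of_real t powr (a - 1) *
        complex_of_real t powr (1 / 2)"
      using powr_add[of "complex_of_real t" "a - 1" "1 / 2"] by (simp add: algebra_simps)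
    have 2: "complex_of_real (exp (- 2 * sqrt (l * t))) = (\<Sum>n. q (1 / 2) n * of_real t ^ n)
      - 2 * of_real (sqrt l) * of_real t powr (1 / 2) * (\<Sum>n. q (3 / 2) n * of_real t ^ n)"
      unfolding q_def by (rule exp_minus_2_sqrt_series) (use l t in auto)
    show "of_real t powr (a - 1) * exp (- of_real t) * complex_of_real (exp (- 2 * sqrt (l * t))) =
      ?f t - 2 * of_real (sqrt l) * ?g t"
      unfolding 1 2 by (simp only: right_diff_distrib mult_ac)
  qed
  also have "\<dots> = (LINT t:{0<..}|lborel. ?f t) - 2 * of_real (sqrt l) * (LINT t:{0<..}|lborel. ?g t)"
    using main(1)[of a "1 / 2"] main(1)[of "a + 1 / 2" "3 / 2"] a
    by (subst set_integral_diff(2)) auto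
  also have "\<dots> = Gamma a * kummer_Phi a (1 / 2) (of_real l) - 2 * of_real (sqrt l) *
      (Gamma (a + 1 / 2) * kummer_Phi (a + 1 / 2) (3 / 2) (of_real l))"
    using main(2)[of a "1 / 2"] main(2)[of "a + 1 / 2" "3 / 2"] a by simp
  finally show ?thesis .
qed

text \<open>Gamma a times (1 + y / s)^(-a) is the integral of t^(a - 1) exp (- t (1 + y / s)) over
  t. After exchanging the integrals, the one over s is a heat kernel and yields exp (- 2 sqrt (y p
  t)), whose Gamma integral is the difference of two Kummer functions. Real p keeps the heat kernel
  real.\<close>

lemma Tricomi_integral_real:
  assumes a: "Re a > 0" and p: "p > 0" and y: "y > 0"
  shows "Gamma a * (LINT s:{0<..}|lborel. exp (- of_real (p * s)) *
      (of_real s powr (a - 1 / 2) * of_real (y + s) powr (- a))) =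
    of_real (sqrt pi / sqrt p) * (Gamma a * kummer_Phi a (1 / 2) (of_real (y * p)) -
      2 * of_real (sqrt (y * p)) * (Gamma (a + 1 / 2) * kummer_Phi (a + 1 / 2) (3 / 2)
          (of_real (y * p))))"
proof -
  \<comment> \<open>Written as one exponential with indicators, \<open>F\<close> is evidently
    jointly measurable. The facts \<open>F\<close> and \<open>G\<close> are its factorisations for
    the two orders of integration.\<close>
  define F where "F s t = (indicator {0<..} s * indicator {0<..} t) *\<^sub>R
    exp (of_real (- (1 / 2) * ln s - p * s - t * (1 + y / s)) + (a - 1) * of_real
        (ln t))" for s t :: real
  have F: "F s t = indicator {0<..} t *\<^sub>R (of_real (s powr (- 1 / 2) * exp (- p * s)) *
      (of_real t powr (a - 1) * exp (- of_real ((1 + y / s) * t))))"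
    if "s > 0" for s t
    using that by (cases "t > 0")
      (auto simp: F_def powr_def Ln_of_real exp_of_real[symmetric] exp_add[symmetric]
          exp_diff[symmetric] field_simps)
  have G: "F s t = indicator {0<..} s *\<^sub>R ((of_real t powr (a - 1) * exp (- of_real t)) *
      complex_of_real (s powr (- 1 / 2) * exp (- ((sqrt (t * y))\<^sup>2 / s) - (sqrt p)\<^sup>2 * s)))" if "t >
          0" for s t
    using that y p by (cases "s > 0")
      (auto simp: F_def powr_def Ln_of_real exp_of_real[symmetric] exp_add[symmetric]
          exp_diff[symmetric] field_simps)
  have intF: "integrable (lborel \<Otimes>\<^sub>M lborel) (\<lambda>(s, t). F s t)"
  proof (rule lborel_pair.Fubini_integrable)
    show meas: "(\<lambda>(s, t). F s t) \<in> borel_measurable (lborel \<Otimes>\<^sub>M lborel)"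
      unfolding F_def by measurable
    define W where "W = (LINT t:{0<..}|lborel. norm (of_real t powr (a - 1) *
        exp (- complex_of_real t)))"
    have wi: "integrable lborel (\<lambda>t. indicator {0<..} t *\<^sub>R norm (of_real t powr (a - 1) *
        exp (- complex_of_real t)))"
      using set_integrable_norm[OF Gamma_integral_lborel(1)[OF a, of 1]]
          unfolding set_integrable_def by simp
    have bd: "norm (F s t) \<le> indicator {0<..} s *\<^sub>R norm (of_real s powr (1 / 2 - 1) *
        exp (- complex_of_real (p * s))) *
        (indicator {0<..} t *\<^sub>R norm (of_real t powr (a - 1) * exp (- complex_of_real t)))" for s t
    proof (cases "s > 0 \<and> t > 0")
      case True
      then have "norm (F s t) = s powr (- 1 / 2) * exp (- p * s) *
          (t powr (Re a - 1) * exp (- ((1 + y / s) * t)))"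
        by (simp add: F norm_mult norm_of_real_powr)
      also have "\<dots> \<le> s powr (- 1 / 2) * exp (- p * s) * (t powr (Re a - 1) * exp (- t))"
        using True y by (intro mult_left_mono) (auto simp: field_simps)
      finally show ?thesis using True by (simp add: norm_mult norm_of_real_powr)
    qed (auto simp: F_def)
    have int2: "integrable lborel (F s)" for s
    proof (rule Bochner_Integration.integrable_bound[OF integrable_mult_right[OF wi]])
      have "(\<lambda>t. F s t) \<in> borel_measurable lborel" unfolding F_def by measurable
      then show "F s \<in> borel_measurable lborel" by simp
      show "AE t in lborel. norm (F s t) \<le>
          norm (indicator {0<..} s *\<^sub>R norm
          (of_real s powr (1 / 2 - 1) * exp (- complex_of_real (p * s))) *
        (indicator {0<..} t *\<^sub>R norm (of_real t powr (a - 1) * exp (- complex_of_real t))))"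
        by (intro AE_I2 order_trans[OF bd]) (unfold real_norm_def, rule abs_ge_self)
    qed
    then show "AE s in lborel. integrable lborel (\<lambda>t. case (s, t) of (s, t) \<Rightarrow> F s t)" by simp
    show "integrable lborel (\<lambda>s. LINT t|lborel. norm (case (s, t) of (s, t) \<Rightarrow> F s t))"
    proof (rule Bochner_Integration.integrable_bound)
      show "integrable lborel (\<lambda>s. indicator {0<..} s *\<^sub>R norm (of_real s powr (1 / 2 - 1) *
          exp (- complex_of_real (p * s))) * W)"
        using set_integrable_norm[OF Gamma_integral_lborel(1)[of "1 / 2", OF _ p]]
            unfolding set_integrable_def by simp
      show "(\<lambda>s. LINT t|lborel. norm (case (s, t) of (s, t) \<Rightarrow> F s t)) \<in> borel_measurable lborel"
        using meas by measurable
      show "AE s in lborel. norm (LINT t|lborel. norm (case (s, t) of (s, t) \<Rightarrow> F s t)) \<le>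
        norm (indicator {0<..} s *\<^sub>R norm
            (of_real s powr (1 / 2 - 1) * exp (- complex_of_real (p * s))) * W)"
      proof (rule AE_I2)
        fix s
        have "(LINT t|lborel. norm (F s t)) \<le>
            indicator {0<..} s *\<^sub>R norm
            (of_real s powr (1 / 2 - 1) * exp (- complex_of_real (p * s))) * W"
          unfolding W_def set_lebesgue_integral_def integral_mult_right_zero[symmetric]
          by (rule integral_mono[OF integrable_norm[OF int2] integrable_mult_right[OF wi] bd])
        then show "norm (LINT t|lborel. norm (case (s, t) of (s, t) \<Rightarrow> F s t)) \<le>
          norm (indicator {0<..} s *\<^sub>R norm
              (of_real s powr (1 / 2 - 1) * exp (- complex_of_real (p * s))) * W)"
          by (simp add: integral_nonneg)
      qed
    qed
  qed
  have inner_t: "(LINT t|lborel. F s t) =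
      indicator {0<..} s *\<^sub>R
      (Gamma a * (exp (- of_real (p * s)) * (of_real s powr (a - 1 / 2) * of_real (y + s) powr
      (- a))))" for s
  proof (cases "s > 0")
    case True
    have "(LINT t|lborel. F s t) = of_real (s powr (- 1 / 2) * exp (- p * s)) *
        (LINT t:{0<..}|lborel. of_real t powr (a - 1) * exp (- of_real ((1 + y / s) * t)))"
      unfolding F[OF True] set_lebesgue_integral_def[symmetric] set_integral_mult_right ..
    also have "\<dots> = of_real (s powr (- 1 / 2) * exp (- p * s)) *
        (Gamma a * of_real (1 + y / s) powr (- a))"
      using Gamma_integral_lborel(2)[OF a, of "1 + y / s"] True y by (simp add: add_pos_pos)
    also have "\<dots> = Gamma a * (of_real (s powr (- 1 / 2) * exp (- p * s)) *
        of_real (1 + y / s) powr (- a))"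
      by (simp only: mult_ac)
    also have "of_real (s powr (- 1 / 2) * exp (- p * s)) * of_real (1 + y / s) powr (- a) =
       exp (- of_real (p * s)) * (of_real s powr (a - 1 / 2) * complex_of_real (y + s) powr (- a))"
    proof -
      have "1 + y / s = (y + s) / s" using True by (simp add: field_simps)
      then have ln: "ln (1 + y / s) = ln (y + s) - ln s" using True y by (simp add: ln_div)
      have pos: "1 + y / s > 0" "y + s > 0" using True y by (auto intro: add_pos_pos)
      have "s powr (- 1 / 2) * exp (- p * s) = exp (- (1 / 2) * ln s - p * s)"
        using True by (simp add: powr_def exp_add[symmetric])
      then have "complex_of_real (s powr (- 1 / 2) * exp (- p * s)) =
          exp (of_real (- (1 / 2) * ln s - p * s))"
        by (simp only: exp_of_real)
      then show ?thesis
        unfolding of_real_powr_eq_exp[OF pos(1)] of_real_powr_eq_exp[OF pos(2)]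
            of_real_powr_eq_exp[OF True] ln
        by (simp add: exp_add[symmetric] algebra_simps)
    qed
    finally show ?thesis using True by (simp add: mult_ac)
  qed (simp add: F_def)
  have inner_s: "(LINT s|lborel. F s t) = of_real (sqrt pi / sqrt p) * (indicator {0<..} t *\<^sub>R
      (of_real t powr (a - 1) * exp (- of_real t) * complex_of_real
          (exp (- 2 * sqrt (y * p * t)))))" for t
  proof (cases "t > 0")
    case True
    have "(LINT s|lborel. F s t) = (of_real t powr (a - 1) * exp (- of_real t)) *
        (LINT s:{0<..}|lborel. complex_of_real
            (s powr (- 1 / 2) * exp (- ((sqrt (t * y))\<^sup>2 / s) - (sqrt p)\<^sup>2 * s)))"
      unfolding G[OF True] set_lebesgue_integral_def[symmetric] set_integral_mult_right ..
    also have "\<dots> = (of_real t powr (a - 1) * exp (- of_real t)) *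
        of_real (sqrt pi / sqrt p * exp (- 2 * sqrt (t * y) * sqrt p))"
      using heat_kernel_integral[of "sqrt (t * y)" "sqrt p"] True y p by simp
    finally show ?thesis using True by (simp add: real_sqrt_mult mult_ac)
  qed (simp add: F_def)
  have "(LINT t|lborel. LINT s|lborel. F s t) = (LINT s|lborel. LINT t|lborel. F s t)"
    by (rule lborel_pair.Fubini_integral[OF intF])
  then have "Gamma a * (LINT s:{0<..}|lborel. exp (- of_real (p * s)) *
      (of_real s powr (a - 1 / 2) * of_real (y + s) powr (- a))) =
    of_real (sqrt pi / sqrt p) * (LINT t:{0<..}|lborel. of_real t powr (a - 1) * exp (- of_real t) *
        complex_of_real (exp (- 2 * sqrt (y * p * t))))"
    unfolding inner_t inner_s set_lebesgue_integral_def[symmetric] set_integral_mult_right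
        integral_mult_right_zero by simp
  also have "\<dots> = of_real (sqrt pi / sqrt p) * (Gamma a * kummer_Phi a (1 / 2) (of_real (y * p)) -
      2 * of_real (sqrt (y * p)) * (Gamma (a + 1 / 2) * kummer_Phi (a + 1 / 2) (3 / 2)
          (of_real (y * p))))"
    using Gamma_integral_exp_sqrt[OF a, of "y * p"] p y by simp
  finally show ?thesis .
qed

lemma right_half_plane: "open {p. Re p > 0}" "convex {p. Re p > 0}"
  using open_halfspace_Re_gt[of 0] convex_halfspace_Re_gt[of 0] by auto

lemma exp_mult_integrable_bound:
  fixes f :: "real \<Rightarrow> complex"
  assumes p: "Re p > 0" and f: "continuous_on {0<..} f"
    and b: "\<And>s. s > 0 \<Longrightarrow> norm (f s) \<le> C * s powr (r - 1)" and r: "r > 0"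
  shows "set_integrable lborel {0<..} (\<lambda>s. exp (- p * of_real s) * f s)"
proof (rule set_integrable_real_bound)
  show "set_integrable lborel {0<..} (\<lambda>s. C * norm (of_real s powr (of_real r - 1) *
      exp (- complex_of_real (Re p * s))))"
    using set_integrable_norm[OF Gamma_integral_lborel(1)[of "of_real r" "Re p"]] p r by simp
  show "set_borel_measurable lborel {0<..} (\<lambda>s. exp (- p * of_real s) * f s)"
    by (intro set_borel_measurable_lborel_continuous continuous_intros f) auto
  show "norm (exp (- p * of_real s) * f s) \<le> C * norm (of_real s powr (of_real r - 1) *
      exp (- complex_of_real (Re p * s)))"
    if "s \<in> {0<..}" for s
    using mult_left_mono[OF b[of s], of "exp (- (Re p * s))"] that
    by (simp add: norm_mult norm_of_real_powr mult_ac)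
qed

text \<open>Since y + s \<ge> s and Re a > 0, the powers of a cancel in the majorant.\<close>

lemma Tricomi_kernel_bound:
  assumes "Re a > 0" "y > 0" "s > 0"
  shows "norm (of_real s powr (a - 1 / 2) * of_real (y + s) powr (- a)) \<le> s powr (- 1 / 2)"
proof -
  have "norm (of_real s powr (a - 1 / 2) * of_real (y + s) powr (- a)) = s powr (Re a - 1 / 2) *
      (y + s) powr (- Re a)"
    using assms by (simp add: norm_mult norm_of_real_powr del: of_real_add)
  also have "\<dots> \<le> s powr (Re a - 1 / 2) * s powr (- Re a)"
    using assms by (intro mult_left_mono powr_mono2') auto
  also have "\<dots> = s powr (- 1 / 2)" by (simp add: powr_add[symmetric])
  finally show ?thesis .
qed

text \<open>The identity theorem in p extends the real case to the right half-plane. The root of p,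
  which the real case has as a denominator, is moved to the left, so that both sides are visibly
  holomorphic.\<close>

lemma Tricomi_integral:
  assumes a: "Re a > 0" and p: "Re p > 0" and y: "y > 0"
  shows "p powr (1 / 2) *
      (Gamma a * (LINT s:{0<..}|lborel. exp (- p * of_real s) *
      (of_real s powr (a - 1 / 2) * of_real (y + s) powr (- a)))) =
    of_real (sqrt pi) * (Gamma a * kummer_Phi a (1 / 2) (of_real y * p) -
      2 * (of_real y powr (1 / 2) * p powr (1 / 2)) * (Gamma (a + 1 / 2) * kummer_Phi (a + 1 / 2)
          (3 / 2) (of_real y * p)))"
    (is "?L p = ?R p")
proof -
  let ?H = "{p. Re p > 0}"
  let ?f = "\<lambda>p s. exp (- p * of_real s) *
      (of_real s powr (a - 1 / 2) * of_real (y + s) powr (- a)) :: complex"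
  note H = right_half_plane
  have cont: "continuous_on {0<..} (\<lambda>s. of_real s powr (a - 1 / 2) *
      complex_of_real (y + s) powr (- a))"
    by (intro continuous_intros) (use y in auto)
  have "(\<lambda>p. LINT s:{0<..}|lborel. ?f p s) holomorphic_on ?H"
  proof (rule holomorphic_parametric_integral[OF H(1)])
    show "(\<lambda>p. ?f p s) holomorphic_on ?H" for s :: real by (intro holomorphic_intros)
    show "set_borel_measurable lborel {0<..} (?f p)" for p
      by (intro set_borel_measurable_lborel_continuous continuous_intros cont) auto
    show "\<exists>h::real \<Rightarrow> real. set_integrable lborel {0<..} h \<and>
        (\<forall>\<^sub>F q in nhds p. \<forall>s\<in>{0<..}. norm (?f q s) \<le> h s)"
      if "p \<in> ?H" for p
    proof (intro exI conjI)
      \<comment> \<open>All q near p satisfy Re q > Re p / 2, so one majorant serves them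
        all.\<close>
      let ?h = "\<lambda>s. norm (exp (- (of_real (Re p / 2)) * of_real s) *
          complex_of_real s powr (of_real (- 1 / 2)))"
      show "set_integrable lborel {0<..} ?h"
        by (rule set_integrable_norm[OF exp_mult_integrable_bound[where C = 1 and r = "1 / 2"]])
           (use that in \<open>auto intro!: continuous_intros simp: norm_of_real_powr\<close>)
      have "eventually (\<lambda>q. Re q > Re p / 2) (nhds p)"
        using that by (intro order_tendstoD(1)[of Re "Re p"] tendsto_Re filterlim_ident) auto
      then show "\<forall>\<^sub>F q in nhds p. \<forall>s\<in>{0<..}. norm (?f q s) \<le> ?h s"
      proof eventually_elim
        case (elim q)
        show ?case
        proof
          fix s :: real assume s: "s \<in> {0<..}"
          have "norm (?f q s) \<le> exp (- Re q * s) * s powr (- 1 / 2)"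
            unfolding norm_mult[of "exp _"] using s Tricomi_kernel_bound[OF a y, of s]
                by (intro mult_mono) auto
          also have "\<dots> \<le> exp (- (Re p / 2) * s) * s powr (- 1 / 2)"
            using s elim by (intro mult_right_mono) auto
          finally show "norm (?f q s) \<le> ?h s" using s by (simp add: norm_mult norm_of_real_powr)
        qed
      qed
    qed
  qed
  then have holL: "?L holomorphic_on ?H"
    by (intro holomorphic_intros) (auto simp: complex_nonpos_Reals_iff)
  have holR: "?R holomorphic_on ?H"
    by (intro holomorphic_intros H) (auto simp: complex_nonpos_Reals_iff)
  have real: "?L (of_real q) = ?R (of_real q)" if q: "q > 0" for q
  proof -
    have 1: "complex_of_real q powr (1 / 2) = of_real (sqrt q)" "complex_of_real y powr (1 / 2) =
        of_real (sqrt y)"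
      using powr_of_real[of q "1 / 2"] powr_of_real[of y "1 / 2"] q y
          by (simp_all add: powr_half_sqrt)
    show ?thesis using arg_cong[OF Tricomi_integral_real[OF a q y], of "\<lambda>z. of_real (sqrt q) * z"] q
      by (simp add: 1 real_sqrt_mult)
  qed
  have "?L p - ?R p = 0"
  proof (rule analytic_continuation[of "\<lambda>p. ?L p - ?R p" ?H "of_real ` {0<..}" 1])
    show "(\<lambda>p. ?L p - ?R p) holomorphic_on ?H" by (rule holomorphic_on_diff[OF holL holR])
    show "connected ?H" using H by (intro convex_connected)
    show "(1::complex) islimpt of_real ` {0<..}"
      unfolding islimpt_approachable
    proof (intro allI impI)
      fix e :: real assume e: "e > 0"
      have "dist (complex_of_real (1 + e / 2)) (of_real 1) = dist (1 + e / 2) 1"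
          by (rule dist_of_real)
      also have "\<dots> < e" using e by (simp add: dist_real_def)
      finally have "dist (complex_of_real (1 + e / 2)) 1 < e" by (simp only: of_real_1)
      moreover have "complex_of_real (1 + e / 2) \<noteq> 1" using e unfolding of_real_eq_1_iff by simp
      moreover have "complex_of_real (1 + e / 2) \<in> of_real ` {0<..}" using e by (intro imageI) simp
      ultimately show "\<exists>x'\<in>of_real ` {0<..}. x' \<noteq> 1 \<and> dist x' (1::complex) < e" by blast
    qed
    show "?L q - ?R q = 0" if "q \<in> of_real ` {0<..}" for q using that real by auto
  qed (use H p in auto)
  then show ?thesis by simp
qed

text \<open>Integration by parts: the derivative of exp (- p s) g(s) integrates to 0 over the
  half-line, which trades the factor p for the two terms of g'. The condition Re a > 1/2 makes g
  vanish at 0 and g' integrable there.\<close>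

lemma Laplace_deriv:
  assumes a: "Re a > 1 / 2" and p: "Re p > 0" and y: "y > 0"
  shows "set_integrable lborel {0<..} (\<lambda>s. exp (- p * of_real s) *
      (of_real s powr (a - 3 / 2) * of_real (y + s) powr (- a)))"
    and "set_integrable lborel {0<..} (\<lambda>s. exp (- p * of_real s) *
        (of_real s powr (a - 1 / 2) * of_real (y + s) powr (- a - 1)))"
    and "p * (LINT s:{0<..}|lborel. exp (- p * of_real s) *
        (of_real s powr (a - 1 / 2) * of_real (y + s) powr (- a))) =
      (a - 1 / 2) * (LINT s:{0<..}|lborel. exp (- p * of_real s) *
          (of_real s powr (a - 3 / 2) * of_real (y + s) powr (- a)))
      - a * (LINT s:{0<..}|lborel. exp (- p * of_real s) * (of_real s powr (a - 1 / 2) * of_real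
          (y + s) powr (- a - 1)))"
proof -
  let ?g = "\<lambda>s. of_real s powr (a - 1 / 2) * complex_of_real (y + s) powr (- a)"
  let ?g1 = "\<lambda>s. of_real s powr (a - 3 / 2) * complex_of_real (y + s) powr (- a)"
  let ?g2 = "\<lambda>s. of_real s powr (a - 1 / 2) * complex_of_real (y + s) powr (- a - 1)"
  let ?e = "\<lambda>s. exp (- p * complex_of_real s)"
  have c: "continuous_on {0<..} ?g" "continuous_on {0<..} ?g1" "continuous_on {0<..} ?g2"
    using y by (auto intro!: continuous_intros simp del: of_real_add)
  have b: "norm (of_real s powr u * complex_of_real (y + s) powr w) \<le> y powr (Re w) * s powr (Re u)"
      if "s > 0" "Re w \<le> 0" for s u w
    using that y by (auto simp: norm_mult norm_of_real_powr mult.commute simp del: of_real_add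
        intro!: mult_right_mono powr_mono2')
  show i1: "set_integrable lborel {0<..} (\<lambda>s. ?e s * ?g1 s)"
    using b[where u = "a - 3 / 2" and w = "- a"] a
    by (intro exp_mult_integrable_bound[OF p c(2), where C = "y powr (Re (- a))"
        and r = "Re a - 1 / 2"]) auto
  show i2: "set_integrable lborel {0<..} (\<lambda>s. ?e s * ?g2 s)"
    using b[where u = "a - 1 / 2" and w = "- a - 1"] a
    by (intro exp_mult_integrable_bound[OF p c(3), where C = "y powr (Re (- a - 1))"
        and r = "Re a + 1 / 2"]) auto
  have i: "set_integrable lborel {0<..} (\<lambda>s. ?e s * ?g s)"
    using b[where u = "a - 1 / 2" and w = "- a"] a
    by (intro exp_mult_integrable_bound[OF p c(1), where C = "y powr (Re (- a))"
        and r = "Re a + 1 / 2"]) auto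
  \<comment> \<open>This is the derivative of \<open>?e s * ?g s\<close>, whose boundary values are
    the subject of \<open>lim0\<close> and \<open>liminf\<close>.\<close>
  define f where "f s = (a - 1 / 2) * (?e s * ?g1 s) - a * (?e s * ?g2 s) - p * (?e s * ?g s)" for s
  have fi: "set_integrable lborel {0<..} f"
    unfolding f_def by (intro set_integral_diff set_integrable_mult_right i i1 i2)
  have fv: "(LINT s:{0<..}|lborel. f s) = (a - 1 / 2) * (LINT s:{0<..}|lborel. ?e s * ?g1 s)
      - a * (LINT s:{0<..}|lborel. ?e s * ?g2 s) - p * (LINT s:{0<..}|lborel. ?e s * ?g s)"
    unfolding f_def using i i1 i2 by (simp add: set_integral_diff)
  have lim0: "((\<lambda>s. ?e s * ?g s) \<longlongrightarrow> 0) (at_right 0)"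
  proof (rule Lim_null_comparison)
    have "((\<lambda>s::real. y powr (- Re a) * s powr (Re a - 1 / 2)) \<longlongrightarrow> y powr (- Re a) *
        0 powr (Re a - 1 / 2)) (at_right 0)"
      using a by (intro tendsto_intros) (auto simp: eventually_at_filter)
    then show "((\<lambda>s::real. y powr (- Re a) * s powr (Re a - 1 / 2)) \<longlongrightarrow> 0) (at_right 0)" by simp
    have "eventually (\<lambda>s::real. s > 0) (at_right 0)" by (rule eventually_at_right_less)
    then show "\<forall>\<^sub>F s in at_right 0. norm (?e s * ?g s) \<le> y powr (- Re a) * s powr (Re a - 1 / 2)"
    proof eventually_elim
      case (elim s)
      have "norm (?e s) * norm (?g s) \<le> 1 * (y powr (- Re a) * s powr (Re a - 1 / 2))"
        using b[of s "- a" "a - 1 / 2"] elim a p by (intro mult_mono) auto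
      then show ?case by (simp only: norm_mult mult_1_left)
    qed
  qed
  have liminf: "((\<lambda>s. ?e s * ?g s) \<longlongrightarrow> 0) at_top"
  proof (rule Lim_null_comparison)
    show "((\<lambda>s::real. s powr (- 1 / 2)) \<longlongrightarrow> 0) at_top"
      by (rule tendsto_neg_powr) (auto intro: filterlim_ident)
    have "eventually (\<lambda>s::real. s > 0) at_top" by (rule eventually_gt_at_top)
    then show "\<forall>\<^sub>F s in at_top. norm (?e s * ?g s) \<le> s powr (- 1 / 2)"
    proof eventually_elim
      case (elim s)
      have "norm (?e s) * norm (?g s) \<le> 1 * s powr (- 1 / 2)"
        using Tricomi_kernel_bound[of a y s] elim a p y by (intro mult_mono) auto
      then show ?case by (simp only: norm_mult mult_1_left)
    qed
  qed
  have ei: "einterval 0 \<infinity> = {0<..}" by (auto simp: einterval_def)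
  have "(LBINT s=0..\<infinity>. f s) = 0 - 0"
  proof (rule interval_integral_FTC_integrable)
    fix s :: real assume "0 < ereal s"
    then have s: "s > 0" by simp
    have d1: "((\<lambda>s. of_real s powr u) has_vector_derivative u *
        complex_of_real s powr (u - 1)) (at s)" for u
    proof -
      have "((\<lambda>z. z powr u) has_field_derivative u *
          complex_of_real s powr (u - 1)) (at (of_real s))"
        using s by (intro has_field_derivative_powr) (auto simp: complex_nonpos_Reals_iff)
      from has_vector_derivative_real_field[OF this] show ?thesis .
    qed
    have d2: "((\<lambda>s. of_real (y + s) powr u) has_vector_derivative u *
        complex_of_real (y + s) powr (u - 1)) (at s)" for u
    proof -
      have "((\<lambda>z. (of_real y + z) powr u) has_field_derivative u *
          (of_real y + complex_of_real s) powr (u - 1)) (at (of_real s))"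
        using s y by (auto intro!: derivative_eq_intros simp: complex_nonpos_Reals_iff)
      from has_vector_derivative_real_field[OF this] show ?thesis by simp
    qed
    have d3: "(?e has_vector_derivative - p * ?e s) (at s)"
    proof -
      have "((\<lambda>z. exp (- p * z)) has_field_derivative - p *
          exp (- p * of_real s)) (at (complex_of_real s))"
        by (auto intro!: derivative_eq_intros)
      from has_vector_derivative_real_field[OF this] show ?thesis .
    qed
    have "((\<lambda>s. ?e s * ?g s) has_vector_derivative
        (?e s * (of_real s powr (a - 1 / 2) * (- a * complex_of_real (y + s) powr (- a - 1)) +
            (a - 1 / 2) * complex_of_real s powr (a - 1 / 2 - 1) * complex_of_real (y + s) powr
            (- a))
        + - p * ?e s * ?g s)) (at s)"
      by (intro has_vector_derivative_mult d1 d2 d3)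
    moreover have e: "a - 1 / 2 - 1 = a - 3 / 2" by simp
    have alg: "E * (S1 * (- a * Y1) + (a - 1 / 2) * S3 * Y0) + - p * E * (S1 * Y0) =
      (a - 1 / 2) * (E * (S3 * Y0)) - a * (E * (S1 * Y1)) - p * (E * (S1 * Y0))" for E S1 S3 Y0 Y1
      by (simp add: algebra_simps)
    ultimately show "((\<lambda>s. ?e s * ?g s) has_vector_derivative f s) (at s)"
      unfolding f_def e alg by simp
    have ce: "continuous_on {0<..} ?e" by (intro continuous_intros)
    have "continuous_on {0<..} f" unfolding f_def
      by (intro continuous_on_diff continuous_on_mult_left continuous_on_mult[OF ce c(1)]
          continuous_on_mult[OF ce c(2)] continuous_on_mult[OF ce c(3)])
    then show "isCont f s" using s by (simp add: continuous_on_eq_continuous_at)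
  next
    show "set_integrable lborel (einterval 0 \<infinity>) f" unfolding ei by (rule fi)
    show "(((\<lambda>s. ?e s * ?g s) \<circ> real_of_ereal) \<longlongrightarrow> 0) (at_right 0)"
      unfolding zero_ereal_def ereal_tendsto_simps by (rule lim0)
    show "(((\<lambda>s. ?e s * ?g s) \<circ> real_of_ereal) \<longlongrightarrow> 0) (at_left \<infinity>)"
      unfolding ereal_tendsto_simps by (rule liminf)
  qed auto
  then have "(LINT s:{0<..}|lborel. f s) = 0"
    by (simp add: interval_lebesgue_integral_def ei)
  then show "p * (LINT s:{0<..}|lborel. ?e s * ?g s) = (a - 1 / 2) *
      (LINT s:{0<..}|lborel. ?e s * ?g1 s)
      - a * (LINT s:{0<..}|lborel. ?e s * ?g2 s)"
    unfolding fv by (simp add: algebra_simps)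
qed

lemma Gamma_minus_half: "Gamma (- (1 / 2)) = (- 2 * of_real (sqrt pi) :: complex)"
proof -
  have "- (1 / 2) \<notin> (\<int>\<^sub>\<le>\<^sub>0 :: complex set)"
  proof
    assume "- (1 / 2) \<in> (\<int>\<^sub>\<le>\<^sub>0 :: complex set)"
    then obtain n where "- (1 / 2) = complex_of_int n" by (auto elim: nonpos_Ints_cases)
    then have "complex_of_int (2 * n) = of_int (- 1)" by (simp flip: \<open>- (1 / 2) = complex_of_int n\<close>)
    then have "2 * n = - 1" by (simp only: of_int_eq_iff)
    then show False by presburger
  qed
  from Gamma_plus1[OF this] show ?thesis using Gamma_one_half_complex by simp
qed

text \<open>The bracket on the left is that of \<open>parabolic_D\<close> at order - 2 a. Of the two
  roots of p that meet here, one comes from \<open>Tricomi_integral\<close> and one from the odd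
  part of the other parabolic cylinder function; their product p is removed by
  \<open>Laplace_deriv\<close>.\<close>

theorem Tricomi_Laplace:
  assumes a: "Re a > 1 / 2" and p: "Re p > 0" and y: "y > 0"
  shows "p powr (1 / 2) * (Gamma (1 / 2) * rGamma (a + 1 / 2) *
      kummer_Phi a (1 / 2) (of_real y * p) +
      of_real y powr (1 / 2) * p powr (1 / 2) * (Gamma (- (1 / 2)) * rGamma a) * kummer_Phi
          (a + 1 / 2) (3 / 2) (of_real y * p)) =
    rGamma (a + 1 / 2) * ((a - 1 / 2) * (LINT s:{0<..}|lborel. exp (- p * of_real s) *
        (of_real s powr (a - 3 / 2) * of_real (y + s) powr (- a)))
      - a * (LINT s:{0<..}|lborel. exp (- p * of_real s) * (of_real s powr (a - 1 / 2) * of_real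
          (y + s) powr (- a - 1))))"
proof -
  have a0: "Re a > 0" "Re (a + 1 / 2) > 0" using a by auto
  have g: "Gamma a * rGamma a = 1" "Gamma (a + 1 / 2) * rGamma (a + 1 / 2) = 1"
    using Gamma_nonzero[OF Re_pos_not_nonpos_Ints[OF a0(1)]]
        Gamma_nonzero[OF Re_pos_not_nonpos_Ints[OF a0(2)]]
    by (auto simp: rGamma_inverse_Gamma)
  have pp: "p powr (1 / 2) * p powr (1 / 2) = p" using p by (auto simp: powr_add[symmetric])
  define W where "W = (LINT s:{0<..}|lborel. exp (- p * of_real s) *
      (of_real s powr (a - 1 / 2) * of_real (y + s) powr (- a)))"
  define K1 K2 where "K1 = kummer_Phi a (1 / 2) (of_real y * p)"
      and "K2 = kummer_Phi (a + 1 / 2) (3 / 2) (of_real y * p)"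
  define P Y where "P = p powr (1 / 2)" and "Y = complex_of_real y powr (1 / 2)"
  define S where "S = complex_of_real (sqrt pi)"
  have T: "P * (Gamma a * W) = S * (Gamma a * K1 - 2 * (Y * P) * (Gamma (a + 1 / 2) * K2))"
    using Tricomi_integral[OF a0(1) p y] unfolding W_def K1_def K2_def P_def Y_def S_def .
  have "P * (S * rGamma (a + 1 / 2) * K1 + Y * P * ((- 2 * S) * rGamma a) * K2) =
     P * rGamma (a + 1 / 2) * rGamma a *
         (S * (Gamma a * K1 - 2 * (Y * P) * (Gamma (a + 1 / 2) * K2)))"
  proof -
    have "P * rGamma (a + 1 / 2) * rGamma a *
        (S * (Gamma a * K1 - 2 * (Y * P) * (Gamma (a + 1 / 2) * K2))) =
      P * rGamma (a + 1 / 2) * S * K1 * (Gamma a * rGamma a) -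
      2 * P * rGamma a * S * Y * P * K2 * (Gamma (a + 1 / 2) * rGamma (a + 1 / 2))"
      by (simp only: right_diff_distrib mult_ac)
    then show ?thesis unfolding g by (simp add: algebra_simps)
  qed
  also have "\<dots> = P * rGamma (a + 1 / 2) * rGamma a * (P * (Gamma a * W))" unfolding T ..
  also have "\<dots> = rGamma (a + 1 / 2) * (P * P * W) * (Gamma a * rGamma a)" by (simp only: mult_ac)
  also have "\<dots> = rGamma (a + 1 / 2) * (p * W)" using pp unfolding g(1) P_def by simp
  finally have main: "P * (S * rGamma (a + 1 / 2) * K1 + Y * P * ((- 2 * S) * rGamma a) * K2) =
      rGamma (a + 1 / 2) * (p * W)" .
  show ?thesis
    unfolding Gamma_minus_half Gamma_one_half_complex using main
    unfolding K1_def K2_def P_def Y_def S_def W_def Laplace_deriv(3)[OF a p y] .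
qed

section \<open>The inner convolution integral\<close>

lemma hyp2F1_commute: "hyp2F1 a b c z = hyp2F1 b a c z"
proof -
  have "fps_hypergeo [a, b] [c] 1 = fps_hypergeo [b, a] [c] 1"
    by (rule fps_ext) (simp add: mult.commute)
  then show ?thesis unfolding hyp2F1_def by simp
qed

text \<open>Legendre's duplication formula in reciprocal form. In this half-plane the only pole of
  Gamma z is 0, where both sides vanish.\<close>

lemma rGamma_duplication:
  assumes "Re z > - 1 / 2"
  shows "rGamma z * rGamma (z + 1 / 2) * of_real (sqrt pi) = 2 powr (2 * z - 1) * rGamma (2 * z)" 
proof (cases "z = 0")
  case False
  have "z \<notin> \<int>\<^sub>\<le>\<^sub>0"
  proof
    assume "z \<in> \<int>\<^sub>\<le>\<^sub>0"
    then obtain n where n: "z = of_int n" "n \<le> 0" by (auto elim: nonpos_Ints_cases)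
    then have "n > - 1" using assms by simp
    then show False using n False by simp
  qed
  moreover have h: "z + 1 / 2 \<notin> \<int>\<^sub>\<le>\<^sub>0" using assms by (intro Re_pos_not_nonpos_Ints) simp
  ultimately have d: "Gamma z * Gamma (z + 1 / 2) = exp ((1 - 2 * z) * of_real (ln 2)) *
      of_real (sqrt pi) * Gamma (2 * z)"
    by (rule Gamma_legendre_duplication)
  have g: "Gamma z \<noteq> 0" "Gamma (z + 1 / 2) \<noteq> 0"
    using \<open>z \<notin> \<int>\<^sub>\<le>\<^sub>0\<close> h Gamma_nonzero by auto
  then have "Gamma (2 * z) \<noteq> 0" using d by auto
  moreover have "2 powr (2 * z - 1) * exp ((1 - 2 * z) * of_real (ln 2)) = 1"
    by (simp add: powr_def Ln_of_real[of 2, simplified] exp_add[symmetric] algebra_simps)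
  ultimately show ?thesis using g d unfolding rGamma_inverse_Gamma by (simp add: field_simps)
qed simp

lemma exp_real_ln: "x > 0 \<Longrightarrow> complex_of_real x = exp (of_real (ln x))"
  by (simp add: exp_of_real)

text \<open>This factorisation and the one in \<open>one_minus_argument_greater\<close> keep the
  arguments below 1 and display how they approach minus infinity and 1, respectively, as t tends to
  x.\<close>

lemma one_minus_argument_less:
  fixes x y t :: real
  assumes "t < x" "0 < y + t"
  shows "1 - t * (x - y - t) / ((x - t) * (y + t)) = x * y / ((x - t) * (y + t))"
proof -
  have "(x - t) * (y + t) \<noteq> 0" using assms by auto
  then have "1 - t * (x - y - t) / ((x - t) * (y + t)) = ((x - t) * (y + t) - t * (x - y - t)) /
      ((x - t) * (y + t))"
    unfolding diff_divide_distrib by (simp only: divide_self not_False_eq_True)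
  also have "(x - t) * (y + t) - t * (x - y - t) = x * y" by (simp add: algebra_simps)
  finally show ?thesis .
qed

lemma one_minus_argument_greater:
  fixes x y t :: real
  assumes "0 < t" "0 < y - x + t"
  shows "1 - x * y / (t * (y - x + t)) = (t - x) * (t + y) / (t * (y - x + t))"
proof -
  have "t * (y - x + t) \<noteq> 0" using assms by auto
  then have "1 - x * y / (t * (y - x + t)) = (t * (y - x + t) - x * y) / (t * (y - x + t))"
    unfolding diff_divide_distrib by (simp only: divide_self not_False_eq_True)
  also have "t * (y - x + t) - x * y = (t - x) * (t + y)" by (simp add: algebra_simps)
  finally show ?thesis .
qed

text \<open>The substitution \<open>u = g v\<close> is the Moebius map that takes 0, 1, infinity to
  t, 0, y + t. The fourth singular point x is the image of 1 / z, so z is a cross-ratio. Each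
  difference of u from a singular point carries one factor 1 / D v and the derivative carries two;
  the condition \<open>sum\<close> makes them cancel.\<close>

lemma Moebius_integral_less:
  fixes \<alpha> \<beta> \<gamma> \<delta> :: complex and x y t :: real
  assumes t: "0 < t" "t < x" and y: "0 < y" and sum: "\<delta> = - 2 - \<alpha> - \<beta> - \<gamma>"
    and \<alpha>: "Re \<alpha> > - 1" and \<gamma>: "Re \<gamma> > - 1"
  defines "z \<equiv> t * (x - y - t) / ((x - t) * (y + t))"
  shows "set_integrable lborel {0<..<t}
      (\<lambda>u. of_real (t - u) powr \<alpha> * of_real (y + t - u) powr \<beta> * of_real u powr \<gamma> * of_real (x - u)
          powr \<delta>)"
    and "(LINT u:{0<..<t}|lborel. of_real (t - u) powr \<alpha> * of_real (y + t - u) powr \<beta> *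
        of_real u powr \<gamma> * of_real (x - u) powr \<delta>) =
      of_real t powr (\<alpha> + \<gamma> + 1) * of_real (y + t) powr (- \<alpha> - 1) * of_real y powr (\<alpha> + \<beta> + 1) *
          of_real (x - t) powr \<delta> *
      (Beta (\<alpha> + 1) (\<gamma> + 1) * hyp2F1 (\<alpha> + 1) (- \<delta>) (\<alpha> + \<gamma> + 2) (of_real z))"
proof -
  let ?f = "\<lambda>u. of_real (t - u) powr \<alpha> * of_real (y + t - u) powr \<beta> * of_real u powr \<gamma> *
      complex_of_real (x - u) powr \<delta>"
  define D where "D v = y + t - v * t" for v
  define g where "g v = t * (y + t) * (1 - v) / D v" for v
  define g' where "g' v = - (t * y * (y + t)) / (D v)\<^sup>2" for v
  define C where "C = of_real t powr (\<alpha> + \<gamma> + 1) * of_real (y + t) powr (- \<alpha> - 1) *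
      of_real y powr (\<alpha> + \<beta> + 1) * complex_of_real (x - t) powr \<delta>"
  let ?E = "\<lambda>v. of_real v powr (\<alpha> + 1 - 1) * of_real (1 - v) powr (\<gamma> + 1 - 1) *
      complex_of_real (1 - z * v) powr (- (- \<delta>))"
  have Dpos: "D v > 0" if "v \<in> {0<..<1}" for v
  proof -
    have "v * t \<le> 1 * t" using that t by (intro mult_right_mono) auto
    then show ?thesis using y by (simp add: D_def)
  qed
  have z1: "1 - z = x * y / ((x - t) * (y + t))"
    unfolding z_def by (rule one_minus_argument_less) (use t y in auto)
  have "x * y / ((x - t) * (y + t)) > 0" using t y by (intro divide_pos_pos mult_pos_pos) auto
  then have z: "z < 1" using z1 by linarith
  have e1: "t - g v = v * t * y / D v" "y + t - g v = y * (y + t) / D v"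
    "x - g v = (x - t) * (y + t) * (1 - z * v) / D v" if "v \<in> {0<..<1}" for v
  proof -
    have D0: "D v \<noteq> 0" using Dpos[OF that] by simp
    have xt: "x - t \<noteq> 0" "y + t \<noteq> 0" using t y by auto
    have "t * D v - t * (y + t) * (1 - v) = v * t * y" by (simp add: D_def algebra_simps)
    then show "t - g v = v * t * y / D v" using D0 by (simp add: g_def field_simps)
    have "(y + t) * D v - t * (y + t) * (1 - v) = y * (y + t)" by (simp add: D_def algebra_simps)
    then show "y + t - g v = y * (y + t) / D v" using D0 by (simp add: g_def field_simps)
    have "(x - t) * (y + t) * (1 - z * v) = (x - t) * (y + t) - v * (t * (x - y - t))"
    proof -
      have "z * ((x - t) * (y + t)) = t * (x - y - t)" unfolding z_def using xt by simp
      moreover have "M * (1 - z * v) = M - v * (z * M)" for M by (simp add: algebra_simps)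
      ultimately show ?thesis by simp
    qed
    also have "\<dots> = x * D v - t * (y + t) * (1 - v)" by (simp add: D_def algebra_simps)
    finally show "x - g v = (x - t) * (y + t) * (1 - z * v) / D v" using D0
        by (simp add: g_def field_simps)
  qed
  have zv: "1 - z * v > 0" if "v \<in> {0<..<1}" for v
  proof (cases "z \<le> 0")
    case True
    then have "z * v \<le> 0" using that by (intro mult_nonpos_nonneg) auto
    then show ?thesis by simp
  next
    case False
    then have "z * v \<le> z * 1" using that by (intro mult_left_mono) auto
    then show ?thesis using z by simp
  qed
  have im: "g ` {0<..<1} = {0<..<t}"
  proof (intro equalityI subsetI)
    fix u assume "u \<in> g ` {0<..<1}"
    then obtain v where v: "v \<in> {0<..<1}" "u = g v" by auto
    have "t - g v > 0" unfolding e1(1)[OF v(1)] using v(1) t y Dpos[OF v(1)]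
        by (intro divide_pos_pos mult_pos_pos) auto
    moreover have "g v > 0" unfolding g_def using v(1) t y Dpos[OF v(1)]
        by (intro divide_pos_pos mult_pos_pos) auto
    ultimately show "u \<in> {0<..<t}" using v by auto
  next
    fix u assume u: "u \<in> {0<..<t}"
    \<comment> \<open>The inverse of \<open>g\<close>, obtained by solving u D v = t (y + t) (1 - v)
      for v.\<close>
    define v where "v = (t - u) * (y + t) / (t * (y + t - u))"
    have pos: "t * (y + t - u) > 0" using u t y by (intro mult_pos_pos) auto
    have "(t - u) * (y + t) > 0" using u t y by (intro mult_pos_pos) auto
    then have "v > 0" unfolding v_def using pos by (intro divide_pos_pos)
    moreover have "(t - u) * (y + t) < t * (y + t - u)" using mult_pos_pos[of u y] u y
        by (simp add: algebra_simps)
    then have "v < 1" unfolding v_def using pos by simp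
    moreover have "g v = u"
    proof -
      have v': "v * (t * (y + t - u)) = (t - u) * (y + t)" using pos
          by (metis v_def less_irrefl nonzero_eq_divide_eq)
      have "t * (y + t) * (1 - v) - u * D v = (t * (y + t) - u * (y + t)) - v * (t * (y + t - u))"
        by (simp add: D_def algebra_simps)
      also have "\<dots> = 0" unfolding v' by (simp add: algebra_simps)
      finally have N: "t * (y + t) * (1 - v) = u * D v" by simp
      show ?thesis unfolding g_def N using Dpos[of v] \<open>v > 0\<close> \<open>v < 1\<close> by simp
    qed
    ultimately show "u \<in> g ` {0<..<1}" by (intro image_eqI[of _ _ v]) auto
  qed
  have inj: "inj_on g {0<..<1}"
  proof (rule inj_onI)
    fix v w assume v: "v \<in> {0<..<1}" and w: "w \<in> {0<..<1}" and eq: "g v = g w"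
    have "v * t * y / D v = w * t * y / D w" using e1(1)[OF v] e1(1)[OF w] eq by simp
    then have "v * D w = w * D v" using Dpos[OF v] Dpos[OF w] t y by (simp add: field_simps)
    then have "v * (y + t) = w * (y + t)" by (simp add: D_def algebra_simps)
    then show "v = w" using t y by simp
  qed
  have der: "(g has_field_derivative g' v) (at v)" if "v \<in> {0<..<1}" for v
  proof -
    have D0: "D v \<noteq> 0" using Dpos[OF that] by simp
    have "(D has_field_derivative - t) (at v)" unfolding D_def[abs_def]
        by (auto intro!: derivative_eq_intros)
    then have "(g has_field_derivative ((t * (y + t) * (0 - 1)) * D v - t * (y + t) * (1 - v) *
        (- t)) / (D v * D v)) (at v)"
      unfolding g_def[abs_def] using D0
          by (intro DERIV_divide DERIV_cmult DERIV_diff DERIV_const DERIV_ident)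
    moreover have "(t * (y + t) * (0 - 1)) * D v - t * (y + t) * (1 - v) * (- t) = -
        (t * y * (y + t))"
      by (simp add: D_def algebra_simps)
    ultimately show ?thesis by (simp add: g'_def power2_eq_square)
  qed
  have cf: "continuous_on (g ` {0<..<1}) ?f"
    unfolding im by (intro continuous_intros) (use t y in auto)
  have cg': "continuous_on {0<..<1} g'"
  proof -
    have "continuous_on {0<..<1} D" unfolding D_def by (intro continuous_intros)
    moreover have "D v \<noteq> 0" if "v \<in> {0<..<1}" for v using Dpos[OF that] by simp
    ultimately show ?thesis unfolding g'_def by (intro continuous_intros) auto
  qed
  \<comment> \<open>All bases are positive reals, so the claim becomes a linear identity between
    logarithms, from which that of \<open>D v\<close> drops out by \<open>sum\<close>.\<close>
  have key: "\<bar>g' v\<bar> *\<^sub>R ?f (g v) = C * ?E v" if v: "v \<in> {0<..<1}" for v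
  proof -
    have pos: "0 < v" "0 < 1 - v" "0 < D v" "0 < 1 - z * v" "0 < y + t" "0 < x - t"
      using v Dpos zv t y by auto
    have l1: "ln (t - g v) = ln v + ln t + ln y - ln (D v)" unfolding e1(1)[OF v] using pos t y
        by (simp add: ln_mult ln_div)
    have l2: "ln (y + t - g v) = ln y + ln (y + t) - ln (D v)" unfolding e1(2)[OF v] using pos t y
        by (simp add: ln_mult ln_div)
    have l3: "ln (x - g v) = ln (x - t) + ln (y + t) + ln (1 - z * v) - ln (D v)"
        unfolding e1(3)[OF v] using pos t y by (simp add: ln_mult ln_div)
    have l4: "ln (g v) = ln t + ln (y + t) + ln (1 - v) - ln (D v)" unfolding g_def using pos t y
        by (simp add: ln_mult ln_div)
    have l5: "ln \<bar>g' v\<bar> = ln t + ln y + ln (y + t) - 2 * ln (D v)"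
      unfolding g'_def using pos t y by (simp add: ln_mult ln_div ln_realpow abs_mult)
    have q: "t - g v > 0" "y + t - g v > 0" "x - g v > 0" "g v > 0" "\<bar>g' v\<bar> > 0"
      unfolding e1[OF v] unfolding g_def g'_def using pos t y by auto
    have "\<bar>g' v\<bar> *\<^sub>R ?f (g v) = exp (of_real (ln \<bar>g' v\<bar>)) *
      (exp (\<alpha> * of_real (ln (t - g v))) * exp (\<beta> * of_real (ln (y + t - g v))) * exp
          (\<gamma> * of_real (ln (g v))) * exp (\<delta> * of_real (ln (x - g v))))"
      unfolding scaleR_conv_of_real exp_real_ln[OF q(5)]
      unfolding of_real_powr_eq_exp[OF q(1)] of_real_powr_eq_exp[OF q(2)]
          of_real_powr_eq_exp[OF q(3)] of_real_powr_eq_exp[OF q(4)] ..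
    also have "\<dots> = exp (of_real (ln \<bar>g' v\<bar>) +
        (\<alpha> * of_real (ln (t - g v)) + \<beta> * of_real (ln (y + t - g v)) + \<gamma> * of_real (ln (g v)) + \<delta> *
        of_real (ln (x - g v))))"
      by (simp only: exp_add)
    also have "of_real (ln \<bar>g' v\<bar>) + (\<alpha> * of_real (ln (t - g v)) + \<beta> * of_real (ln (y + t - g v)) +
        \<gamma> * of_real (ln (g v)) + \<delta> * of_real (ln (x - g v)))
      = (\<alpha> + \<gamma> + 1) * of_real (ln t) + (- \<alpha> - 1) * of_real (ln (y + t)) + (\<alpha> + \<beta> + 1) * of_real
          (ln y) + \<delta> * of_real (ln (x - t))
       + ((\<alpha> + 1 - 1) * of_real (ln v) + (\<gamma> + 1 - 1) * of_real (ln (1 - v)) + (- (- \<delta>)) * of_real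
           (ln (1 - z * v)))"
      unfolding l1 l2 l3 l4 l5 sum of_real_add of_real_diff of_real_mult
          by (simp add: algebra_simps)
    also have "exp \<dots> = C * ?E v"
      unfolding C_def of_real_powr_eq_exp[OF t(1)] of_real_powr_eq_exp[OF y]
          of_real_powr_eq_exp[OF pos(1)] of_real_powr_eq_exp[OF pos(2)]
        of_real_powr_eq_exp[OF pos(4)] of_real_powr_eq_exp[OF pos(5)] of_real_powr_eq_exp[OF pos(6)]
      by (simp only: exp_add mult.assoc)
    finally show ?thesis .
  qed
  have b: "Re (\<alpha> + 1) > 0" "Re (\<gamma> + 1) > 0" using \<alpha> \<gamma> by auto
  have borel: "{0<..<1::real} \<in> sets borel" "g ` {0<..<1} \<in> sets borel" unfolding im by auto
  have subst: "set_integrable lborel {0<..<t} ?f \<longleftrightarrow> set_integrable lborel {0<..<1}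
      (\<lambda>v. \<bar>g' v\<bar> *\<^sub>R ?f (g v))"
    "(LINT u:{0<..<t}|lborel. ?f u) = (LINT v:{0<..<1}|lborel. \<bar>g' v\<bar> *\<^sub>R ?f (g v))"
    unfolding im[symmetric]
        by (rule set_integral_substitution_real[OF borel _ inj cf cg'], rule der, assumption)+
  have si: "set_integrable lborel {0<..<1} (\<lambda>v. \<bar>g' v\<bar> *\<^sub>R ?f (g v)) \<longleftrightarrow> set_integrable lborel
      {0<..<1} (\<lambda>v. C * ?E v)"
    by (intro set_integrable_cong refl key)
  show "set_integrable lborel {0<..<t} ?f"
    by (rule iffD2[OF subst(1)], rule iffD2[OF si])
        (intro set_integrable_mult_right Euler_integral_integrable b z)
  have "(LINT u:{0<..<t}|lborel. ?f u) = (LINT v:{0<..<1}|lborel. C * ?E v)"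
    unfolding subst(2) by (intro set_lebesgue_integral_cong) (simp, intro allI impI key)
  also have "\<dots> = C * (Beta (\<alpha> + 1) (\<gamma> + 1) * hyp2F1 (- \<delta>) (\<alpha> + 1) (\<alpha> + 1 + (\<gamma> + 1)) (of_real z))"
    unfolding set_integral_mult_right Euler_integral[OF b z] ..
  also have "hyp2F1 (- \<delta>) (\<alpha> + 1) (\<alpha> + 1 + (\<gamma> + 1)) (of_real z) =
      hyp2F1 (\<alpha> + 1) (- \<delta>) (\<alpha> + \<gamma> + 2) (of_real z)"
    by (simp add: hyp2F1_commute[of "- \<delta>"] algebra_simps)
  finally show "(LINT u:{0<..<t}|lborel. ?f u) = of_real t powr (\<alpha> + \<gamma> + 1) *
      of_real (y + t) powr (- \<alpha> - 1) * of_real y powr (\<alpha> + \<beta> + 1) * of_real (x - t) powr \<delta> *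
      (Beta (\<alpha> + 1) (\<gamma> + 1) * hyp2F1 (\<alpha> + 1) (- \<delta>) (\<alpha> + \<gamma> + 2) (of_real z))"
    unfolding C_def .
qed

text \<open>Here x lies below t and ends the interval. The Moebius map therefore takes 0, 1,
  infinity to x, 0, t, and it is y + t that becomes the image of 1 / z.\<close>

lemma Moebius_integral_greater:
  fixes \<alpha> \<beta> \<gamma> \<delta> :: complex and x y t :: real
  assumes t: "x < t" and x: "0 < x" and y: "0 < y" and sum: "\<alpha> = - 2 - \<beta> - \<gamma> - \<delta>"
    and \<gamma>: "Re \<gamma> > - 1" and \<delta>: "Re \<delta> > - 1"
  defines "z \<equiv> x * y / (t * (y - x + t))"
  shows "set_integrable lborel {0<..<x}
      (\<lambda>u. of_real (t - u) powr \<alpha> * of_real (y + t - u) powr \<beta> * of_real u powr \<gamma> * of_real (x - u)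
          powr \<delta>)"
    and "(LINT u:{0<..<x}|lborel. of_real (t - u) powr \<alpha> * of_real (y + t - u) powr \<beta> *
        of_real u powr \<gamma> * of_real (x - u) powr \<delta>) =
      of_real x powr (\<gamma> + \<delta> + 1) * of_real t powr (- \<delta> - 1) * of_real (t - x) powr (- \<beta> - \<gamma> - 1) *
          of_real (y - x + t) powr \<beta> *
      (Beta (\<delta> + 1) (\<gamma> + 1) * hyp2F1 (- \<beta>) (\<delta> + 1) (\<gamma> + \<delta> + 2) (of_real z))"
proof -
  let ?f = "\<lambda>u. of_real (t - u) powr \<alpha> * of_real (y + t - u) powr \<beta> * of_real u powr \<gamma> *
      complex_of_real (x - u) powr \<delta>"
  define D where "D v = t - v * x" for v
  define g where "g v = x * t * (1 - v) / D v" for v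
  define g' where "g' v = - (x * t * (t - x)) / (D v)\<^sup>2" for v
  define C where "C = of_real x powr (\<gamma> + \<delta> + 1) * of_real t powr (- \<delta> - 1) *
      of_real (t - x) powr (- \<beta> - \<gamma> - 1) * complex_of_real (y - x + t) powr \<beta>"
  let ?E = "\<lambda>v. of_real v powr (\<delta> + 1 - 1) * of_real (1 - v) powr (\<gamma> + 1 - 1) *
      complex_of_real (1 - z * v) powr (- (- \<beta>))"
  have t0: "t > 0" "t - x > 0" "y - x + t > 0" using t x y by auto
  have Dpos: "D v > 0" if "v \<in> {0<..<1}" for v
  proof -
    have "v * x \<le> 1 * x" using that x by (intro mult_right_mono) auto
    then show ?thesis using t by (simp add: D_def)
  qed
  have "(t - x) * (t + y) / (t * (y - x + t)) > 0" using t0 y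
      by (intro divide_pos_pos mult_pos_pos) auto
  moreover have "1 - z = (t - x) * (t + y) / (t * (y - x + t))"
    unfolding z_def using t0(1,3) by (rule one_minus_argument_greater)
  ultimately have z: "z < 1" by linarith
  have z0: "z > 0" unfolding z_def using t0 x y by (intro divide_pos_pos mult_pos_pos) auto
  have e1: "t - g v = t * (t - x) / D v" "x - g v = x * v * (t - x) / D v"
    "y + t - g v = t * (y - x + t) * (1 - z * v) / D v" if "v \<in> {0<..<1}" for v
  proof -
    have D0: "D v \<noteq> 0" using Dpos[OF that] by simp
    have xt: "t \<noteq> 0" "y - x + t \<noteq> 0" using t0 by auto
    have "t * D v - x * t * (1 - v) = t * (t - x)" by (simp add: D_def algebra_simps)
    then show "t - g v = t * (t - x) / D v" using D0 by (simp add: g_def field_simps)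
    have "x * D v - x * t * (1 - v) = x * v * (t - x)" by (simp add: D_def algebra_simps)
    then show "x - g v = x * v * (t - x) / D v" using D0 by (simp add: g_def field_simps)
    have "t * (y - x + t) * (1 - z * v) = t * (y - x + t) - v * (x * y)"
    proof -
      have "z * (t * (y - x + t)) = x * y" unfolding z_def using xt by simp
      moreover have "M * (1 - z * v) = M - v * (z * M)" for M by (simp add: algebra_simps)
      ultimately show ?thesis by simp
    qed
    also have "\<dots> = (y + t) * D v - x * t * (1 - v)" by (simp add: D_def algebra_simps)
    finally show "y + t - g v = t * (y - x + t) * (1 - z * v) / D v" using D0
        by (simp add: g_def field_simps)
  qed
  have zv: "1 - z * v > 0" if "v \<in> {0<..<1}" for v
  proof -
    have "z * v \<le> z * 1" using that z0 by (intro mult_left_mono) auto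
    then show ?thesis using z by simp
  qed
  have im: "g ` {0<..<1} = {0<..<x}"
  proof (intro equalityI subsetI)
    fix u assume "u \<in> g ` {0<..<1}"
    then obtain v where v: "v \<in> {0<..<1}" "u = g v" by auto
    have "x - g v > 0" unfolding e1(2)[OF v(1)] using v(1) t0 x Dpos[OF v(1)]
        by (intro divide_pos_pos mult_pos_pos) auto
    moreover have "g v > 0" unfolding g_def using v(1) t0 x Dpos[OF v(1)]
        by (intro divide_pos_pos mult_pos_pos) auto
    ultimately show "u \<in> {0<..<x}" using v by auto
  next
    fix u assume u: "u \<in> {0<..<x}"
    define v where "v = (x - u) * t / (x * (t - u))"
    have pos: "x * (t - u) > 0" using u t x by (intro mult_pos_pos) auto
    have "(x - u) * t > 0" using u t0 by (intro mult_pos_pos) auto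
    then have "v > 0" unfolding v_def using pos by (intro divide_pos_pos)
    moreover have "(x - u) * t < x * (t - u)" using mult_strict_left_mono[OF t, of u] u
        by (simp add: algebra_simps)
    then have "v < 1" unfolding v_def using pos by simp
    moreover have "g v = u"
    proof -
      have v': "v * (x * (t - u)) = (x - u) * t" using pos
          by (metis v_def less_irrefl nonzero_eq_divide_eq)
      have "x * t * (1 - v) - u * D v = (x * t - u * t) - v * (x * (t - u))"
        by (simp add: D_def algebra_simps)
      also have "\<dots> = 0" unfolding v' by (simp add: algebra_simps)
      finally have N: "x * t * (1 - v) = u * D v" by simp
      show ?thesis unfolding g_def N using Dpos[of v] \<open>v > 0\<close> \<open>v < 1\<close> by simp
    qed
    ultimately show "u \<in> g ` {0<..<1}" by (intro image_eqI[of _ _ v]) auto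
  qed
  have inj: "inj_on g {0<..<1}"
  proof (rule inj_onI)
    fix v w assume v: "v \<in> {0<..<1}" and w: "w \<in> {0<..<1}" and eq: "g v = g w"
    have "t * (t - x) / D v = t * (t - x) / D w" 
      unfolding e1(1)[OF v, symmetric] e1(1)[OF w, symmetric] eq ..
    then have "t = 0 \<or> t = x \<or> D v = D w" by simp
    then have "D v = D w" using t t0 by auto
    then show "v = w" using x by (simp add: D_def)
  qed
  have der: "(g has_field_derivative g' v) (at v)" if "v \<in> {0<..<1}" for v
  proof -
    have D0: "D v \<noteq> 0" using Dpos[OF that] by simp
    have "(D has_field_derivative - x) (at v)" unfolding D_def[abs_def]
        by (auto intro!: derivative_eq_intros)
    then have "(g has_field_derivative ((x * t * (0 - 1)) * D v - x * t * (1 - v) * (- x)) /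
        (D v * D v)) (at v)"
      unfolding g_def[abs_def] using D0
          by (intro DERIV_divide DERIV_cmult DERIV_diff DERIV_const DERIV_ident)
    moreover have "(x * t * (0 - 1)) * D v - x * t * (1 - v) * (- x) = - (x * t * (t - x))"
      by (simp add: D_def algebra_simps)
    ultimately show ?thesis by (simp add: g'_def power2_eq_square)
  qed
  have cf: "continuous_on (g ` {0<..<1}) ?f"
    unfolding im by (intro continuous_intros) (use t y in auto)
  have cg': "continuous_on {0<..<1} g'"
  proof -
    have "continuous_on {0<..<1} D" unfolding D_def by (intro continuous_intros)
    moreover have "D v \<noteq> 0" if "v \<in> {0<..<1}" for v using Dpos[OF that] by simp
    ultimately show ?thesis unfolding g'_def by (intro continuous_intros) auto
  qed
  have key: "\<bar>g' v\<bar> *\<^sub>R ?f (g v) = C * ?E v" if v: "v \<in> {0<..<1}" for v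
  proof -
    have pos: "0 < v" "0 < 1 - v" "0 < D v" "0 < 1 - z * v"
      using v Dpos zv by auto
    have l1: "ln (t - g v) = ln t + ln (t - x) - ln (D v)" unfolding e1(1)[OF v] using pos t0 y
        by (simp add: ln_mult ln_div)
    have l2: "ln (y + t - g v) = ln t + ln (y - x + t) + ln (1 - z * v) - ln (D v)"
        unfolding e1(3)[OF v] using pos t0 y by (simp add: ln_mult ln_div)
    have l3: "ln (x - g v) = ln x + ln v + ln (t - x) - ln (D v)" unfolding e1(2)[OF v]
        using pos t0 x by (simp add: ln_mult ln_div)
    have l4: "ln (g v) = ln x + ln t + ln (1 - v) - ln (D v)" unfolding g_def using pos t0 x
        by (simp add: ln_mult ln_div)
    have l5: "ln \<bar>g' v\<bar> = ln x + ln t + ln (t - x) - 2 * ln (D v)"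
      unfolding g'_def using pos t0 x by (simp add: ln_mult ln_div ln_realpow abs_mult)
    have q: "t - g v > 0" "y + t - g v > 0" "x - g v > 0" "g v > 0" "\<bar>g' v\<bar> > 0"
      unfolding e1[OF v] unfolding g_def g'_def using pos t0 x y by auto
    have "\<bar>g' v\<bar> *\<^sub>R ?f (g v) = exp (of_real (ln \<bar>g' v\<bar>)) *
      (exp (\<alpha> * of_real (ln (t - g v))) * exp (\<beta> * of_real (ln (y + t - g v))) * exp
          (\<gamma> * of_real (ln (g v))) * exp (\<delta> * of_real (ln (x - g v))))"
      unfolding scaleR_conv_of_real exp_real_ln[OF q(5)]
      unfolding of_real_powr_eq_exp[OF q(1)] of_real_powr_eq_exp[OF q(2)]
          of_real_powr_eq_exp[OF q(3)] of_real_powr_eq_exp[OF q(4)] ..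
    also have "\<dots> = exp (of_real (ln \<bar>g' v\<bar>) +
        (\<alpha> * of_real (ln (t - g v)) + \<beta> * of_real (ln (y + t - g v)) + \<gamma> * of_real (ln (g v)) + \<delta> *
        of_real (ln (x - g v))))"
      by (simp only: exp_add)
    also have "of_real (ln \<bar>g' v\<bar>) + (\<alpha> * of_real (ln (t - g v)) + \<beta> * of_real (ln (y + t - g v)) +
        \<gamma> * of_real (ln (g v)) + \<delta> * of_real (ln (x - g v)))
      = (\<gamma> + \<delta> + 1) * of_real (ln x) + (- \<delta> - 1) * of_real (ln t) + (- \<beta> - \<gamma> - 1) * of_real
          (ln (t - x)) + \<beta> * of_real (ln (y - x + t))
       + ((\<delta> + 1 - 1) * of_real (ln v) + (\<gamma> + 1 - 1) * of_real (ln (1 - v)) + (- (- \<beta>)) * of_real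
           (ln (1 - z * v)))"
      unfolding l1 l2 l3 l4 l5 sum of_real_add of_real_diff of_real_mult
          by (simp add: algebra_simps)
    also have "exp \<dots> = C * ?E v"
      unfolding C_def of_real_powr_eq_exp[OF x] of_real_powr_eq_exp[OF t0(1)]
          of_real_powr_eq_exp[OF t0(2)] of_real_powr_eq_exp[OF t0(3)]
        of_real_powr_eq_exp[OF pos(1)] of_real_powr_eq_exp[OF pos(2)] of_real_powr_eq_exp[OF pos(4)]
      by (simp only: exp_add mult.assoc)
    finally show ?thesis .
  qed
  have b: "Re (\<delta> + 1) > 0" "Re (\<gamma> + 1) > 0" using \<delta> \<gamma> by auto
  have borel: "{0<..<1::real} \<in> sets borel" "g ` {0<..<1} \<in> sets borel" unfolding im by auto
  have subst: "set_integrable lborel {0<..<x} ?f \<longleftrightarrow> set_integrable lborel {0<..<1}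
      (\<lambda>v. \<bar>g' v\<bar> *\<^sub>R ?f (g v))"
    "(LINT u:{0<..<x}|lborel. ?f u) = (LINT v:{0<..<1}|lborel. \<bar>g' v\<bar> *\<^sub>R ?f (g v))"
    unfolding im[symmetric]
        by (rule set_integral_substitution_real[OF borel _ inj cf cg'], rule der, assumption)+
  have si: "set_integrable lborel {0<..<1} (\<lambda>v. \<bar>g' v\<bar> *\<^sub>R ?f (g v)) \<longleftrightarrow> set_integrable lborel
      {0<..<1} (\<lambda>v. C * ?E v)"
    by (intro set_integrable_cong refl key)
  show "set_integrable lborel {0<..<x} ?f"
    by (rule iffD2[OF subst(1)], rule iffD2[OF si])
        (intro set_integrable_mult_right Euler_integral_integrable b z)
  have "(LINT u:{0<..<x}|lborel. ?f u) = (LINT v:{0<..<1}|lborel. C * ?E v)"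
    unfolding subst(2) by (intro set_lebesgue_integral_cong) (simp, intro allI impI key)
  also have "\<dots> = C * (Beta (\<delta> + 1) (\<gamma> + 1) * hyp2F1 (- \<beta>) (\<delta> + 1) (\<delta> + 1 + (\<gamma> + 1)) (of_real z))"
    unfolding set_integral_mult_right Euler_integral[OF b z] ..
  also have "\<delta> + 1 + (\<gamma> + 1) = \<gamma> + \<delta> + 2" by simp
  finally show "(LINT u:{0<..<x}|lborel. ?f u) = of_real x powr (\<gamma> + \<delta> + 1) *
      of_real t powr (- \<delta> - 1) * of_real (t - x) powr (- \<beta> - \<gamma> - 1) * of_real (y - x + t) powr \<beta> *
      (Beta (\<delta> + 1) (\<gamma> + 1) * hyp2F1 (- \<beta>) (\<delta> + 1) (\<gamma> + \<delta> + 2) (of_real z))"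
    unfolding C_def .
qed

section \<open>The identity for \<open>Re \<mu> < -1\<close>\<close>

lemma powr_half_mult_self: "z powr (1 / 2) * z powr (1 / 2) = (z :: complex)"
  by (cases "z = 0") (simp_all add: powr_add[symmetric])

text \<open>The exponentials of the two functions combine with the prefactor to exp (- p x). The
  root of p left by the odd part is put beside the bracket of order \<mu>, as
  \<open>Tricomi_Laplace\<close> expects it. This form also makes it plain that \<open>lhs\<close>
  is holomorphic in both orders.\<close>

lemma lhs_eq:
  "lhs \<nu> \<mu> p x y = 4 * of_real (sqrt pi) * (2 powr (\<mu> / 2) * 2 powr (\<nu> / 2)) * rGamma (- \<nu> / 2) *
    (p powr (1 / 2) * (Gamma (1 / 2) * rGamma (- \<mu> / 2 + 1 / 2) * kummer_Phi (- \<mu> / 2) (1 / 2)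
        (of_real y * p) +
      of_real y powr (1 / 2) * p powr (1 / 2) * (Gamma (- (1 / 2)) * rGamma (- \<mu> / 2)) * kummer_Phi
          (- \<mu> / 2 + 1 / 2) (3 / 2) (of_real y * p))) *
    (of_real x powr (1 / 2) * (exp (- p * of_real x) * kummer_Phi ((1 - \<nu>) / 2) (3 / 2)
        (p * of_real x)))"
proof -
  define s2 sx sy sp where "s2 = (2 :: complex) powr (1 / 2)"
      and "sx = complex_of_real x powr (1 / 2)"
    and "sy = complex_of_real y powr (1 / 2)" and "sp = p powr (1 / 2)"
  have s2: "s2 \<noteq> 0" by (simp add: s2_def)
  have sq: "(s2 * w powr (1 / 2) * sp) ^ 2 = 2 * (w * p)" for w :: complex
  proof -
    have "(s2 * w powr (1 / 2) * sp) ^ 2 = (s2 * s2) * ((w powr (1 / 2) * w powr (1 / 2)) *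
        (sp * sp))"
      by (simp add: power2_eq_square)
    then show ?thesis unfolding powr_half_mult_self s2_def sp_def by simp
  qed
  have neg: "- s2 * sx * sp = - (s2 * sx * sp)" by simp
  have q: "- (2 * w) / 4 = - w / 2" "2 * w / 2 = w" "s2 * sw * sp / s2 = sw * sp"
      "- (s2 * sw * sp) / s2 = - (sw * sp)" for w sw :: complex
    using s2 by auto
  have a: "(1 - \<mu>) / 2 = - \<mu> / 2 + 1 / 2" by (simp add: field_simps)
  have D1: "parabolic_D \<mu> (s2 * sy * sp) = 2 powr (\<mu> / 2) * exp (- (of_real y * p) / 2) *
      (Gamma (1 / 2) * rGamma (- \<mu> / 2 + 1 / 2) * kummer_Phi (- \<mu> / 2) (1 / 2) (of_real y * p) +
      sy * sp * (Gamma (- (1 / 2)) * rGamma (- \<mu> / 2)) * kummer_Phi (- \<mu> / 2 + 1 / 2) (3 / 2)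
          (of_real y * p))"
    unfolding parabolic_D_def s2_def[symmetric] sy_def sq q unfolding a ..
  define P1 P2 where "P1 = Gamma (1 / 2) * rGamma ((1 - \<nu>) / 2) *
      kummer_Phi (- \<nu> / 2) (1 / 2) (of_real x * p)"
    and "P2 = kummer_Phi ((1 - \<nu>) / 2) (3 / 2) (of_real x * p)"
  have D2: "parabolic_D \<nu> (s2 * sx * sp) = 2 powr (\<nu> / 2) * exp (- (of_real x * p) / 2) *
      (P1 + sx * sp * (Gamma (- (1 / 2)) * rGamma (- \<nu> / 2)) * P2)"
    unfolding parabolic_D_def s2_def[symmetric] sx_def sq q P1_def P2_def ..
  have D3: "parabolic_D \<nu> (- s2 * sx * sp) = 2 powr (\<nu> / 2) * exp (- (of_real x * p) / 2) *
      (P1 + - (sx * sp) * (Gamma (- (1 / 2)) * rGamma (- \<nu> / 2)) * P2)"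
    unfolding neg unfolding parabolic_D_def s2_def[symmetric] power2_minus sx_def sq q P1_def P2_def
        ..
  have e: "exp (1 / 2 * p * of_real (y - x)) * exp (- (of_real y * p) / 2) *
      exp (- (of_real x * p) / 2) = exp (- p * of_real x)"
    by (simp add: exp_add[symmetric] algebra_simps diff_divide_distrib)
  define K where "K = Gamma (1 / 2) * rGamma (- \<mu> / 2 + 1 / 2) *
      kummer_Phi (- \<mu> / 2) (1 / 2) (of_real y * p) +
      sy * sp * (Gamma (- (1 / 2)) * rGamma (- \<mu> / 2)) * kummer_Phi (- \<mu> / 2 + 1 / 2) (3 / 2)
          (of_real y * p)"
  have diff: "A * (P1 + - (sx * sp) * (G * r) * P2) - A * (P1 + sx * sp * (G * r) * P2) = A *
      (- 2 * G) * (sx * sp * r * P2)" for A G r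
    by (simp add: algebra_simps)
  have G: "- 2 * (- 2 * of_real (sqrt pi)) = (4 * of_real (sqrt pi) :: complex)" by simp
  have "lhs \<nu> \<mu> p x y = exp (1 / 2 * p * of_real (y - x)) *
      (2 powr (\<mu> / 2) * exp (- (of_real y * p) / 2) * K) *
     (2 powr (\<nu> / 2) * exp (- (of_real x * p) / 2) * (4 * of_real (sqrt pi)) *
         (sx * sp * rGamma (- \<nu> / 2) * P2))"
    unfolding lhs_def s2_def[symmetric] sx_def[symmetric] sy_def[symmetric] sp_def[symmetric] D1 D2
        D3 diff unfolding K_def[symmetric] unfolding Gamma_minus_half G ..
  also have "\<dots> = 4 * of_real (sqrt pi) * (2 powr (\<mu> / 2) * 2 powr (\<nu> / 2)) * rGamma (- \<nu> / 2) *
      (sp * K) *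
     (sx * ((exp (1 / 2 * p * of_real (y - x)) * exp (- (of_real y * p) / 2) * exp
         (- (of_real x * p) / 2)) * P2))"
    by (simp only: mult_ac)
  finally show ?thesis unfolding e P2_def K_def sx_def sy_def sp_def mult.commute[of p "of_real x"]
      by simp
qed

text \<open>The substitution u = x (1 - v), rather than u = x v, splits exp (- p u) into exp (- p x)
  and exp (p x v) and so produces the factor exp (- p x) of \<open>lhs_eq\<close>.\<close>

lemma Kummer_integral_scaled:
  assumes x: "x > 0" and a: "Re a > 0" and d: "Re d > 0"
  shows "set_integrable lborel {0<..<x} (\<lambda>u. exp (- p * of_real u) *
      (of_real u powr (d - 1) * of_real (x - u) powr (a - 1)))"
    and "(LINT u:{0<..<x}|lborel. exp (- p * of_real u) *
        (of_real u powr (d - 1) * of_real (x - u) powr (a - 1))) =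
      of_real x powr (a + d - 1) *
          (exp (- p * of_real x) * (Beta a d * kummer_Phi a (a + d) (p * of_real x)))"
proof -
  let ?f = "\<lambda>u. exp (- p * of_real u) *
      (of_real u powr (d - 1) * complex_of_real (x - u) powr (a - 1))"
  let ?g = "\<lambda>v. x * (1 - v)"
  let ?C = "of_real x powr (a + d - 1) * exp (- p * of_real x)"
  let ?h = "\<lambda>v. of_real v powr (a - 1) * complex_of_real (1 - v) powr (d - 1) *
      exp (p * of_real x * of_real v)"
  have im: "?g ` {0<..<1} = {0<..<x}"
  proof (intro equalityI subsetI)
    fix u assume u: "u \<in> {0<..<x}"
    then show "u \<in> ?g ` {0<..<1}" using x
        by (intro image_eqI[of _ _ "1 - u / x"]) (auto simp: field_simps)
  qed (use x in auto)
  have inj: "inj_on ?g {0<..<1}" using x by (auto intro!: inj_onI)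
  have der: "(?g has_field_derivative - x) (at v)" for v
    by (auto intro!: derivative_eq_intros)
  have cf: "continuous_on {0<..<x} ?f" by (intro continuous_intros) auto
  have borel: "{0<..<1::real} \<in> sets borel" "?g ` {0<..<1} \<in> sets borel" unfolding im by auto
  note subst = set_integral_substitution_real[OF borel der inj cf[folded im] continuous_on_const,
      unfolded im]
  have key: "\<bar>- x\<bar> *\<^sub>R ?f (?g v) = ?C * ?h v" if v: "v \<in> {0<..<1}" for v
  proof -
    have 1: "x - x * (1 - v) = x * v" by (simp add: algebra_simps)
    have 2: "exp (- p * of_real (x * (1 - v))) = exp (- p * of_real x) *
        exp (p * of_real x * of_real v)"
      by (simp add: exp_add[symmetric] algebra_simps)
    have "of_real x * (of_real x powr (d - 1) * of_real x powr (a - 1)) =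
        complex_of_real x powr (a + d - 1)"
      using powr_add[of "complex_of_real x" 1 "d - 1"] powr_add[of "complex_of_real x" d "a - 1"] x
      by (simp add: algebra_simps)
    then show ?thesis unfolding 1 2 using v x
      by (subst (1 2) of_real_powr_mult) (auto simp: scaleR_conv_of_real mult_ac)
  qed
  have Kint: "set_integrable lborel {0<..<1} ?h"
  proof (rule set_integrable_real_bound)
    show "set_integrable lborel {0<..<1} (\<lambda>v. norm (of_real v powr (a - 1) *
        complex_of_real (1 - v) powr (d - 1)) * exp (norm (p * of_real x)))"
      by (intro set_integrable_mult_left set_integrable_norm Beta_integral_integrable a d)
    show "set_borel_measurable lborel {0<..<1} ?h"
      by (intro set_borel_measurable_lborel_continuous continuous_intros) auto
    show "norm (?h v) \<le> norm (of_real v powr (a - 1) * complex_of_real (1 - v) powr (d - 1)) *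
        exp (norm (p * of_real x))"
      if v: "v \<in> {0<..<1}" for v
    proof -
      have "norm (p * of_real x * of_real v) \<le> norm (p * of_real x) * 1"
        unfolding norm_mult[of "p * of_real x"] using v by (intro mult_left_mono) auto
      then have "norm (exp (p * of_real x * of_real v)) \<le> exp (norm (p * of_real x))"
        by (intro order_trans[OF norm_exp]) auto
      then show ?thesis unfolding norm_mult[of "_ * _" "exp _"] by (intro mult_left_mono) auto
    qed
  qed
  have si: "set_integrable lborel {0<..<1} (\<lambda>v. \<bar>- x\<bar> *\<^sub>R ?f (?g v)) \<longleftrightarrow> set_integrable lborel
      {0<..<1} (\<lambda>v. ?C * ?h v)"
    by (intro set_integrable_cong refl key)
  show "set_integrable lborel {0<..<x} ?f"
    unfolding subst(1) si by (intro set_integrable_mult_right Kint)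
  have "(LINT u:{0<..<x}|lborel. ?f u) = (LINT v:{0<..<1}|lborel. ?C * ?h v)"
    unfolding subst(2) by (intro set_lebesgue_integral_cong) (simp, intro allI impI key)
  then show "(LINT u:{0<..<x}|lborel. ?f u) =
      of_real x powr (a + d - 1) *
          (exp (- p * of_real x) * (Beta a d * kummer_Phi a (a + d) (p * of_real x)))"
    unfolding set_integral_mult_right Kummer_integral[OF a d] by (simp only: mult.assoc)
qed

text \<open>One factor lives on (0, x) only, so the convolution integral runs over 0 < u < min t x.
  This is the source of the two integrals in the theorem; the point t = x is a null set.\<close>

lemma Laplace_convolution:
  fixes f h :: "real \<Rightarrow> complex"
  assumes x: "x > 0" and f: "set_integrable lborel {0<..} (\<lambda>s. exp (- p * of_real s) * f s)"
    and h: "set_integrable lborel {0<..<x} (\<lambda>u. exp (- p * of_real u) * h u)"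
  defines "A \<equiv> \<lambda>t. exp (- p * of_real t) * (LINT u:{0<..<t}|lborel. f (t - u) * h u)"
    and "B \<equiv> \<lambda>t. exp (- p * of_real t) * (LINT u:{0<..<x}|lborel. f (t - u) * h u)"
  shows "set_integrable lborel {0<..<x} A" "set_integrable lborel {x<..} B"
    and "(LINT s:{0<..}|lborel. exp (- p * of_real s) * f s) *
        (LINT u:{0<..<x}|lborel. exp (- p * of_real u) * h u) =
      (LINT t:{0<..<x}|lborel. A t) + (LINT t:{x<..}|lborel. B t)"
proof -
  define F where "F s = indicator {0<..} s *\<^sub>R (exp (- p * of_real s) * f s)" for s
  define H where "H u = indicator {0<..<x} u *\<^sub>R (exp (- p * of_real u) * h u)" for u
  define I where "I t = (LINT u|lborel. F (t - u) * H u)" for t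
  have FH: "integrable lborel F" "integrable lborel H" using f h
      unfolding set_integrable_def F_def H_def by auto
  note conv = integral_convolution[OF FH, folded I_def]
  have e: "exp (- p * of_real (t - u)) * exp (- p * of_real u) = exp (- p * of_real t)"
      for t u :: real
    by (simp add: exp_add[symmetric] algebra_simps)
  have IA: "I t = A t" if "t \<in> {0<..<x}" for t
  proof -
    have "F (t - u) * H u = exp (- p * of_real t) * (indicator {0<..<t} u *\<^sub>R (f (t - u) * h u))"
        for u
      using that unfolding F_def H_def e[of t u, symmetric] by (auto simp: indicator_def)
    then show ?thesis unfolding I_def A_def set_lebesgue_integral_def
        by (simp only: integral_mult_right_zero)
  qed
  have IB: "I t = B t" if "t \<in> {x<..}" for t
  proof -
    have "F (t - u) * H u = exp (- p * of_real t) * (indicator {0<..<x} u *\<^sub>R (f (t - u) * h u))"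
        for u
      using that unfolding F_def H_def e[of t u, symmetric] by (auto simp: indicator_def)
    then show ?thesis unfolding I_def B_def set_lebesgue_integral_def
        by (simp only: integral_mult_right_zero)
  qed
  have I0: "I t = 0" if "t \<le> 0" for t
  proof -
    have "(\<lambda>u. F (t - u) * H u) = (\<lambda>u. 0)" using that by (auto simp: F_def H_def indicator_def)
    then show ?thesis unfolding I_def by simp
  qed
  have si: "set_integrable lborel S I" if "S \<in> sets borel" for S
    unfolding set_integrable_def using that conv(1) by (intro integrable_mult_indicator) auto
  show sA: "set_integrable lborel {0<..<x} A"
    using si[of "{0<..<x}"] IA by (subst set_integrable_cong[OF refl refl, of _ A I]) auto
  show sB: "set_integrable lborel {x<..} B"
    using si[of "{x<..}"] IB by (subst set_integrable_cong[OF refl refl, of _ B I]) auto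
  have "(LINT t|lborel. I t) = (LINT t:{0<..<x} \<union> {x<..}|lborel. I t)"
    unfolding set_lebesgue_integral_def
  proof (rule integral_cong_AE)
    show "I \<in> borel_measurable lborel" using conv(1) by auto
    then show "(\<lambda>t. indicat_real ({0<..<x} \<union> {x<..}) t *\<^sub>R I t) \<in> borel_measurable lborel"
        by measurable
    have "AE t in lborel. t \<noteq> x" by (rule AE_lborel_singleton)
    then show "AE t in lborel. I t = indicat_real ({0<..<x} \<union> {x<..}) t *\<^sub>R I t"
      by eventually_elim (auto simp: indicator_def I0)
  qed
  also have "\<dots> = (LINT t:{0<..<x}|lborel. I t) + (LINT t:{x<..}|lborel. I t)"
    by (rule set_integral_Un) (auto intro: si)
  also have "(LINT t:{0<..<x}|lborel. I t) = (LINT t:{0<..<x}|lborel. A t)"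
    by (intro set_lebesgue_integral_cong) (auto simp: IA)
  also have "(LINT t:{x<..}|lborel. I t) = (LINT t:{x<..}|lborel. B t)"
    by (intro set_lebesgue_integral_cong) (auto simp: IB)
  finally show "(LINT s:{0<..}|lborel. exp (- p * of_real s) * f s) *
      (LINT u:{0<..<x}|lborel. exp (- p * of_real u) * h u) =
      (LINT t:{0<..<x}|lborel. A t) + (LINT t:{x<..}|lborel. B t)"
    using conv(2) unfolding F_def H_def set_lebesgue_integral_def[symmetric] by simp
qed

text \<open>\<open>integrand2\<close> is split so that neither half contains the coefficient \<mu> /
  (1 + \<mu>). Both halves are regular at \<mu> = -1, and the coefficient can be merged with the
  reciprocal Gamma factor.\<close>

definition integrand2a :: "complex \<Rightarrow> complex \<Rightarrow> complex \<Rightarrow> real \<Rightarrow> real \<Rightarrow> real \<Rightarrow> complex" where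
  "integrand2a \<nu> \<mu> p x y t = exp (- p * of_real t) * of_real t powr ((\<nu> - 1) / 2)
     * of_real (t - x) powr (- (2 + \<mu> + \<nu>) / 2) * of_real (y - x + t) powr (\<mu> / 2)
     * hyp2F1 (- \<mu> / 2) ((1 - \<nu>) / 2) (3 / 2) (of_real (x * y / (t * (y - x + t))))"

definition integrand2b :: "complex \<Rightarrow> complex \<Rightarrow> complex \<Rightarrow> real \<Rightarrow> real \<Rightarrow> real \<Rightarrow> complex" where
  "integrand2b \<nu> \<mu> p x y t = exp (- p * of_real t) * of_real t powr ((\<nu> - 1) / 2)
     * of_real (t - x) powr (- (2 + \<mu> + \<nu>) / 2) * of_real (y - x + t) powr (\<mu> / 2)
     * (of_real ((t - x) / (y - x + t)) * hyp2F1 ((2 - \<mu>) / 2) ((1 - \<nu>) / 2) (3 / 2)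
         (of_real (x * y / (t * (y - x + t)))))"

lemma integrand2_eq: "integrand2 \<nu> \<mu> p x y t = integrand2a \<nu> \<mu> p x y t - \<mu> / (1 + \<mu>) *
    integrand2b \<nu> \<mu> p x y t"
proof -
  have 1: "\<mu> * of_real (t - x) / ((1 + \<mu>) * of_real (y - x + t)) = \<mu> / (1 + \<mu>) *
      of_real ((t - x) / (y - x + t))"
    by simp
  show ?thesis unfolding integrand2_def integrand2a_def integrand2b_def 1 right_diff_distrib
      by (simp only: mult_ac)
qed

text \<open>The right-hand side with the removable singularity at \<open>\<mu> = -1\<close> removed, by means of
  \<open>1/\<Gamma>(z) = z/\<Gamma>(z + 1)\<close>.\<close>

definition rhs_reg :: "complex \<Rightarrow> complex \<Rightarrow> complex \<Rightarrow> real \<Rightarrow> real \<Rightarrow> complex" where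
  "rhs_reg \<nu> \<mu> p x y =
     2 powr ((\<mu> - \<nu>) / 2) * of_real (sqrt pi) * of_real y powr (- (1 / 2))
       * rGamma ((1 - \<mu> + \<nu>) / 2) * rGamma (- \<nu>)
       * (LINT t:{0<..<x}|lborel. integrand1 \<nu> \<mu> p x y t)
     + 2 powr ((4 + \<mu> + \<nu>) / 2) * of_real (sqrt pi) * of_real x powr (1 / 2) * rGamma (- \<nu> / 2)
       * (rGamma (- (1 + \<mu>) / 2) * (LINT t:{x<..}|lborel. integrand2a \<nu> \<mu> p x y t)
          + \<mu> / 2 * rGamma ((1 - \<mu>) / 2) * (LINT t:{x<..}|lborel. integrand2b \<nu> \<mu> p x y t))"

lemma rGamma_half_shift: "rGamma (- (1 + \<mu>) / 2) = - (1 + \<mu>) / 2 * rGamma ((1 - \<mu>) / 2 :: complex)"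
proof -
  have "- (1 + \<mu>) / 2 + 1 = (1 - \<mu>) / 2" by (simp add: field_simps)
  then show ?thesis using rGamma_plus1[of "- (1 + \<mu>) / 2"] by (simp only:)
qed

lemma rhs_eq_rhs_reg:
  assumes \<mu>: "\<mu> \<noteq> - 1"
    and "set_integrable lborel {x<..} (integrand2a \<nu> \<mu> p x y)"
        "set_integrable lborel {x<..} (integrand2b \<nu> \<mu> p x y)"
  shows "rhs \<nu> \<mu> p x y = rhs_reg \<nu> \<mu> p x y"
proof -
  have "1 + \<mu> \<noteq> 0" using \<mu> by (metis add.commute add_eq_0_iff)
  \<comment> \<open>The zero of the reciprocal Gamma factor at \<mu> = -1 cancels the pole of the
    coefficient.\<close>
  have 1: "rGamma (- (1 + \<mu>) / 2) * (\<mu> / (1 + \<mu>)) = - (\<mu> / 2 * rGamma ((1 - \<mu>) / 2))"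
  proof -
    have "(- k / 2 * r) * (\<mu> / k) = - (\<mu> / 2 * r)" if "k \<noteq> 0" for k r :: complex using that by simp
    from this[OF \<open>1 + \<mu> \<noteq> 0\<close>] show ?thesis unfolding rGamma_half_shift .
  qed
  have 2: "(LINT t:{x<..}|lborel. integrand2 \<nu> \<mu> p x y t) =
      (LINT t:{x<..}|lborel. integrand2a \<nu> \<mu> p x y t) - \<mu> / (1 + \<mu>) *
          (LINT t:{x<..}|lborel. integrand2b \<nu> \<mu> p x y t)"
    unfolding integrand2_eq by (subst set_integral_diff(2)) (use assms in auto)
  have 3: "K * rGamma (- (1 + \<mu>) / 2) * r * (X - \<mu> / (1 + \<mu>) * Y) = K * r *
      (rGamma (- (1 + \<mu>) / 2) * X - (rGamma (- (1 + \<mu>) / 2) * (\<mu> / (1 + \<mu>))) * Y)" for K r X Y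
    by (simp only: right_diff_distrib mult_ac)
  show ?thesis unfolding rhs_def rhs_reg_def 2 3 1 by simp
qed

text \<open>The bounds on \<nu> make (1 - \<nu>) / 2 and 1 + \<nu> / 2 admissible in Kummer's
  integral; the bound on \<mu> is Re a > 1/2 in the integration by parts. The two kernels
  \<open>f1\<close> and \<open>f2\<close> left by the latter are each convolved with
  \<open>h\<close>, and each convolution yields one hypergeometric function below x and one
  above.\<close>

theorem lhs_eq_rhs_reg_convolution:
  assumes \<nu>: "- 2 < Re \<nu>" "Re \<nu> < 1" and \<mu>: "Re \<mu> < - 1" and p: "Re p > 0" and x: "x > 0"
      and y: "y > 0"
  shows "lhs \<nu> \<mu> p x y = rhs_reg \<nu> \<mu> p x y"
proof -
  define a where "a = - \<mu> / 2"
  have a: "Re a > 1 / 2" using \<mu> by (simp add: a_def)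
  \<comment> \<open>Its Laplace transform over (0, x) is the last factor of \<open>lhs_eq\<close>
    times the Beta value \<open>B\<close>, as recorded in \<open>Hv\<close>.\<close>
  define h where "h u = of_real u powr (\<nu> / 2) * complex_of_real (x - u) powr (- (1 + \<nu>) / 2)" for u
  define f1 where "f1 s = of_real s powr (a - 3 / 2) * complex_of_real (y + s) powr (- a)" for s
  define f2 where "f2 s = of_real s powr (a - 1 / 2) * complex_of_real (y + s) powr (- a - 1)" for s
  have hp: "1 + \<nu> / 2 - 1 = \<nu> / 2" "(1 - \<nu>) / 2 - 1 = - (1 + \<nu>) / 2" "(1 - \<nu>) / 2 + (1 + \<nu> / 2) =
      3 / 2"
    "3 / 2 - 1 = (1 / 2 :: complex)" by (auto simp: field_simps)
  have ab: "Re ((1 - \<nu>) / 2) > 0" "Re (1 + \<nu> / 2) > 0" using \<nu> by auto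
  note H = Kummer_integral_scaled[OF x ab, of p, unfolded hp, folded h_def]
  note F = Laplace_deriv(1,2)[OF a p y, folded f1_def f2_def]
  note C1 = Laplace_convolution[OF x F(1) H(1)] and C2 = Laplace_convolution[OF x F(2) H(1)]
  define B where "B = Beta ((1 - \<nu>) / 2) (1 + \<nu> / 2)"
  define B1 where "B1 = Beta (- (1 + \<mu>) / 2) (1 + \<nu> / 2)"
  define B2 where "B2 = Beta ((1 - \<mu>) / 2) (1 + \<nu> / 2)"
  define Y where "Y = complex_of_real y powr (- (1 / 2))"
  define X where "X = complex_of_real x powr (1 / 2)"
  define pre1 where "pre1 t = exp (- p * of_real t) * of_real t powr (- (1 + \<mu> - \<nu>) / 2)
     * of_real (x - t) powr (- (1 + \<nu>) / 2) * complex_of_real (y + t) powr ((1 + \<mu>) / 2)" for t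
  define z1 where "z1 t = complex_of_real (t * (x - y - t) / ((x - t) * (y + t)))" for t
  define i1a where "i1a t = pre1 t * hyp2F1 (- (1 + \<mu>) / 2) ((1 + \<nu>) / 2) ((1 - \<mu> + \<nu>) / 2) (z1 t)"
      for t
  define i1b where "i1b t = pre1 t *
      (of_real t / of_real (y + t) * hyp2F1 ((1 - \<mu>) / 2) ((1 + \<nu>) / 2) ((3 - \<mu> + \<nu>) / 2)
      (z1 t))" for t
  have i1: "integrand1 \<nu> \<mu> p x y t = i1a t + \<mu> / (1 - \<mu> + \<nu>) * i1b t" for t
  proof -
    have "\<mu> * of_real t / ((1 - \<mu> + \<nu>) * of_real (y + t)) = \<mu> / (1 - \<mu> + \<nu>) *
        (of_real t / of_real (y + t))"
      by (simp only: times_divide_times_eq)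
    then show ?thesis
      unfolding integrand1_def i1a_def i1b_def pre1_def[symmetric] z1_def[symmetric]
      unfolding distrib_left by (simp only: mult_ac)
  qed
  have split: "f1 (t - u) * h u = of_real (t - u) powr (a - 3 / 2) *
      of_real (y + t - u) powr (- a) * of_real u powr (\<nu> / 2) * of_real (x - u) powr
      (- (1 + \<nu>) / 2)"
    "f2 (t - u) * h u = of_real (t - u) powr (a - 1 / 2) * of_real (y + t - u) powr (- a - 1) *
        of_real u powr (\<nu> / 2) * of_real (x - u) powr (- (1 + \<nu>) / 2)" for t u
    unfolding f1_def f2_def h_def add_diff_eq by (simp_all only: mult.assoc)
  \<comment> \<open>The exponents of \<open>f1\<close> and \<open>h\<close> sum to (a - 3/2) - a +
    \<nu>/2 - (1 + \<nu>)/2 = -2, as the Moebius substitution requires. For \<open>f2\<close> one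
    unit moves from the second to the first.\<close>
  have K1: "exp (- p * of_real t) * (LINT u:{0<..<t}|lborel. f1 (t - u) * h u) = B1 * Y * i1a t"
      if t: "t \<in> {0<..<x}" for t
  proof -
    have "(LINT u:{0<..<t}|lborel. f1 (t - u) * h u) = of_real t powr (a - 3 / 2 + \<nu> / 2 + 1) *
        of_real (y + t) powr (- (a - 3 / 2) - 1) * of_real y powr (a - 3 / 2 + - a + 1) * of_real
        (x - t) powr (- (1 + \<nu>) / 2) *
      (Beta (a - 3 / 2 + 1) (\<nu> / 2 + 1) * hyp2F1 (a - 3 / 2 + 1) (- (- (1 + \<nu>) / 2))
          (a - 3 / 2 + \<nu> / 2 + 2) (of_real (t * (x - y - t) / ((x - t) * (y + t)))))"
      unfolding split by (rule Moebius_integral_less(2)) (use t y a \<nu> in \<open>auto simp: field_simps\<close>)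
    moreover have "a - 3 / 2 + \<nu> / 2 + 1 = - (1 + \<mu> - \<nu>) / 2" "- (a - 3 / 2) - 1 = (1 + \<mu>) / 2"
        "a - 3 / 2 + - a + 1 = - (1 / 2)"
      "a - 3 / 2 + 1 = - (1 + \<mu>) / 2" "\<nu> / 2 + 1 = 1 + \<nu> / 2" "- (- (1 + \<nu>) / 2) = (1 + \<nu>) / 2"
          "a - 3 / 2 + \<nu> / 2 + 2 = (1 - \<mu> + \<nu>) / 2"
      by (auto simp: a_def field_simps)
    ultimately show ?thesis unfolding i1a_def pre1_def z1_def B1_def Y_def by (simp only: mult_ac)
  qed
  \<comment> \<open>The unit moved between the exponents of \<open>f2\<close> appears as the
    quotient t / (y + t), and in \<open>K4\<close> as (t - x) / (y - x + t), before the second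
    hypergeometric function.\<close>
  have K2: "exp (- p * of_real t) * (LINT u:{0<..<t}|lborel. f2 (t - u) * h u) = B2 * Y * i1b t"
      if t: "t \<in> {0<..<x}" for t
  proof -
    have "(LINT u:{0<..<t}|lborel. f2 (t - u) * h u) = of_real t powr (a - 1 / 2 + \<nu> / 2 + 1) *
        of_real (y + t) powr (- (a - 1 / 2) - 1) * of_real y powr (a - 1 / 2 + (- a - 1) + 1) *
        of_real (x - t) powr (- (1 + \<nu>) / 2) *
      (Beta (a - 1 / 2 + 1) (\<nu> / 2 + 1) * hyp2F1 (a - 1 / 2 + 1) (- (- (1 + \<nu>) / 2))
          (a - 1 / 2 + \<nu> / 2 + 2) (of_real (t * (x - y - t) / ((x - t) * (y + t)))))"
      unfolding split by (rule Moebius_integral_less(2)) (use t y a \<nu> in \<open>auto simp: field_simps\<close>)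
    moreover have e: "a - 1 / 2 + \<nu> / 2 + 1 = - (1 + \<mu> - \<nu>) / 2 + 1" "- (a - 1 / 2) - 1 = (1 + \<mu>) /
        2 - 1" "a - 1 / 2 + (- a - 1) + 1 = - (1 / 2)"
      "a - 1 / 2 + 1 = (1 - \<mu>) / 2" "\<nu> / 2 + 1 = 1 + \<nu> / 2" "- (- (1 + \<nu>) / 2) = (1 + \<nu>) / 2"
          "a - 1 / 2 + \<nu> / 2 + 2 = (3 - \<mu> + \<nu>) / 2"
      by (auto simp: a_def field_simps)
    moreover have "complex_of_real t powr (- (1 + \<mu> - \<nu>) / 2 + 1) =
        of_real t powr (- (1 + \<mu> - \<nu>) / 2) * of_real t"
      using t by (simp only: powr_add powr_to_1)
    moreover have "complex_of_real (y + t) powr ((1 + \<mu>) / 2 - 1) =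
        of_real (y + t) powr ((1 + \<mu>) / 2) / of_real (y + t)"
      using t y by (simp only: powr_diff powr_to_1)
    ultimately show ?thesis unfolding i1b_def pre1_def z1_def B2_def Y_def
        by (simp only: mult_ac divide_inverse)
  qed
  have K3: "exp (- p * of_real t) * (LINT u:{0<..<x}|lborel. f1 (t - u) * h u) = B * X *
      integrand2a \<nu> \<mu> p x y t" if t: "t \<in> {x<..}" for t
  proof -
    have "(LINT u:{0<..<x}|lborel. f1 (t - u) * h u) = of_real x powr (\<nu> / 2 + - (1 + \<nu>) / 2 + 1) *
        of_real t powr (- (- (1 + \<nu>) / 2) - 1) * of_real (t - x) powr (- (- a) - \<nu> / 2 - 1) *
        of_real (y - x + t) powr (- a) *
      (Beta (- (1 + \<nu>) / 2 + 1) (\<nu> / 2 + 1) * hyp2F1 (- (- a)) (- (1 + \<nu>) / 2 + 1)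
          (\<nu> / 2 + - (1 + \<nu>) / 2 + 2) (of_real (x * y / (t * (y - x + t)))))"
      unfolding split by (rule Moebius_integral_greater(2))
          (use t x y a \<nu> in \<open>auto simp: field_simps\<close>)
    moreover have "\<nu> / 2 + - (1 + \<nu>) / 2 + 1 = 1 / 2" "- (- (1 + \<nu>) / 2) - 1 = (\<nu> - 1) / 2"
        "- (- a) - \<nu> / 2 - 1 = - (2 + \<mu> + \<nu>) / 2" "- (1 + \<nu>) / 2 + 1 = (1 - \<nu>) / 2"
      "\<nu> / 2 + 1 = 1 + \<nu> / 2" "- (- a) = - \<mu> / 2" "- a = \<mu> / 2" "\<nu> / 2 + - (1 + \<nu>) / 2 + 2 = 3 / 2"
      by (auto simp: a_def field_simps)
    ultimately show ?thesis unfolding integrand2a_def B_def X_def by (simp only: mult_ac)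
  qed
  have K4: "exp (- p * of_real t) * (LINT u:{0<..<x}|lborel. f2 (t - u) * h u) = B * X *
      integrand2b \<nu> \<mu> p x y t" if t: "t \<in> {x<..}" for t
  proof -
    have "(LINT u:{0<..<x}|lborel. f2 (t - u) * h u) = of_real x powr (\<nu> / 2 + - (1 + \<nu>) / 2 + 1) *
        of_real t powr (- (- (1 + \<nu>) / 2) - 1) * of_real (t - x) powr (- (- a - 1) - \<nu> / 2 - 1) *
        of_real (y - x + t) powr (- a - 1) *
      (Beta (- (1 + \<nu>) / 2 + 1) (\<nu> / 2 + 1) * hyp2F1 (- (- a - 1)) (- (1 + \<nu>) / 2 + 1)
          (\<nu> / 2 + - (1 + \<nu>) / 2 + 2) (of_real (x * y / (t * (y - x + t)))))"
      unfolding split by (rule Moebius_integral_greater(2))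
          (use t x y a \<nu> in \<open>auto simp: field_simps\<close>)
    moreover have "\<nu> / 2 + - (1 + \<nu>) / 2 + 1 = 1 / 2" "- (- (1 + \<nu>) / 2) - 1 = (\<nu> - 1) / 2"
        "- (- a - 1) - \<nu> / 2 - 1 = - (2 + \<mu> + \<nu>) / 2 + 1" "- (1 + \<nu>) / 2 + 1 = (1 - \<nu>) / 2"
      "\<nu> / 2 + 1 = 1 + \<nu> / 2" "- (- a - 1) = (2 - \<mu>) / 2" "- a - 1 = \<mu> / 2 - 1" "\<nu> / 2 + - (1 + \<nu>) /
          2 + 2 = 3 / 2"
      by (auto simp: a_def field_simps)
    moreover have "complex_of_real (t - x) powr (- (2 + \<mu> + \<nu>) / 2 + 1) =
        of_real (t - x) powr (- (2 + \<mu> + \<nu>) / 2) * of_real (t - x)"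
      using t by (simp only: powr_add powr_to_1)
    moreover have "complex_of_real (y - x + t) powr (\<mu> / 2 - 1) = of_real (y - x + t) powr (\<mu> / 2) /
        of_real (y - x + t)"
      using t y by (simp only: powr_diff powr_to_1)
    ultimately show ?thesis unfolding integrand2b_def B_def X_def of_real_divide
        by (simp only: mult_ac divide_inverse)
  qed
  have nz: "B \<noteq> 0" "B1 \<noteq> 0" "B2 \<noteq> 0" "Y \<noteq> 0" "X \<noteq> 0"
  proof -
    have beta: "Beta u v \<noteq> 0" if "Re u > 0" "Re v > 0" for u v :: complex
      unfolding Beta_def using that by (auto simp: Gamma_eq_zero_iff Re_pos_not_nonpos_Ints)
    have "Re (- (1 + \<mu>) / 2) > 0" "Re ((1 - \<mu>) / 2) > 0" using \<mu> by auto
    with ab show "B \<noteq> 0" "B1 \<noteq> 0" "B2 \<noteq> 0" unfolding B_def B1_def B2_def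
        by (simp_all only: beta not_False_eq_True)
    show "Y \<noteq> 0" "X \<noteq> 0" using x y by (auto simp: X_def Y_def)
  qed
  define J1a J1b J2a J2b where "J1a = (LINT t:{0<..<x}|lborel. i1a t)"
      and "J1b = (LINT t:{0<..<x}|lborel. i1b t)"
    and "J2a = (LINT t:{x<..}|lborel. integrand2a \<nu> \<mu> p x y t)"
        and "J2b = (LINT t:{x<..}|lborel. integrand2b \<nu> \<mu> p x y t)"
  have int: "set_integrable lborel {0<..<x} i1a" "set_integrable lborel {0<..<x} i1b"
  proof -
    have "set_integrable lborel {0<..<x} (\<lambda>t. B1 * Y * i1a t)"
      by (rule iffD1[OF set_integrable_cong[OF refl refl K1] C1(1)])
    then show "set_integrable lborel {0<..<x} i1a" using nz by simp
    have "set_integrable lborel {0<..<x} (\<lambda>t. B2 * Y * i1b t)"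
      by (rule iffD1[OF set_integrable_cong[OF refl refl K2] C2(1)])
    then show "set_integrable lborel {0<..<x} i1b" using nz by simp
  qed
  have L1: "(LINT t:{0<..<x}|lborel. exp (- p * of_real t) * (LINT u:{0<..<t}|lborel. f1 (t - u) *
      h u)) = B1 * Y * J1a"
    unfolding J1a_def set_integral_mult_right[symmetric] using K1
        by (intro set_lebesgue_integral_cong) auto
  have L2: "(LINT t:{0<..<x}|lborel. exp (- p * of_real t) * (LINT u:{0<..<t}|lborel. f2 (t - u) *
      h u)) = B2 * Y * J1b"
    unfolding J1b_def set_integral_mult_right[symmetric] using K2
        by (intro set_lebesgue_integral_cong) auto
  have L3: "(LINT t:{x<..}|lborel. exp (- p * of_real t) * (LINT u:{0<..<x}|lborel. f1 (t - u) *
      h u)) = B * X * J2a"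
    unfolding J2a_def set_integral_mult_right[symmetric] using K3
        by (intro set_lebesgue_integral_cong) auto
  have L4: "(LINT t:{x<..}|lborel. exp (- p * of_real t) * (LINT u:{0<..<x}|lborel. f2 (t - u) *
      h u)) = B * X * J2b"
    unfolding J2b_def set_integral_mult_right[symmetric] using K4
        by (intro set_lebesgue_integral_cong) auto
  have J1: "(LINT t:{0<..<x}|lborel. integrand1 \<nu> \<mu> p x y t) = J1a + \<mu> / (1 - \<mu> + \<nu>) * J1b"
    unfolding i1 J1a_def J1b_def using int by (subst set_integral_add(2)) auto
  define E where "E = exp (- p * of_real x) * kummer_Phi ((1 - \<nu>) / 2) (3 / 2) (p * of_real x)"
  define Hv where "Hv = (LINT u:{0<..<x}|lborel. exp (- p * of_real u) * h u)"
  define F1 F2 where "F1 = (LINT s:{0<..}|lborel. exp (- p * of_real s) * f1 s)"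
      and "F2 = (LINT s:{0<..}|lborel. exp (- p * of_real s) * f2 s)"
  have Hv: "Hv = B * (X * E)"
    unfolding Hv_def H(2) X_def E_def B_def by (simp only: mult_ac)
  have conv1: "F1 * Hv = B1 * Y * J1a + B * X * J2a"
      and conv2: "F2 * Hv = B2 * Y * J1b + B * X * J2b"
    using C1(3) C2(3) unfolding L1 L2 L3 L4 F1_def F2_def Hv_def by auto
  define R where "R = rGamma (a + 1 / 2)"
  have T: "p powr (1 / 2) * (Gamma (1 / 2) * rGamma (a + 1 / 2) *
      kummer_Phi a (1 / 2) (of_real y * p) +
      of_real y powr (1 / 2) * p powr (1 / 2) * (Gamma (- (1 / 2)) * rGamma a) * kummer_Phi
          (a + 1 / 2) (3 / 2) (of_real y * p)) =
      R * ((a - 1 / 2) * F1 - a * F2)"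
    using Tricomi_Laplace[OF a p y] unfolding R_def F1_def F2_def f1_def f2_def .
  define c where "c = 4 * of_real (sqrt pi) * (2 powr (\<mu> / 2) * 2 powr (\<nu> / 2)) * rGamma (- \<nu> / 2)"
  have lhs: "lhs \<nu> \<mu> p x y = c * (R * ((a - 1 / 2) * F1 - a * F2)) * (X * E)"
    unfolding lhs_eq a_def[symmetric] T c_def X_def E_def ..
  have c1: "1 - \<mu> + \<nu> \<noteq> 0"
  proof
    assume "1 - \<mu> + \<nu> = 0"
    then have "Re (1 - \<mu> + \<nu>) = 0" by simp
    then show False using \<nu> \<mu> by simp
  qed
  \<comment> \<open>This ratio of Beta values turns the weights - (1 + \<mu>) / 2 and \<mu> / 2 of
    the two convolutions into the coefficients 1 and \<mu> / (1 - \<mu> + \<nu>) of the first brace,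
    up to a common factor.\<close>
  have B2: "B2 = - (1 + \<mu>) / (1 - \<mu> + \<nu>) * B1"
  proof -
    have "- (1 + \<mu>) / 2 \<notin> \<int>\<^sub>\<le>\<^sub>0" using \<mu> by (intro Re_pos_not_nonpos_Ints) simp
    from Beta_plus1_left[OF this, of "1 + \<nu> / 2"]
    have "(- (1 + \<mu>) / 2 + (1 + \<nu> / 2)) * Beta (- (1 + \<mu>) / 2 + 1) (1 + \<nu> / 2) = - (1 + \<mu>) / 2 * B1"
      unfolding B1_def .
    moreover have "- (1 + \<mu>) / 2 + 1 = (1 - \<mu>) / 2" "- (1 + \<mu>) / 2 + (1 + \<nu> / 2) = (1 - \<mu> + \<nu>) / 2"
        by (auto simp: field_simps)
    ultimately have "(1 - \<mu> + \<nu>) / 2 * B2 = - (1 + \<mu>) / 2 * B1" unfolding B2_def by (simp only:)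
    moreover have "b = m / k * c" if "k / 2 * b = m / 2 * c" "k \<noteq> 0" for b c k m :: complex
      using that by (auto simp: divide_simps mult.commute)
    ultimately show ?thesis using c1 by blast
  qed
  have "((a - 1 / 2) * F1 - a * F2) * Hv = (a - 1 / 2) * (F1 * Hv) - a * (F2 * Hv)"
    by (simp only: left_diff_distrib mult.assoc)
  also have "\<dots> = - (1 + \<mu>) / 2 * (B1 * Y * J1a + B * X * J2a) + \<mu> / 2 *
      (B2 * Y * J1b + B * X * J2b)"
    unfolding conv1 conv2 a_def by (simp add: diff_divide_distrib add_divide_distrib)
  also have "\<dots> = - (1 + \<mu>) / 2 * (B1 * Y) * (J1a + \<mu> / (1 - \<mu> + \<nu>) * J1b) + B * X *
      (- (1 + \<mu>) / 2 * J2a + \<mu> / 2 * J2b)"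
  proof -
    have gen: "Q * (B1 * Y * J1a + B * X * J2a) + m * (B2 * Y * J1b + B * X * J2b) =
        Q * (B1 * Y) * (J1a + k * J1b) + B * X * (Q * J2a + m * J2b)" if "m * B2 = Q * B1 *
            k" for Q m k
    proof -
      have "Q * (B1 * Y * J1a + B * X * J2a) + m * (B2 * Y * J1b + B * X * J2b) =
        Q * B1 * Y * J1a + Q * B * X * J2a + (m * B2) * Y * J1b + m * B * X *
            J2b" by (simp add: algebra_simps)
      then show ?thesis unfolding that by (simp add: algebra_simps)
    qed
    show ?thesis by (rule gen) (simp add: B2)
  qed
  \<comment> \<open>For t > x the inner integrals carry the same Beta value \<open>B\<close> as
    \<open>Hv\<close>, so it cancels there; below x a quotient of Beta values remains.\<close>
  finally have main: "((a - 1 / 2) * F1 - a * F2) * (X * E) = - (1 + \<mu>) / 2 * (B1 / B) * Y *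
      (J1a + \<mu> / (1 - \<mu> + \<nu>) * J1b) + X * (- (1 + \<mu>) / 2 * J2a + \<mu> / 2 * J2b)"
    unfolding Hv using nz by (simp add: field_simps)
  have R: "R = rGamma ((1 - \<mu>) / 2)" unfolding R_def a_def by (simp add: diff_divide_distrib)
  have sh: "rGamma (- (1 + \<mu>) / 2) = - (1 + \<mu>) / 2 * R" unfolding R by (rule rGamma_half_shift)
  have two: "4 * (2 powr (\<mu> / 2) * 2 powr (\<nu> / 2)) = (2 powr ((4 + \<mu> + \<nu>) / 2) :: complex)"
  proof -
    have "(4 + \<mu> + \<nu>) / 2 = 2 + (\<mu> / 2 + \<nu> / 2)" by (simp add: add_divide_distrib)
    then have "(2 powr ((4 + \<mu> + \<nu>) / 2) :: complex) = 2 powr (of_nat 2) *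
        (2 powr (\<mu> / 2) * 2 powr (\<nu> / 2))"
      by (simp only: powr_add of_nat_numeral)
    moreover have "(2::complex) powr (of_nat 2) = 4" by (subst powr_nat) simp
    ultimately show ?thesis by simp
  qed
  \<comment> \<open>In the quotient of Beta values Gamma (1 + \<nu>/2) cancels and Gamma (3/2)
    contributes sqrt pi / 2. The remaining product of reciprocal Gammas at - \<nu>/2 and (1 -
    \<nu>)/2 is merged by duplication.\<close>
  have first: "c * (- (1 + \<mu>) / 2) * R * (B1 / B) = 2 powr ((\<mu> - \<nu>) / 2) * of_real (sqrt pi) *
      rGamma ((1 - \<mu> + \<nu>) / 2) * rGamma (- \<nu>)"
  proof -
    have g: "Gamma (1 + \<nu> / 2) \<noteq> 0" "Gamma ((1 - \<nu>) / 2) \<noteq> 0" "Gamma (- (1 + \<mu>) / 2) \<noteq> 0"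
      using ab \<mu> by (auto simp: Gamma_eq_zero_iff Re_pos_not_nonpos_Ints)
    have s: "- (1 + \<mu>) / 2 + (1 + \<nu> / 2) = (1 - \<mu> + \<nu>) / 2" by (simp add: field_simps)
    have g32: "rGamma (3 / 2) = (2 / of_real (sqrt pi) :: complex)"
    proof -
      have "1 / 2 + 1 = (3 / 2 :: complex)" by simp
      then have "1 / 2 * rGamma (3 / 2) = (inverse (of_real (sqrt pi)) :: complex)"
        using rGamma_plus1[of "1 / 2 :: complex"]
            by (simp only: rGamma_inverse_Gamma[of "1 / 2"] Gamma_one_half_complex)
      moreover have "rGamma (3 / 2) = 2 * (1 / 2 * rGamma (3 / 2 :: complex))" by simp
      ultimately show ?thesis by (simp only: divide_inverse)
    qed
    have k1: "- (1 + \<mu>) / 2 * R * (B1 / B) = rGamma ((1 - \<mu> + \<nu>) / 2) * rGamma ((1 - \<nu>) / 2) *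
        (of_real (sqrt pi) / 2)"
      unfolding sh[symmetric] B1_def B_def Beta_altdef s hp(3) g32
          rGamma_inverse_Gamma[of "- (1 + \<mu>) / 2"] rGamma_inverse_Gamma[of "(1 - \<nu>) / 2"]
      using g by (simp add: field_simps)
    moreover have "rGamma (- \<nu> / 2) * rGamma ((1 - \<nu>) / 2) * of_real (sqrt pi) = 2 powr (- \<nu> - 1) *
        rGamma (- \<nu>)"
      using rGamma_duplication[of "- \<nu> / 2"] \<nu> by (simp add: diff_divide_distrib)
    moreover have "2 * 2 powr (\<mu> / 2) * 2 powr (\<nu> / 2) * 2 powr (- \<nu> - 1) =
        (2 powr ((\<mu> - \<nu>) / 2) :: complex)"
    proof -
      have "(\<mu> - \<nu>) / 2 = 1 + \<mu> / 2 + \<nu> / 2 + (- \<nu> - 1)" by (simp add: field_simps)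
      then show ?thesis by (simp only: powr_add powr_to_1)
    qed
    moreover have "c * (- (1 + \<mu>) / 2) * R * (B1 / B) = c * (- (1 + \<mu>) / 2 * R * (B1 / B))"
        by (simp only: mult.assoc)
    moreover have "4 * s * (m * n) * q * (r1 * r2 * (s / 2)) = (2 * m * n) * s * r1 * (q * r2 * s)"
        for s m n q r1 r2 :: complex
      by (simp add: algebra_simps)
    ultimately have "c * (- (1 + \<mu>) / 2) * R * (B1 / B) = (2 * 2 powr (\<mu> / 2) * 2 powr (\<nu> / 2)) *
        of_real (sqrt pi) * rGamma ((1 - \<mu> + \<nu>) / 2) *
        (rGamma (- \<nu> / 2) * rGamma ((1 - \<nu>) / 2) * of_real (sqrt pi))"
      unfolding c_def by (simp only:)
    also have "\<dots> = (2 * 2 powr (\<mu> / 2) * 2 powr (\<nu> / 2) * 2 powr (- \<nu> - 1)) * of_real (sqrt pi) *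
        rGamma ((1 - \<mu> + \<nu>) / 2) * rGamma (- \<nu>)"
      unfolding \<open>rGamma (- \<nu> / 2) * rGamma ((1 - \<nu>) / 2) * of_real (sqrt pi) = _\<close>
          by (simp only: mult_ac)
    finally show ?thesis unfolding \<open>2 * 2 powr (\<mu> / 2) * 2 powr (\<nu> / 2) * 2 powr (- \<nu> - 1) = _\<close> .
  qed
  have "lhs \<nu> \<mu> p x y = c * R * (((a - 1 / 2) * F1 - a * F2) * (X * E))"
    unfolding lhs by (simp only: mult_ac)
  also have "\<dots> = (c * (- (1 + \<mu>) / 2) * R * (B1 / B)) * Y * (J1a + \<mu> / (1 - \<mu> + \<nu>) * J1b) +
     c * X * ((- (1 + \<mu>) / 2 * R) * J2a + \<mu> / 2 * R * J2b)"
  proof -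
    have "c * R * (q * b * Y * Z + X * (q * Ja + m * Jb)) = (c * q * R * b) * Y * Z + c * X *
        ((q * R) * Ja + m * R * Jb)" for q b Z m Ja Jb
      by (simp add: algebra_simps)
    then show ?thesis unfolding main .
  qed
  also have "\<dots> = rhs_reg \<nu> \<mu> p x y"
    unfolding first sh[symmetric]
    unfolding rhs_reg_def J1 R[symmetric] J2a_def[symmetric] J2b_def[symmetric] two[symmetric] c_def
        X_def Y_def
    by (simp only: mult_ac)
  finally show ?thesis .
qed

section \<open>Analytic continuation\<close>

lemma powr_le_near_0:
  fixes t X r e R :: real
  assumes "0 < t" "t \<le> X" "e \<le> r" "r \<le> R"
  shows "t powr r \<le> max 1 X powr (R - e) * t powr e"
proof -
  have "t powr r = t powr (r - e) * t powr e" by (simp add: powr_add[symmetric])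
  also have "t powr (r - e) \<le> max 1 X powr (r - e)" using assms by (intro powr_mono2) auto
  also have "\<dots> \<le> max 1 X powr (R - e)" using assms by (intro powr_mono) auto
  finally show ?thesis by (simp add: mult_right_mono)
qed

lemma powr_le_compact:
  fixes w A B r R :: real
  assumes "0 < A" "A \<le> w" "w \<le> B" "\<bar>r\<bar> \<le> R"
  shows "w powr r \<le> max 1 (max B (1 / A)) powr R"
proof (cases "r \<ge> 0")
  case True
  have "w powr r \<le> max 1 (max B (1 / A)) powr r" using assms True by (intro powr_mono2) auto
  also have "\<dots> \<le> max 1 (max B (1 / A)) powr R" using assms by (intro powr_mono) auto
  finally show ?thesis .
next
  case False
  have "w powr r = (1 / w) powr (- r)" using assms by (simp add: powr_minus powr_divide)
  also have "1 / w \<le> 1 / A" using assms by (intro divide_left_mono) auto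
  then have "(1 / w) powr (- r) \<le> max 1 (max B (1 / A)) powr (- r)" using assms False
      by (intro powr_mono2) auto
  also have "\<dots> \<le> max 1 (max B (1 / A)) powr R" using assms by (intro powr_mono) auto
  finally show ?thesis .
qed

text \<open>One bound for exponents of either sign: for small s the base is near y, which costs the
  constant, and for large s it grows like s.\<close>

lemma powr_le_growth:
  fixes s y r R :: real
  assumes "0 < s" "0 < y" "\<bar>r\<bar> \<le> R"
  shows "(y + s) powr r \<le> max 1 (max y (1 / y)) powr R * (1 + s) powr R"
proof -
  let ?m = "max 1 (max y (1 / y))"
  have "(y + s) powr r \<le> (?m * (1 + s)) powr R"
  proof (cases "r \<ge> 0")
    case True
    have "y + s \<le> ?m * 1 + ?m * s" using assms
        by (intro add_mono) (auto simp: mult_le_cancel_right1)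
    then have "y + s \<le> ?m * (1 + s)" by (simp add: algebra_simps)
    moreover have "1 \<le> ?m * (1 + s)" using mult_mono[of 1 ?m 1 "1 + s"] assms by simp
    ultimately have "(y + s) powr r \<le> (?m * (1 + s)) powr r" "(?m * (1 + s)) powr r \<le>
        (?m * (1 + s)) powr R"
      using assms True by (auto intro!: powr_mono2 powr_mono)
    then show ?thesis by simp
  next
    case False
    have "(y + s) powr r = (1 / (y + s)) powr (- r)" using assms
        by (simp add: powr_minus powr_divide)
    also have "1 / (y + s) \<le> 1 / y" using assms by (intro divide_left_mono) auto
    then have "(1 / (y + s)) powr (- r) \<le> ?m powr (- r)" using assms False
        by (intro powr_mono2) auto
    also have "\<dots> \<le> ?m powr R" using assms by (intro powr_mono) auto
    also have "?m powr R \<le> (?m * (1 + s)) powr R" using assms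
        by (intro powr_mono2) (auto simp: mult_le_cancel_left1)
    finally show ?thesis .
  qed
  also have "\<dots> = ?m powr R * (1 + s) powr R" using assms by (simp add: powr_mult)
  finally show ?thesis .
qed

text \<open>Take ln w \<le> w - 1 at w = r z / Q. The constant is the maximum of z^Q exp (- r z),
  attained at z = Q / r.\<close>

lemma powr_le_exp:
  fixes z Q r :: real
  assumes "z > 0" "Q > 0" "r > 0"
  shows "z powr Q \<le> exp (- Q - Q * ln (r / Q)) * exp (r * z)"
proof -
  have "ln (r / Q * z) \<le> r / Q * z - 1" using assms by (intro ln_le_minus_one) auto
  then have "Q * ln (r / Q * z) \<le> Q * (r / Q * z - 1)" using assms by (intro mult_left_mono) auto
  moreover have "ln (r / Q * z) = ln (r / Q) + ln z" using assms by (intro ln_mult_pos) auto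
  ultimately have "Q * ln z \<le> - Q - Q * ln (r / Q) + r * z" using assms by (simp add: algebra_simps)
  then show ?thesis using assms by (simp add: powr_def exp_add[symmetric])
qed

lemma eventually_norm_le:
  assumes "(f \<longlongrightarrow> (l::complex)) F" shows "eventually (\<lambda>x. norm (f x) \<le> norm l + 1) F"
  using order_tendstoD(2)[OF tendsto_norm[OF assms], of "norm l + 1"]
      by (auto elim: eventually_mono)

lemma beta_weight_integrable:
  assumes "x > 0" "e > - 1" "f > - 1"
  shows "set_integrable lborel {0<..<x} (\<lambda>t::real. K * (t powr e * (x - t) powr f))"
proof -
  have "set_integrable lborel {0<..<x} (\<lambda>t. norm (exp (- 0 * complex_of_real t) *
      (of_real t powr (of_real (e + 1) - 1) * of_real (x - t) powr (of_real (f + 1) - 1))))"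
    by (intro set_integrable_norm Kummer_integral_scaled(1)) (use assms in auto)
  also have "?this \<longleftrightarrow> set_integrable lborel {0<..<x} (\<lambda>t. t powr e * (x - t) powr f)"
    by (intro set_integrable_cong refl) (auto simp: norm_mult norm_of_real_powr simp
        del: of_real_diff)
  finally show ?thesis by (rule set_integrable_mult_right)
qed

lemma gamma_weight_integrable:
  assumes "e > - 1" "r > 0"
  shows "set_integrable lborel {x<..} (\<lambda>t::real. K * (exp (- r * (t - x)) * (t - x) powr e))"
proof -
  have "set_integrable lborel {0<..} (\<lambda>t. norm (complex_of_real t powr (of_real (e + 1) - 1) *
      exp (- of_real (r * t))))"
    by (intro set_integrable_norm Gamma_integral_lborel(1)) (use assms in auto)
  also have "?this \<longleftrightarrow> set_integrable lborel {0<..} (\<lambda>t. exp (- r * t) * t powr e)"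
    by (intro set_integrable_cong refl) (auto simp: norm_mult norm_of_real_powr)
  finally have "integrable lborel (\<lambda>t. indicator {0<..} t *\<^sub>R (exp (- r * t) * t powr e))"
    unfolding set_integrable_def .
  then have "integrable lborel (\<lambda>t. indicator {0<..} (- x + 1 * t) *\<^sub>R (exp (- r * (- x + 1 * t)) *
      (- x + 1 * t) powr e))"
    by (rule lborel_integrable_real_affine) simp
  also have "(\<lambda>t. indicator {0<..} (- x + 1 * t) *\<^sub>R (exp (- r * (- x + 1 * t)) *
      (- x + 1 * t) powr e)) =
      (\<lambda>t. indicator {x<..} t *\<^sub>R (exp (- r * (t - x)) * (t - x) powr e))"
    by (auto simp: indicator_def)
  finally have "set_integrable lborel {x<..} (\<lambda>t. exp (- r * (t - x)) * (t - x) powr e)"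
    unfolding set_integrable_def .
  then show ?thesis by (rule set_integrable_mult_right)
qed

text \<open>At t = 0 the argument is 0 and only the power of t matters. As t tends to x the argument
  tends to minus infinity, and growth of order e in 1 - z costs a factor (x - t)^(-e).\<close>

lemma integrand1_bound:
  assumes N: "(N \<longlongrightarrow> \<nu>) F" and M: "(M \<longlongrightarrow> \<mu>) F"
    and \<nu>: "Re \<nu> < 1" and \<mu>: "Re \<mu> < 1 + Re \<nu>" "Re \<mu> < - Re \<nu>"
    and p: "Re p > 0" and x: "x > 0" and y: "y > 0"
  shows "\<exists>h. set_integrable lborel {0<..<x} h \<and>
    eventually (\<lambda>l. \<forall>t\<in>{0<..<x}. norm (integrand1 (N l) (M l) p x y t) \<le> h t) F"
proof -
  \<comment> \<open>A midpoint: \<open>e\<close> must exceed the growth exponents (1 + Re \<mu>)/2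
    and - (1 + Re \<nu>)/2, while integrability of (x - t)^(- (1 + Re \<nu>)/2 - e) at x asks for e
    < (1 - Re \<nu>)/2. The first pair of bounds is compatible exactly when Re \<mu> < - Re
    \<nu>.\<close>
  define e where "e = (max ((1 + Re \<mu>) / 2) (- (1 + Re \<nu>) / 2) + (1 - Re \<nu>) / 2) / 2"
  have e: "e > (1 + Re \<mu>) / 2" "e > - (1 + Re \<nu>) / 2" "e < (1 - Re \<nu>) / 2"
    using \<nu> \<mu> unfolding e_def by (auto simp: max_def field_simps)
  have e': "- ((- 1 - Re \<mu>) / 2) < e" "- ((1 + Re \<nu>) / 2) < e" "- ((1 - Re \<mu>) / 2) < e"
  proof -
    have "2 * e > 1 + Re \<mu>" "2 * e > - (1 + Re \<nu>)" using e by (simp_all add: field_simps)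
    then show "- ((- 1 - Re \<mu>) / 2) < e" "- ((1 + Re \<nu>) / 2) < e" "- ((1 - Re \<mu>) / 2) < e"
      by (simp_all add: field_simps)
  qed
  \<comment> \<open>An upper bound for the argument z, since 1 - z = x y / ((x - t) (y + t)) and (x
    - t) (y + t) \<le> x (x + y).\<close>
  define R where "R = x / (x + y)"
  have R: "0 \<le> R" "R < 1" using x y by (auto simp: R_def)
  have c0: "1 - \<mu> + \<nu> \<noteq> 0"
  proof
    assume "1 - \<mu> + \<nu> = 0"
    then have "Re (1 - \<mu> + \<nu>) = 0" by simp
    then show False using \<mu> by simp
  qed
  have "\<exists>C\<ge>0. eventually (\<lambda>l. \<forall>z\<le>R. norm (hyp2F1 (- (1 + M l) / 2) ((1 + N l) /
      2) ((1 - M l + N l) / 2) (of_real z)) \<le> C * (1 - z) powr e) F"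
    by (rule hyp2F1_bound_neg[of "\<lambda>l. - (1 + M l) / 2" "- (1 + \<mu>) / 2" F "\<lambda>l. (1 + N l) / 2"
        "(1 + \<nu>) / 2" "\<lambda>l. (1 - M l + N l) / 2" "(1 - \<mu> + \<nu>) / 2" e R])
       (use R \<mu> e' in \<open>auto intro!: tendsto_intros N M\<close>)
  then obtain C1 where C1: "C1 \<ge> 0"
      "eventually (\<lambda>l. \<forall>z\<le>R. norm (hyp2F1 (- (1 + M l) / 2) ((1 + N l) / 2) ((1 - M l + N l) /
      2) (of_real z)) \<le> C1 * (1 - z) powr e) F"
    by blast
  have "\<exists>C\<ge>0. eventually (\<lambda>l. \<forall>z\<le>R. norm (hyp2F1 ((1 - M l) / 2) ((1 + N l) / 2) ((3 - M l + N l) /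
      2) (of_real z)) \<le> C * (1 - z) powr e) F"
    by (rule hyp2F1_bound_neg[of "\<lambda>l. (1 - M l) / 2" "(1 - \<mu>) / 2" F "\<lambda>l. (1 + N l) / 2" "(1 + \<nu>) /
        2" "\<lambda>l. (3 - M l + N l) / 2" "(3 - \<mu> + \<nu>) / 2" e R])
       (use R \<mu> e' in \<open>auto intro!: tendsto_intros N M\<close>)
  then obtain C2 where C2: "C2 \<ge> 0"
      "eventually (\<lambda>l. \<forall>z\<le>R. norm (hyp2F1 ((1 - M l) / 2) ((1 + N l) / 2) ((3 - M l + N l) /
      2) (of_real z)) \<le> C2 * (1 - z) powr e) F"
    by blast
  \<comment> \<open>\<open>e1\<close> and \<open>e2\<close> lie halfway between -1 and the exact
    exponents at 0 and x, which leaves room for the parameters to move.\<close>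
  define e1 where "e1 = (- 1 + - (1 + Re \<mu> - Re \<nu>) / 2) / 2"
  define e2 where "e2 = (- 1 + (- (1 + Re \<nu>) / 2 - e)) / 2"
  have e12: "- 1 < e1" "e1 < - (1 + Re \<mu> - Re \<nu>) / 2" "- 1 < e2" "e2 < - (1 + Re \<nu>) / 2 - e"
    using \<mu> e by (auto simp: e1_def e2_def field_simps)
  define E where "E = - (1 + \<mu> - \<nu>) / 2"
  have "((\<lambda>l. - (1 + M l - N l) / 2) \<longlongrightarrow> E) F" unfolding E_def by (intro tendsto_intros N M) auto
  note ev1 = order_tendstoD[OF tendsto_Re[OF this]]
  have v1: "eventually (\<lambda>l. e1 < Re (- (1 + M l - N l) / 2)) F"
      "eventually (\<lambda>l. Re (- (1 + M l - N l) / 2) < Re E + 1) F"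
    by (rule ev1(1), use e12 in \<open>simp add: E_def\<close>) (rule ev1(2), simp)
  define E' where "E' = - (1 + \<nu>) / 2"
  have "((\<lambda>l. - (1 + N l) / 2) \<longlongrightarrow> E') F" unfolding E'_def by (intro tendsto_intros N M) auto
  note ev2 = order_tendstoD[OF tendsto_Re[OF this]]
  have v2: "eventually (\<lambda>l. e2 + e < Re (- (1 + N l) / 2)) F"
      "eventually (\<lambda>l. Re (- (1 + N l) / 2) < Re E' + 1) F"
    by (rule ev2(1), use e12 in \<open>simp add: E'_def field_simps\<close>) (rule ev2(2), simp)
  have v3: "eventually (\<lambda>l. norm ((1 + M l) / 2) \<le> norm ((1 + \<mu>) / 2) + 1) F"
    by (intro eventually_norm_le tendsto_intros M) auto
  have v4: "eventually (\<lambda>l. norm (M l / (1 - M l + N l)) \<le> norm (\<mu> / (1 - \<mu> + \<nu>)) + 1) F"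
    by (intro eventually_norm_le tendsto_intros N M c0)
  define K1 where "K1 = max 1 x powr (Re E + 1 - e1)"
  define K2 where "K2 = max 1 x powr (Re E' + 1 - e - e2)"
  define K3 where "K3 = max 1 (max (y + x) (1 / y)) powr (norm ((1 + \<mu>) / 2) + 1)"
  define K4 where "K4 = (x * y / (x + y)) powr e + x powr e"
  define K5 where "K5 = C1 + (norm (\<mu> / (1 - \<mu> + \<nu>)) + 1) * C2"
  have K: "K1 \<ge> 0" "K2 \<ge> 0" "K3 \<ge> 0" "K4 \<ge> 0" "K5 \<ge> 0"
    using C1 C2 by (auto simp: K1_def K2_def K3_def K4_def K5_def)
  define h where "h t = K1 * K2 * K3 * K4 * K5 * (t powr e1 * (x - t) powr e2)" for t
  have "set_integrable lborel {0<..<x} h"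
    unfolding h_def[abs_def] by (rule beta_weight_integrable) (use x e12 in auto)
  moreover have "eventually (\<lambda>l. \<forall>t\<in>{0<..<x}. norm (integrand1 (N l) (M l) p x y t) \<le> h t) F"
    using C1(2) C2(2) v1 v2 v3 v4
  proof eventually_elim
    case (elim l)
    show ?case
    proof
      fix t assume t: "t \<in> {0<..<x}"
      define z where "z = t * (x - y - t) / ((x - t) * (y + t))"
      have z1: "1 - z = x * y / (y + t) / (x - t)"
        unfolding z_def using one_minus_argument_less[of t x y] t y by (simp add: mult.commute)
      have q: "x * y / (x + y) \<le> x * y / (y + t)" "x * y / (y + t) \<le> x"
      proof -
        show "x * y / (x + y) \<le> x * y / (y + t)" using t x y
            by (intro divide_left_mono mult_pos_pos) auto
        have "x * y \<le> x * (y + t)" using t x by (intro mult_left_mono) auto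
        then show "x * y / (y + t) \<le> x" using t y by (simp add: divide_le_eq)
      qed
      have q0: "x * y / (x + y) > 0" using x y by simp
      have "x * y / (x + y) / x \<le> x * y / (y + t) / (x - t)"
        using q q0 t x y by (intro frac_le) auto
      then have "1 - z \<ge> y / (x + y)" unfolding z1 using x by simp
      moreover have "1 - R = y / (x + y)" unfolding R_def using x y by (simp add: field_simps)
      ultimately have zR: "z \<le> R" by linarith
      have "(x * y / (y + t)) powr e \<le> K4"
      proof (cases "e \<ge> 0")
        case True
        then have "(x * y / (y + t)) powr e \<le> x powr e" using q q0 by (intro powr_mono2) auto
        then show ?thesis unfolding K4_def by (simp add: add_increasing)
      next
        case False
        then have "(x * y / (y + t)) powr e \<le> (x * y / (x + y)) powr e" using q q0
            by (intro powr_mono2') auto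
        then show ?thesis unfolding K4_def by (simp add: add_increasing2)
      qed
      moreover have "(1 - z) powr e = (x * y / (y + t)) powr e * (x - t) powr (- e)"
      proof -
        have "(x * y / (y + t) / (x - t)) powr e = (x * y / (y + t)) powr e / (x - t) powr e"
          by (rule powr_divide)
        then show ?thesis unfolding z1 by (simp only: powr_minus divide_inverse)
      qed
      ultimately have ze: "(1 - z) powr e \<le> K4 * (x - t) powr (- e)" by (simp add: mult_right_mono)
      have n1: "norm (exp (- p * complex_of_real t)) \<le> 1" using p t by simp
      have n2: "norm (complex_of_real t powr (- (1 + M l - N l) / 2)) \<le> K1 * t powr e1"
        unfolding K1_def using t elim(3,4)
            by (subst norm_of_real_powr) (auto intro!: powr_le_near_0)
      have n3: "norm (complex_of_real (x - t) powr (- (1 + N l) / 2)) * (x - t) powr (- e) \<le> K2 *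
          (x - t) powr e2"
      proof -
        have "norm (complex_of_real (x - t) powr (- (1 + N l) / 2)) * (x - t) powr (- e) =
            (x - t) powr (Re (- (1 + N l) / 2) - e)"
          using t by (subst norm_of_real_powr) (auto simp: powr_add[symmetric])
        also have "\<dots> \<le> K2 * (x - t) powr e2"
          unfolding K2_def
        proof (rule powr_le_near_0)
          show "0 < x - t" "x - t \<le> x" using t by auto
          show "e2 \<le> Re (- (1 + N l) / 2) - e" "Re (- (1 + N l) / 2) - e \<le> Re E' + 1 - e"
              using elim(5,6) by linarith+
        qed
        finally show ?thesis .
      qed
      have n4: "norm (complex_of_real (y + t) powr ((1 + M l) / 2)) \<le> K3"
        unfolding K3_def using t y elim(7) order_trans[OF abs_Re_le_cmod elim(7)]
        by (subst norm_of_real_powr) (auto intro!: powr_le_compact simp del: Re_divide_numeral)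
      define F1 F2 where "F1 = hyp2F1 (- (1 + M l) / 2) ((1 + N l) / 2) ((1 - M l + N l) /
          2) (of_real z)"
        and "F2 = hyp2F1 ((1 - M l) / 2) ((1 + N l) / 2) ((3 - M l + N l) / 2) (of_real z)"
      have f: "norm F1 \<le> C1 * (1 - z) powr e" "norm F2 \<le> C2 * (1 - z) powr e"
        unfolding F1_def F2_def using elim(1,2) zR by auto
      have "M l * of_real t / ((1 - M l + N l) * of_real (y + t)) = M l / (1 - M l + N l) *
          of_real (t / (y + t))"
        unfolding of_real_divide by (simp only: times_divide_times_eq)
      then have "norm (M l * of_real t / ((1 - M l + N l) * of_real (y + t))) =
          norm (M l / (1 - M l + N l)) * (t / (y + t))"
        using t y by (simp only: norm_mult norm_of_real) simp
      also have "\<dots> \<le> (norm (\<mu> / (1 - \<mu> + \<nu>)) + 1) * 1"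
        using elim(8) t y by (intro mult_mono) auto
      finally have n5: "norm (M l * of_real t / ((1 - M l + N l) * of_real (y + t))) \<le>
          norm (\<mu> / (1 - \<mu> + \<nu>)) + 1" by simp
      have "norm (F1 + M l * of_real t / ((1 - M l + N l) * of_real (y + t)) * F2) \<le>
          norm F1 + norm (M l * of_real t / ((1 - M l + N l) * of_real (y + t))) * norm F2"
        by (metis norm_mult norm_triangle_ineq)
      also have "\<dots> \<le> C1 * (1 - z) powr e + (norm (\<mu> / (1 - \<mu> + \<nu>)) + 1) * (C2 * (1 - z) powr e)"
        using f n5 by (intro add_mono mult_mono) auto
      also have "\<dots> = K5 * (1 - z) powr e" by (simp add: K5_def algebra_simps)
      also have "\<dots> \<le> K5 * (K4 * (x - t) powr (- e))" using ze K by (intro mult_left_mono)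
      finally have n6: "norm (F1 + M l * of_real t / ((1 - M l + N l) * of_real (y + t)) * F2) \<le>
          K5 * (K4 * (x - t) powr (- e))" .
      have "norm (integrand1 (N l) (M l) p x y t) = norm (exp (- p * complex_of_real t)) *
          norm (complex_of_real t powr (- (1 + M l - N l) / 2)) *
        norm (complex_of_real (x - t) powr (- (1 + N l) / 2)) * norm
            (complex_of_real (y + t) powr ((1 + M l) / 2)) *
        norm (F1 + M l * of_real t / ((1 - M l + N l) * of_real (y + t)) * F2)"
        unfolding integrand1_def F1_def F2_def z_def by (simp only: norm_mult)
      also have "\<dots> \<le> 1 * (K1 * t powr e1) * norm (complex_of_real (x - t) powr (- (1 + N l) / 2)) *
          K3 * (K5 * (K4 * (x - t) powr (- e)))"
        using n1 n2 n4 n6 K by (intro mult_mono) auto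
      also have "\<dots> = K1 * t powr e1 * K3 * K5 * K4 *
          (norm (complex_of_real (x - t) powr (- (1 + N l) / 2)) * (x - t) powr (- e))"
        by (simp only: mult_ac mult_1_left)
      also have "\<dots> \<le> K1 * t powr e1 * K3 * K5 * K4 * (K2 * (x - t) powr e2)"
        using n3 K by (intro mult_left_mono) auto
      also have "\<dots> = h t" unfolding h_def by (simp only: mult_ac)
      finally show "norm (integrand1 (N l) (M l) p x y t) \<le> h t" .
    qed
  qed
  ultimately show ?thesis by blast
qed

lemma powr_quotient_absorb:
  fixes A B a b s :: real
  assumes "A > 0" "B > 0"
  shows "A powr a * B powr b * (A / B) powr (- s) = A powr (a - s) * B powr (b + s)"
proof -
  have "(A / B) powr (- s) = exp (- s * (ln A - ln B))" using assms by (simp add: powr_def ln_div)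
  then show ?thesis using assms by (simp add: powr_def exp_add[symmetric] algebra_simps)
qed

text \<open>As t decreases to x the argument z tends to 1. With q = (t - x) / (y - x + t) one has q
  \<le> 1 - z, so powers of q dominate both hypergeometric functions. The second may be more
  singular by one order, for which the factor q in \<open>integrand2b\<close> compensates.
  Exponential decay pays for all powers at infinity.\<close>

lemma integrand2_bound:
  assumes N: "(N \<longlongrightarrow> \<nu>) F" and M: "(M \<longlongrightarrow> \<mu>) F"
    and \<nu>: "Re \<nu> < 1" and \<mu>: "Re \<mu> < - Re \<nu>"
    and p: "Re p > 0" and x: "x > 0" and y: "y > 0"
  shows "\<exists>h. set_integrable lborel {x<..} h \<and>
    eventually (\<lambda>l. \<forall>t\<in>{x<..}. norm (integrand2a (N l) (M l) p x y t) \<le> h t \<and>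
      norm (integrand2b (N l) (M l) p x y t) \<le> h t) F"
proof -
  \<comment> \<open>\<open>S - 1\<close> and \<open>S\<close> are the values of Re (a + b - c) for
    the two hypergeometric functions, and \<open>S - 1\<close> is also the exponent of t - x. Any s
    with max 0 (S - 1) < s < S serves both functions and keeps the final exponent S - 1 - s above
    -1.\<close>
  define S where "S = - (Re \<mu> + Re \<nu>) / 2"
  have S0: "S > 0" using \<mu> by (simp add: S_def)
  define s where "s = (max 0 (S - 1) + S) / 2"
  have s: "s > 0" "s > S - 1" "s < S" using S0 by (auto simp: s_def max_def field_simps)
  have tA: "((\<lambda>l. - M l / 2) \<longlongrightarrow> - \<mu> / 2) F" "((\<lambda>l. (2 - M l) / 2) \<longlongrightarrow> (2 - \<mu>) / 2) F"
    "((\<lambda>l. (1 - N l) / 2) \<longlongrightarrow> (1 - \<nu>) / 2) F"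
    by (intro tendsto_intros N M; simp)+
  have "Re (- \<mu> / 2 + (1 - \<nu>) / 2 - 3 / 2) = S - 1" "Re ((2 - \<mu>) / 2 + (1 - \<nu>) / 2 - 3 / 2) = S"
    by (auto simp: S_def field_simps)
  then have s': "s > Re (- \<mu> / 2 + (1 - \<nu>) / 2 - 3 / 2)"
      "1 + s > Re ((2 - \<mu>) / 2 + (1 - \<nu>) / 2 - 3 / 2)"
    using s by linarith+
  have c: "Re (3 / 2) > 0" "1 + s > 0" using s by auto
  obtain C1 where C1: "C1 \<ge> 0" "eventually (\<lambda>l. \<forall>z\<in>{0..<1::real}.
    norm (hyp2F1 (- M l / 2) ((1 - N l) / 2) (3 / 2) (of_real z)) \<le> C1 * (1 - z) powr (- s)) F"
    using hyp2F1_bound_near_1[OF tA(1,3) tendsto_const c(1) s(1) s'(1)] by blast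
  obtain C2 where C2: "C2 \<ge> 0" "eventually (\<lambda>l. \<forall>z\<in>{0..<1::real}.
    norm (hyp2F1 ((2 - M l) / 2) ((1 - N l) / 2) (3 / 2) (of_real z)) \<le> C2 * (1 - z) powr
        (- (1 + s))) F"
    using hyp2F1_bound_near_1[OF tA(2,3) tendsto_const c(1) c(2) s'(2)] by blast
  define E where "E = - (2 + \<mu> + \<nu>) / 2"
  have "((\<lambda>l. - (2 + M l + N l) / 2) \<longlongrightarrow> E) F" unfolding E_def by (intro tendsto_intros N M) auto
  note evE = order_tendstoD[OF tendsto_Re[OF this]]
  have ReE: "Re E = S - 1" by (simp add: E_def S_def field_simps)
  define e where "e = (- 1 + (Re E - s)) / 2"
  have e: "- 1 < e" "e < Re E - s" using s by (auto simp: e_def ReE field_simps)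
  have vE: "eventually (\<lambda>l. e + s < Re (- (2 + M l + N l) / 2)) F"
      "eventually (\<lambda>l. Re (- (2 + M l + N l) / 2) < Re E + 1) F"
    by (rule evE(1), use e in simp) (rule evE(2), simp)
  define Q where "Q = Re E + 1 - s - e"
  have Q: "Q > 0" using e by (simp add: Q_def)
  define T where "T = norm (\<mu> / 2) + 1 + s"
  have T: "T > 0" using s by (auto simp: T_def intro: add_nonneg_pos)
  define T' where "T' = norm ((\<nu> - 1) / 2) + 1"
  have v1: "eventually (\<lambda>l. norm (M l / 2) \<le> norm (\<mu> / 2) + 1) F"
      "eventually (\<lambda>l. norm ((N l - 1) / 2) \<le> T') F"
    unfolding T'_def by (intro eventually_norm_le tendsto_intros N M; simp)+
  have vN: "eventually (\<lambda>l. Re (N l) < 1) F" by (rule order_tendstoD(2)[OF tendsto_Re[OF N] \<nu>])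
  \<comment> \<open>Half of the decay is spent on polynomial growth through
    \<open>powr_le_exp\<close>; the other half remains in \<open>h\<close>.\<close>
  define r where "r = Re p / 2"
  have r: "r > 0" using p by (simp add: r_def)
  define K1 where "K1 = max 1 (max x (1 / x)) powr T'"
  define K2 where "K2 = max 1 (max y (1 / y)) powr T"
  define K3 where "K3 = exp (- (Q + T) - (Q + T) * ln (r / (Q + T))) * exp r"
  have K: "K1 \<ge> 0" "K2 \<ge> 0" "K3 \<ge> 0" by (auto simp: K1_def K2_def K3_def)
  define h where "h t = (C1 + C2) * K1 * K2 * K3 * (exp (- r * (t - x)) * (t - x) powr e)" for t
  have "set_integrable lborel {x<..} h" unfolding h_def[abs_def]
      by (rule gamma_weight_integrable) (use e r in auto)
  moreover have "eventually (\<lambda>l. \<forall>t\<in>{x<..}. norm (integrand2a (N l) (M l) p x y t) \<le> h t \<and>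
      norm (integrand2b (N l) (M l) p x y t) \<le> h t) F"
    using C1(2) C2(2) vE v1 vN
  proof eventually_elim
    case (elim l)
    show ?case
    proof
      fix t assume t: "t \<in> {x<..}"
      have t0: "t > 0" "t - x > 0" "y - x + t > 0" using t x y by auto
      define z where "z = x * y / (t * (y - x + t))"
      define q where "q = (t - x) / (y - x + t)"
      have q0: "q > 0" "q \<le> 1" using t0 y by (auto simp: q_def)
      have z1: "1 - z = q * ((t + y) / t)"
        unfolding z_def q_def one_minus_argument_greater[OF t0(1,3)] by simp
      have "1 \<le> (t + y) / t" using t0 y by simp
      then have qz: "q \<le> 1 - z" unfolding z1 using q0 mult_left_mono[of 1 "(t + y) / t" q] by simp
      have "z > 0" unfolding z_def using t0 x y by (intro divide_pos_pos mult_pos_pos) auto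
      then have z: "z \<in> {0..<1}" using qz q0 by auto
      define F1 F2 where "F1 = hyp2F1 (- M l / 2) ((1 - N l) / 2) (3 / 2) (of_real z)"
        and "F2 = hyp2F1 ((2 - M l) / 2) ((1 - N l) / 2) (3 / 2) (of_real z)"
      have "norm F1 \<le> C1 * (1 - z) powr (- s)" unfolding F1_def using elim(1) z by auto
      also have "\<dots> \<le> C1 * q powr (- s)" using qz q0 s C1(1)
          by (intro mult_left_mono powr_mono2') auto
      finally have f1: "norm F1 \<le> (C1 + C2) * q powr (- s)" using C2(1)
          by (simp add: algebra_simps add_increasing2)
      have "norm (of_real q * F2) = q * norm F2" using q0 by (simp add: norm_mult)
      also have "\<dots> \<le> q * (C2 * (1 - z) powr (- (1 + s)))" unfolding F2_def using elim(2) z q0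
          by (intro mult_left_mono) auto
      also have "\<dots> \<le> q * (C2 * q powr (- (1 + s)))" using qz q0 s C2(1)
          by (intro mult_left_mono powr_mono2') auto
      also have "\<dots> = C2 * (q powr 1 * q powr (- (1 + s)))" using q0 by simp
      also have "q powr 1 * q powr (- (1 + s)) = q powr (- s)"
          by (simp only: powr_add[symmetric]) simp
      finally have f2: "norm (of_real q * F2) \<le> (C1 + C2) * q powr (- s)" using C1(1)
          by (simp add: algebra_simps add_increasing)
      define P where "P = norm (exp (- p * complex_of_real t)) *
          norm (complex_of_real t powr ((N l - 1) / 2)) *
        norm (complex_of_real (t - x) powr (- (2 + M l + N l) / 2)) * norm
            (complex_of_real (y - x + t) powr (M l / 2))"
      have n1: "norm (exp (- p * complex_of_real t)) \<le> exp (- (2 * r) * (t - x))"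
        using p x by (simp add: r_def algebra_simps)
      have n2: "norm (complex_of_real t powr ((N l - 1) / 2)) \<le> K1"
      proof -
        have "norm (complex_of_real t powr ((N l - 1) / 2)) = t powr Re ((N l - 1) / 2)" using t0
            by (intro norm_of_real_powr)
        also have "\<dots> \<le> x powr Re ((N l - 1) / 2)" using t x elim(7) by (intro powr_mono2') auto
        also have "\<dots> \<le> K1" unfolding K1_def
          using x order_trans[OF abs_Re_le_cmod elim(6)] by (intro powr_le_compact[of x]) auto
        finally show ?thesis .
      qed
      have "norm (complex_of_real (t - x) powr (- (2 + M l + N l) / 2)) *
          norm (complex_of_real (y - x + t) powr (M l / 2)) * q powr (- s) =
        (t - x) powr (Re (- (2 + M l + N l) / 2) - s) * (y - x + t) powr (Re (M l / 2) + s)"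
        unfolding q_def norm_of_real_powr[OF t0(2)] norm_of_real_powr[OF t0(3)]
        by (rule powr_quotient_absorb[OF t0(2,3)])
      also have "\<dots> \<le> ((1 + (t - x)) powr Q * (t - x) powr e) * (K2 * (1 + (t - x)) powr T)"
      proof (intro mult_mono)
        have "(t - x) powr (Re (- (2 + M l + N l) / 2) - s) =
            (t - x) powr (Re (- (2 + M l + N l) / 2) - s - e) * (t - x) powr e"
          by (simp add: powr_add[symmetric])
        also have "(t - x) powr (Re (- (2 + M l + N l) / 2) - s - e) \<le>
            (1 + (t - x)) powr (Re (- (2 + M l + N l) / 2) - s - e)"
          by (intro powr_mono2; use t0 elim(3) in linarith)
        also have "\<dots> \<le> (1 + (t - x)) powr Q" by (intro powr_mono; use t0 elim(4) Q_def in linarith)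
        finally show "(t - x) powr (Re (- (2 + M l + N l) / 2) - s) \<le> (1 + (t - x)) powr Q *
            (t - x) powr e"
          by (simp add: mult_right_mono)
        have "\<bar>Re (M l / 2) + s\<bar> \<le> T"
          using order_trans[OF abs_Re_le_cmod elim(5)] s unfolding T_def by linarith
        from powr_le_growth[OF t0(2) y this]
        show "(y - x + t) powr (Re (M l / 2) + s) \<le> K2 * (1 + (t - x)) powr T"
          unfolding K2_def by (simp add: algebra_simps)
      qed (use K in auto)
      also have "\<dots> = K2 * ((1 + (t - x)) powr (Q + T) * (t - x) powr e)"
          by (simp add: powr_add mult_ac)
      also have "\<dots> \<le> K2 * ((K3 * exp (r * (t - x))) * (t - x) powr e)"
      proof -
        have "(1 + (t - x)) powr (Q + T) \<le> exp (- (Q + T) - (Q + T) * ln (r / (Q + T))) *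
            exp (r * (1 + (t - x)))"
          using t0 Q T r by (intro powr_le_exp) auto
        also have "\<dots> = K3 * exp (r * (t - x))" unfolding K3_def
            by (simp add: exp_add[symmetric] algebra_simps)
        finally show ?thesis using K by (intro mult_left_mono mult_right_mono) auto
      qed
      finally have n3: "norm (complex_of_real (t - x) powr (- (2 + M l + N l) / 2)) *
          norm (complex_of_real (y - x + t) powr (M l / 2)) * q powr (- s)
        \<le> K2 * ((K3 * exp (r * (t - x))) * (t - x) powr e)" .
      have "P * q powr (- s) = norm (exp (- p * complex_of_real t)) *
          norm (complex_of_real t powr ((N l - 1) / 2)) *
         (norm (complex_of_real (t - x) powr (- (2 + M l + N l) / 2)) * norm
             (complex_of_real (y - x + t) powr (M l / 2)) * q powr (- s))"
        unfolding P_def by (simp only: mult.assoc)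
      also have "\<dots> \<le> exp (- (2 * r) * (t - x)) * K1 *
          (K2 * ((K3 * exp (r * (t - x))) * (t - x) powr e))"
        by (rule mult_mono[OF mult_mono[OF n1 n2] n3]) (use K in auto)
      also have "\<dots> = K1 * K2 * K3 * ((exp (- (2 * r) * (t - x)) * exp (r * (t - x))) *
          (t - x) powr e)" by (simp only: mult_ac)
      also have "exp (- (2 * r) * (t - x)) * exp (r * (t - x)) = exp (- r * (t - x))"
          by (simp add: exp_add[symmetric] algebra_simps)
      finally have PP: "P * q powr (- s) \<le> K1 * K2 * K3 * (exp (- r * (t - x)) * (t - x) powr e)" .
      have fin: "P * f \<le> h t" if "f \<le> (C1 + C2) * q powr (- s)" for f
      proof -
        have "P * f \<le> P * ((C1 + C2) * q powr (- s))" using that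
            by (intro mult_left_mono) (auto simp: P_def)
        also have "\<dots> = (C1 + C2) * (P * q powr (- s))" by (simp only: mult_ac)
        also have "\<dots> \<le> (C1 + C2) * (K1 * K2 * K3 * (exp (- r * (t - x)) * (t - x) powr e))"
          using PP C1(1) C2(1) by (intro mult_left_mono) auto
        also have "\<dots> = h t" by (simp only: h_def mult.assoc)
        finally show ?thesis .
      qed
      have "norm (integrand2a (N l) (M l) p x y t) = P * norm F1"
          "norm (integrand2b (N l) (M l) p x y t) = P * norm (of_real q * F2)"
        unfolding integrand2a_def integrand2b_def F1_def F2_def z_def q_def P_def
            by (simp_all only: norm_mult)
      then show "norm (integrand2a (N l) (M l) p x y t) \<le> h t \<and>
          norm (integrand2b (N l) (M l) p x y t) \<le> h t"
        using fin f1 f2 by simp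
    qed
  qed
  ultimately show ?thesis by blast
qed

section \<open>Continuity, measurability and integrability of the integrands\<close>

lemma argument_less_lt_1:
  fixes x y t :: real
  assumes "0 < t" "t < x" "0 < y"
  shows "t * (x - y - t) / ((x - t) * (y + t)) < 1"
proof -
  have "x * y / ((x - t) * (y + t)) > 0" using assms by (intro divide_pos_pos mult_pos_pos) auto
  moreover have "1 - t * (x - y - t) / ((x - t) * (y + t)) = x * y / ((x - t) * (y + t))"
    by (rule one_minus_argument_less) (use assms in auto)
  ultimately show ?thesis by linarith
qed

lemma argument_greater_lt_1:
  fixes x y t :: real
  assumes "0 < x" "x < t" "0 < y"
  shows "x * y / (t * (y - x + t)) < 1"
proof -
  have "(t - x) * (t + y) / (t * (y - x + t)) > 0" using assms
      by (intro divide_pos_pos mult_pos_pos) auto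
  moreover have "1 - x * y / (t * (y - x + t)) = (t - x) * (t + y) / (t * (y - x + t))"
    by (rule one_minus_argument_greater) (use assms in auto)
  ultimately show ?thesis by linarith
qed

lemma hyp2F1_continuous_on_compose:
  assumes "c \<notin> \<int>\<^sub>\<le>\<^sub>0" "continuous_on S f" "\<And>t. t \<in> S \<Longrightarrow> f t < 1"
  shows "continuous_on S (\<lambda>t. hyp2F1 a b c (of_real (f t)))"
  by (rule continuous_on_compose2[OF hyp2F1_continuous_on_real[OF assms(1)] assms(2)])
      (use assms(3) in auto)

lemma integrand1_continuous_on:
  assumes "Re \<mu> < 1 + Re \<nu>" "x > 0" "y > 0"
  shows "continuous_on {0<..<x} (integrand1 \<nu> \<mu> p x y)"
proof -
  have z: "continuous_on {0<..<x} (\<lambda>t. t * (x - y - t) / ((x - t) * (y + t)))"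
    using assms by (intro continuous_intros) auto
  have c: "(1 - \<mu> + \<nu>) / 2 \<notin> \<int>\<^sub>\<le>\<^sub>0" "(3 - \<mu> + \<nu>) / 2 \<notin> \<int>\<^sub>\<le>\<^sub>0"
    using assms by (auto intro!: Re_pos_not_nonpos_Ints)
  note h = hyp2F1_continuous_on_compose[OF c(1) z] hyp2F1_continuous_on_compose[OF c(2) z]
  have F: "continuous_on {0<..<x} (\<lambda>t. hyp2F1 a b ((1 - \<mu> + \<nu>) /
      2) (of_real (t * (x - y - t) / ((x - t) * (y + t)))))"
    "continuous_on {0<..<x} (\<lambda>t. hyp2F1 a b ((3 - \<mu> + \<nu>) /
        2) (of_real (t * (x - y - t) / ((x - t) * (y + t)))))" for a b
    using assms argument_less_lt_1
        by (auto intro!: h simp del: of_real_divide of_real_mult of_real_diff)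
  have k: "(1 - \<mu> + \<nu>) \<noteq> 0" using c(1) by auto
  have q: "continuous_on {0<..<x} (\<lambda>t. \<mu> * of_real t / ((1 - \<mu> + \<nu>) * complex_of_real (y + t)))"
    using k assms by (intro continuous_intros) (auto simp flip: of_real_add)
  have P: "continuous_on {0<..<x} (\<lambda>t. exp (- p * complex_of_real t))"
    "continuous_on {0<..<x} (\<lambda>t. complex_of_real t powr a)"
        "continuous_on {0<..<x} (\<lambda>t. complex_of_real (x - t) powr a)"
    "continuous_on {0<..<x} (\<lambda>t. complex_of_real (y + t) powr a)" for a
    using assms by (auto intro!: continuous_intros simp del: of_real_add of_real_diff)
  show ?thesis unfolding integrand1_def[abs_def]
    by (intro continuous_on_mult continuous_on_add F q P)
qed

lemma integrand2_continuous_on: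
  assumes "x > 0" "y > 0"
  shows "continuous_on {x<..} (integrand2a \<nu> \<mu> p x y)"
      "continuous_on {x<..} (integrand2b \<nu> \<mu> p x y)"
proof -
  have z: "continuous_on {x<..} (\<lambda>t. x * y / (t * (y - x + t)))"
    using assms by (intro continuous_intros) auto
  have c: "3 / 2 \<notin> (\<int>\<^sub>\<le>\<^sub>0 :: complex set)" by (rule Re_pos_not_nonpos_Ints) simp
  have F: "continuous_on {x<..} (\<lambda>t. hyp2F1 a b (3 / 2) (of_real (x * y / (t * (y - x + t)))))"
      for a b
    using assms argument_greater_lt_1
        by (auto intro!: hyp2F1_continuous_on_compose[OF c z] simp del: of_real_divide of_real_mult
        of_real_diff)
  have q: "continuous_on {x<..} (\<lambda>t. complex_of_real ((t - x) / (y - x + t)))"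
    using assms by (intro continuous_intros) auto
  have P: "continuous_on {x<..} (\<lambda>t. exp (- p * complex_of_real t))"
    "continuous_on {x<..} (\<lambda>t. complex_of_real t powr a)"
        "continuous_on {x<..} (\<lambda>t. complex_of_real (t - x) powr a)"
    "continuous_on {x<..} (\<lambda>t. complex_of_real (y - x + t) powr a)" for a
    using assms by (auto intro!: continuous_intros simp del: of_real_add of_real_diff)
  show "continuous_on {x<..} (integrand2a \<nu> \<mu> p x y)" "continuous_on {x<..} (integrand2b \<nu> \<mu> p x y)"
    unfolding integrand2a_def[abs_def] integrand2b_def[abs_def]
    by (intro continuous_on_mult F q P)+
qed

lemma integrand1_integrable:
  assumes "Re \<nu> < 1" "Re \<mu> < 1 + Re \<nu>" "Re \<mu> < - Re \<nu>" "Re p > 0" "x > 0" "y > 0"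
  shows "set_integrable lborel {0<..<x} (integrand1 \<nu> \<mu> p x y)"
proof -
  obtain h where h: "set_integrable lborel {0<..<x} h"
    "eventually (\<lambda>l. \<forall>t\<in>{0<..<x}. norm (integrand1 \<nu> \<mu> p x y t) \<le> h t) sequentially"
    using integrand1_bound[OF tendsto_const tendsto_const assms] by blast
  show ?thesis
    by (rule set_integrable_real_bound[OF h(1)])
       (use h(2) in \<open>auto intro!: set_borel_measurable_lborel_continuous integrand1_continuous_on
           assms\<close>)
qed

lemma integrand2_integrable:
  assumes "Re \<nu> < 1" "Re \<mu> < - Re \<nu>" "Re p > 0" "x > 0" "y > 0"
  shows "set_integrable lborel {x<..} (integrand2a \<nu> \<mu> p x y)"
      "set_integrable lborel {x<..} (integrand2b \<nu> \<mu> p x y)"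
    "set_integrable lborel {x<..} (integrand2 \<nu> \<mu> p x y)"
proof -
  obtain h where h: "set_integrable lborel {x<..} h"
    "eventually (\<lambda>l. \<forall>t\<in>{x<..}. norm (integrand2a \<nu> \<mu> p x y t) \<le> h t \<and>
        norm (integrand2b \<nu> \<mu> p x y t) \<le> h t) sequentially"
    using integrand2_bound[OF tendsto_const tendsto_const assms] by blast
  show 1: "set_integrable lborel {x<..} (integrand2a \<nu> \<mu> p x y)"
      "set_integrable lborel {x<..} (integrand2b \<nu> \<mu> p x y)"
    by (rule set_integrable_real_bound[OF h(1)];
        use h(2) in \<open>auto intro!: set_borel_measurable_lborel_continuous integrand2_continuous_on
            assms\<close>)+
  show "set_integrable lborel {x<..} (integrand2 \<nu> \<mu> p x y)"
    unfolding integrand2_eq[abs_def] by (intro set_integral_diff set_integrable_mult_right 1)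
qed

lemma holomorphic_tendsto_nhds:
  assumes "f holomorphic_on L" "open L" "x \<in> L"
  shows "(f \<longlongrightarrow> f x) (nhds x)"
  using assms holomorphic_on_imp_continuous_on continuous_on_eq_continuous_at
  by (metis isCont_def tendsto_at_iff_tendsto_nhds)

lemma lhs_holomorphic:
  assumes L: "open L" and N: "N holomorphic_on L" and M: "M holomorphic_on L"
  shows "(\<lambda>l. lhs (N l) (M l) p x y) holomorphic_on L"
  unfolding lhs_eq by (intro holomorphic_intros L N M) auto

context
  fixes L :: "complex set" and N M :: "complex \<Rightarrow> complex" and p :: complex and x y :: real
  assumes L: "open L" and N: "N holomorphic_on L" and M: "M holomorphic_on L"
    and NL: "\<And>l. l \<in> L \<Longrightarrow> Re (N l) < 1"
        and MN: "\<And>l. l \<in> L \<Longrightarrow> Re (M l) < 1 + Re (N l)" "\<And>l. l \<in> L \<Longrightarrow> Re (M l) < - Re (N l)"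
    and p: "Re p > 0" and x: "x > 0" and y: "y > 0"
begin

text \<open>Both orders are functions \<open>N\<close> and \<open>M\<close> of one complex variable,
  which reduces continuation in two parameters to the identity theorem in one. The majorants near l
  come from \<open>integrand1_bound\<close> with the filter \<open>nhds l\<close>.\<close>

lemma integral1_holomorphic:
    "(\<lambda>l. LINT t:{0<..<x}|lborel. integrand1 (N l) (M l) p x y t) holomorphic_on L"
proof (rule holomorphic_parametric_integral[OF L])
  fix t assume t: "t \<in> {0<..<x}"
  define z where "z = t * (x - y - t) / ((x - t) * (y + t))"
  have z: "z < 1" unfolding z_def using t y argument_less_lt_1 by simp
  have pos: "complex_of_real t \<notin> \<real>\<^sub>\<le>\<^sub>0" "complex_of_real (x - t) \<notin> \<real>\<^sub>\<le>\<^sub>0"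
      "complex_of_real (y + t) \<notin> \<real>\<^sub>\<le>\<^sub>0"
    using t y by (auto simp: complex_nonpos_Reals_iff)
  have k: "1 - M l + N l \<noteq> 0" if "l \<in> L" for l
  proof
    assume "1 - M l + N l = 0"
    then have "Re (1 - M l + N l) = 0" by simp
    then show False using MN(1)[OF that] by simp
  qed
  have h1: "(\<lambda>l. hyp2F1 (- (1 + M l) / 2) ((1 + N l) / 2) ((1 - M l + N l) / 2) (of_real z))
      holomorphic_on L"
  proof (rule hyp2F1_param_holomorphic[OF L _ _ _ _ z])
    show "Re ((1 - M l + N l) / 2) > 0" if "l \<in> L" for l using MN(1)[OF that] by simp
  qed (intro holomorphic_intros N M; simp)+
  have h2: "(\<lambda>l. hyp2F1 ((1 - M l) / 2) ((1 + N l) / 2) ((3 - M l + N l) / 2) (of_real z))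
      holomorphic_on L"
  proof (rule hyp2F1_param_holomorphic[OF L _ _ _ _ z])
    show "Re ((3 - M l + N l) / 2) > 0" if "l \<in> L" for l using MN(1)[OF that] by simp
  qed (intro holomorphic_intros N M; simp)+
  have yt: "complex_of_real (y + t) \<noteq> 0" using t y by (simp del: of_real_add)
  show "(\<lambda>l. integrand1 (N l) (M l) p x y t) holomorphic_on L"
    unfolding integrand1_def z_def[symmetric]
    by (intro holomorphic_on_mult holomorphic_on_add h1 h2 holomorphic_on_divide
        holomorphic_on_const N M
        holomorphic_on_powr_right holomorphic_on_minus holomorphic_on_diff)
       (use pos k yt in \<open>auto simp del: of_real_add\<close>)
next
  fix l assume l: "l \<in> L"
  show "set_borel_measurable lborel {0<..<x} (integrand1 (N l) (M l) p x y)"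
    using MN(1)[OF l] x y by (intro set_borel_measurable_lborel_continuous integrand1_continuous_on)
        auto
  show "\<exists>h. set_integrable lborel {0<..<x} h \<and>
      (\<forall>\<^sub>F l' in nhds l. \<forall>t\<in>{0<..<x}. norm (integrand1 (N l') (M l') p x y t) \<le> h t)"
    by (rule integrand1_bound[OF holomorphic_tendsto_nhds[OF N L l]
        holomorphic_tendsto_nhds[OF M L l] NL[OF l] MN(1)[OF l] MN(2)[OF l] p x y])
qed

lemma integral2_holomorphic:
  "(\<lambda>l. LINT t:{x<..}|lborel. integrand2a (N l) (M l) p x y t) holomorphic_on L"
  "(\<lambda>l. LINT t:{x<..}|lborel. integrand2b (N l) (M l) p x y t) holomorphic_on L"
proof -
  have hol: "(\<lambda>l. integrand2a (N l) (M l) p x y t) holomorphic_on L \<and>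
      (\<lambda>l. integrand2b (N l) (M l) p x y t) holomorphic_on L"
    if t: "t \<in> {x<..}" for t
  proof -
    define z where "z = x * y / (t * (y - x + t))"
    have z: "z < 1" unfolding z_def using t x y argument_greater_lt_1 by simp
    have pos: "complex_of_real t \<notin> \<real>\<^sub>\<le>\<^sub>0" "complex_of_real (t - x) \<notin> \<real>\<^sub>\<le>\<^sub>0"
        "complex_of_real (y - x + t) \<notin> \<real>\<^sub>\<le>\<^sub>0"
      using t x y by (auto simp: complex_nonpos_Reals_iff)
    have h1: "(\<lambda>l. hyp2F1 (- M l / 2) ((1 - N l) / 2) (3 / 2) (of_real z)) holomorphic_on L"
      "(\<lambda>l. hyp2F1 ((2 - M l) / 2) ((1 - N l) / 2) (3 / 2) (of_real z)) holomorphic_on L"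
      by (rule hyp2F1_param_holomorphic[OF L _ _ _ _ z]; (intro holomorphic_intros N M)?; simp)+
    show ?thesis
      unfolding integrand2a_def integrand2b_def z_def[symmetric]
      by (intro conjI holomorphic_on_mult holomorphic_on_add h1 holomorphic_on_divide
          holomorphic_on_const N M
          holomorphic_on_powr_right holomorphic_on_minus holomorphic_on_diff)
         (use pos in \<open>auto simp del: of_real_add of_real_diff\<close>)
  qed
  have bd: "\<exists>h. set_integrable lborel {x<..} h \<and>
      (\<forall>\<^sub>F l' in nhds l. \<forall>t\<in>{x<..}. norm (integrand2a (N l') (M l') p x y t) \<le> h t \<and>
      norm (integrand2b (N l') (M l') p x y t) \<le> h t)" if l: "l \<in> L" for l
    by (rule integrand2_bound[OF holomorphic_tendsto_nhds[OF N L l]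
        holomorphic_tendsto_nhds[OF M L l] NL[OF l] MN(2)[OF l] p x y])
  show "(\<lambda>l. LINT t:{x<..}|lborel. integrand2a (N l) (M l) p x y t) holomorphic_on L"
  proof (rule holomorphic_parametric_integral[OF L])
    fix l assume l: "l \<in> L"
    show "set_borel_measurable lborel {x<..} (integrand2a (N l) (M l) p x y)"
      by (intro set_borel_measurable_lborel_continuous integrand2_continuous_on x y) simp
    show "\<exists>h. set_integrable lborel {x<..} h \<and>
        (\<forall>\<^sub>F l' in nhds l. \<forall>t\<in>{x<..}. norm (integrand2a (N l') (M l') p x y t) \<le> h t)"
      using bd[OF l] by (rule ex_forward) (erule conj_forward, assumption, erule eventually_mono,
          blast)
  qed (use hol in auto)
  show "(\<lambda>l. LINT t:{x<..}|lborel. integrand2b (N l) (M l) p x y t) holomorphic_on L"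
  proof (rule holomorphic_parametric_integral[OF L])
    fix l assume l: "l \<in> L"
    show "set_borel_measurable lborel {x<..} (integrand2b (N l) (M l) p x y)"
      by (intro set_borel_measurable_lborel_continuous integrand2_continuous_on x y) simp
    show "\<exists>h. set_integrable lborel {x<..} h \<and>
        (\<forall>\<^sub>F l' in nhds l. \<forall>t\<in>{x<..}. norm (integrand2b (N l') (M l') p x y t) \<le> h t)"
      using bd[OF l] by (rule ex_forward) (erule conj_forward, assumption, erule eventually_mono,
          blast)
  qed (use hol in auto)
qed

text \<open>The regularised form matters: the coefficient \<mu> / (1 + \<mu>) of \<open>rhs\<close>
  has a pole that the curve of parameters may meet.\<close>

lemma rhs_reg_holomorphic: "(\<lambda>l. rhs_reg (N l) (M l) p x y) holomorphic_on L"
  unfolding rhs_reg_def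
  by (intro holomorphic_on_add holomorphic_on_mult integral1_holomorphic integral2_holomorphic)
     (intro holomorphic_intros N M; simp)+

end

lemma halfplane_open_convex:
  fixes c d :: complex
  shows "open {l. Re (c + l * d) < b}" "convex {l. Re (c + l * d) < b}"
proof -
  have "{l. Re (c + l * d) < b} = {l. inner (cnj d) l < b - Re c}"
    by (auto simp: inner_complex_def algebra_simps)
  then show "open {l. Re (c + l * d) < b}" "convex {l. Re (c + l * d) < b}"
    by (simp_all add: open_halfspace_lt convex_halfspace_lt)
qed

text \<open>Both sides are holomorphic along the complex line that joins \<open>(\<nu>, \<mu>)\<close> to the point
  \<open>(-1, -2)\<close>, near which the convolution argument applies.\<close>

theorem lhs_eq_rhs_reg:
  assumes \<nu>: "Re \<nu> < 1" and \<mu>: "Re \<mu> < 1 + Re \<nu>" "Re \<mu> < - Re \<nu>"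
    and p: "Re p > 0" and x: "x > 0" and y: "y > 0"
  shows "lhs \<nu> \<mu> p x y = rhs_reg \<nu> \<mu> p x y"
proof -
  define N where "N l = \<nu> + l * (- 1 - \<nu>)" for l
  define M where "M l = \<mu> + l * (- 2 - \<mu>)" for l
  \<comment> \<open>The parameter region pulled back to l. It is an intersection of half-planes,
    hence convex and connected. \<open>U\<close> is the open part in which the convolution argument
    applies; it contains l = 1.\<close>
  define L where "L = {l. Re (N l) < 1} \<inter> {l. Re (M l - N l) < 1} \<inter> {l. Re (M l + N l) < 0}"
  define U where "U = L \<inter> {l. Re (- N l) < 2} \<inter> {l. Re (M l) < - 1}"
  have e: "M l - N l = (\<mu> - \<nu>) + l * ((- 2 - \<mu>) - (- 1 - \<nu>))" "M l + N l = (\<mu> + \<nu>) + l *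
      ((- 2 - \<mu>) + (- 1 - \<nu>))"
    "- N l = - \<nu> + l * (1 + \<nu>)" for l by (auto simp: M_def N_def algebra_simps)
  have oL: "open L" "convex L"
    unfolding L_def e unfolding N_def by (intro open_Int convex_Int halfplane_open_convex)+
  have oU: "open U" unfolding U_def e unfolding M_def by (intro open_Int oL halfplane_open_convex)
  have hol: "N holomorphic_on L" "M holomorphic_on L" unfolding N_def[abs_def] M_def[abs_def]
      by (intro holomorphic_intros)+
  have inL: "Re (N l) < 1" "Re (M l) < 1 + Re (N l)" "Re (M l) < - Re (N l)" if "l \<in> L" for l
    using that by (auto simp: L_def)
  have 1: "1 \<in> U" by (simp add: U_def L_def N_def M_def)
  have 0: "0 \<in> L" using assms by (simp add: L_def N_def M_def)
  have "lhs (N 0) (M 0) p x y = rhs_reg (N 0) (M 0) p x y"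
  proof (rule analytic_continuation_open[of U L "\<lambda>l. lhs (N l) (M l) p x y"
      "\<lambda>l. rhs_reg (N l) (M l) p x y"])
    show "connected L" using oL by (intro convex_connected)
    show "(\<lambda>l. lhs (N l) (M l) p x y) holomorphic_on L" by (rule lhs_holomorphic[OF oL(1) hol])
    show "(\<lambda>l. rhs_reg (N l) (M l) p x y) holomorphic_on L"
        by (rule rhs_reg_holomorphic[OF oL(1) hol inL p x y])
    show "lhs (N l) (M l) p x y = rhs_reg (N l) (M l) p x y" if "l \<in> U" for l
      by (rule lhs_eq_rhs_reg_convolution) (use that p x y in \<open>auto simp: U_def L_def\<close>)
  qed (use oU oL 1 0 in \<open>auto simp: U_def\<close>)
  then show ?thesis by (simp add: N_def M_def)
qed

section \<open>Divergence of the integrals\<close>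

text \<open>Near a the modulus of f is at least a constant times 1 / (t - a), whose integral
  diverges logarithmically.\<close>

lemma not_integrable_powr_singularity:
  fixes a b :: real and f g :: "real \<Rightarrow> complex"
  assumes int: "set_integrable lborel {a<..<b} f" and ab: "a < b"
    and f: "\<And>t. t \<in> {a<..<b} \<Longrightarrow> f t = of_real (t - a) powr E * g t" and E: "Re E \<le> - 1"
    and g: "(g \<longlongrightarrow> G) (at_right a)" and G: "G \<noteq> 0"
  shows False
proof -
  define c where "c = norm G / 2"
  have c: "c > 0" using G by (simp add: c_def)
  have "eventually (\<lambda>t. c < norm (g t)) (at_right a)"
    using order_tendstoD(1)[OF tendsto_norm[OF g], of c] G by (simp add: c_def)
  then obtain d where d: "d > a" "\<And>t. a < t \<Longrightarrow> t < d \<Longrightarrow> c < norm (g t)"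
    unfolding eventually_at_right_field by blast
  \<comment> \<open>With \<open>m \<le> a + 1\<close> the base t - a is at most 1, so that an
    exponent with real part at most -1 gives at least 1 / (t - a).\<close>
  define m where "m = min (min b d) (a + 1)"
  have m: "a < m" "m \<le> b" "m \<le> d" "m \<le> a + 1" using ab d by (auto simp: m_def)
  have low: "c * (1 / (t - a)) \<le> norm (f t)" if t: "t \<in> {a<..<m}" for t
  proof -
    have "c * (t - a) powr (- 1) \<le> norm (g t) * (t - a) powr Re E"
      using t m d(2)[of t] E c by (intro mult_mono powr_mono') auto
    then show ?thesis using t m
        by (simp add: f norm_mult norm_of_real_powr powr_minus divide_inverse mult.commute
        del: of_real_diff)
  qed
  have I: "set_integrable lborel {a<..<m} (\<lambda>t. 1 / (t - a))"
  proof (rule set_integrable_bound)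
    have "set_integrable lborel {a<..<m} f" by (rule set_integrable_subset[OF int]) (use m in auto)
    then show "set_integrable lborel {a<..<m} (\<lambda>t. norm (f t) / c)"
        by (intro set_integrable_divide set_integrable_norm)
    show "set_borel_measurable lborel {a<..<m} (\<lambda>t. 1 / (t - a))"
      by (intro set_borel_measurable_lborel_continuous continuous_intros) auto
    show "AE t in lborel. t \<in> {a<..<m} \<longrightarrow> norm (1 / (t - a)) \<le> norm (norm (f t) / c)"
    proof (intro AE_I2 impI)
      fix t assume t: "t \<in> {a<..<m}"
      then have "1 / (t - a) \<le> norm (f t) / c" using low[OF t] c by (simp add: field_simps)
      then show "norm (1 / (t - a)) \<le> norm (norm (f t) / c)" using t c by simp
    qed
  qed
  define J where "J = integral {a<..<m} (\<lambda>t. 1 / (t - a))"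
  have hk: "(\<lambda>t. 1 / (t - a)) integrable_on {a<..<m}" using I
      by (rule set_borel_integral_eq_integral(1))
  define w where "w = (a + m) / 2"
  have w: "a < w" "w < m" using m by (auto simp: w_def)
  \<comment> \<open>Chosen so that the integral from a + k to w is |J| + 1, more than the integral
    \<open>J\<close> over the whole interval.\<close>
  define k where "k = (w - a) * exp (- (\<bar>J\<bar> + 1))"
  have k: "0 < k" "k \<le> w - a" unfolding k_def using w
      by (auto intro!: mult_left_le simp: mult_le_cancel_left1)
  have ft: "((\<lambda>t. 1 / (t - a)) has_integral (ln (w - a) - ln (a + k - a))) {a + k..w}"
    by (rule fundamental_theorem_of_calculus)
       (use k w in \<open>auto intro!: derivative_eq_intros
           simp: has_real_derivative_iff_has_vector_derivative[symmetric]\<close>)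
  have "integral {a + k..w} (\<lambda>t. 1 / (t - a)) \<le> J"
    unfolding J_def using ft k w by (intro integral_subset_le hk) (auto simp: has_integral_iff)
  moreover have "integral {a + k..w} (\<lambda>t. 1 / (t - a)) = ln (w - a) - ln k" using ft
      by (simp add: has_integral_iff)
  moreover have "ln k = ln (w - a) - (\<bar>J\<bar> + 1)" unfolding k_def using w by (simp add: ln_mult_pos)
  ultimately show False by linarith
qed

text \<open>This covers all c: at a nonpositive integer the series, with quotients by zero read as
  0, still starts with 1. The divergence argument at t = 0 meets such values, as (1 - \<mu> + \<nu>)
  / 2 may be one there.\<close>

lemma hyp2F1_tendsto_0: "((\<lambda>z. hyp2F1 a b c z) \<longlongrightarrow> 1) (nhds 0)"
proof -
  have "gauss_series a b c holomorphic_on ball 0 1"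
      by (rule gauss_series_holomorphic) (auto intro: holomorphic_intros)
  from holomorphic_tendsto_nhds[OF this open_ball]
  have "(gauss_series a b c \<longlongrightarrow> gauss_series a b c 0) (nhds 0)" by simp
  moreover have "gauss_series a b c 0 = 1"
    unfolding gauss_series_def using powser_zero[of "gauss_coeff a b c"] by simp
  moreover have "eventually (\<lambda>z. gauss_series a b c z = hyp2F1 a b c z) (nhds 0)"
    using eventually_nhds_in_open[OF open_ball, of 0 "0::complex" 1]
        by (auto elim!: eventually_mono simp: hyp2F1_eq_gauss_series)
  ultimately show ?thesis using Lim_transform_eventually by fastforce
qed

text \<open>As t tends to 0 the brace tends to 1, so the integrand is t^(- (1 + \<mu> - \<nu>)/2)
  times a function with a nonzero limit.\<close>

lemma Re_mu_less_of_integrable: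
  assumes int: "set_integrable lborel {0<..<x} (integrand1 \<nu> \<mu> p x y)" and x: "x > 0" and y: "y > 0"
  shows "Re \<mu> < 1 + Re \<nu>"
proof (rule ccontr)
  assume "\<not> Re \<mu> < 1 + Re \<nu>"
  then have E: "Re (- (1 + \<mu> - \<nu>) / 2) \<le> - 1" by simp
  define z where "z t = t * (x - y - t) / ((x - t) * (y + t))" for t
  define g where "g t = exp (- p * of_real t) * of_real (x - t) powr (- (1 + \<nu>) / 2) *
      of_real (y + t) powr ((1 + \<mu>) / 2)
     * (hyp2F1 (- (1 + \<mu>) / 2) ((1 + \<nu>) / 2) ((1 - \<mu> + \<nu>) / 2) (of_real (z t))
        + \<mu> * of_real t / ((1 - \<mu> + \<nu>) * of_real (y + t))
          * hyp2F1 ((1 - \<mu>) / 2) ((1 + \<nu>) / 2) ((3 - \<mu> + \<nu>) / 2) (of_real (z t)))" for t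
  have id: "((\<lambda>t::real. t) \<longlongrightarrow> 0) (at_right 0)" by (rule tendsto_ident_at)
  have "(z \<longlongrightarrow> 0 * (x - y - 0) / ((x - 0) * (y + 0))) (at_right 0)"
    unfolding z_def by (intro tendsto_intros id) (use x y in auto)
  then have "((\<lambda>t. complex_of_real (z t)) \<longlongrightarrow> of_real 0) (at_right 0)" by (intro tendsto_of_real) simp
  then have F: "((\<lambda>t. hyp2F1 a b c (of_real (z t))) \<longlongrightarrow> 1) (at_right 0)" for a b c
    using filterlim_compose[OF hyp2F1_tendsto_0] by simp
  have q: "((\<lambda>t. \<mu> * of_real t / ((1 - \<mu> + \<nu>) * complex_of_real (y + t))) \<longlongrightarrow> 0) (at_right 0)"
  \<comment> \<open>Where this denominator vanishes, the quotient is 0 by convention.\<close>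
  proof (cases "1 - \<mu> + \<nu> = 0")
    case False
    have "((\<lambda>t. \<mu> * of_real t / ((1 - \<mu> + \<nu>) * complex_of_real (y + t))) \<longlongrightarrow> \<mu> * of_real 0 /
        ((1 - \<mu> + \<nu>) * complex_of_real (y + 0))) (at_right 0)"
      by (intro tendsto_intros id) (use False y in auto)
    then show ?thesis by simp
  qed simp
  have pw: "((\<lambda>t. complex_of_real (f t) powr a) \<longlongrightarrow> of_real l powr a) (at_right 0)"
    if "(f \<longlongrightarrow> l) (at_right 0)" "l > 0" for f l a
    by (intro tendsto_powr_complex tendsto_of_real that tendsto_const)
        (use that in \<open>auto simp: complex_nonpos_Reals_iff\<close>)
  have "(g \<longlongrightarrow> exp (- p * of_real 0) * of_real (x - 0) powr (- (1 + \<nu>) / 2) *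
      of_real (y + 0) powr ((1 + \<mu>) / 2) * (1 + 0 * 1)) (at_right 0)"
    unfolding g_def by (intro tendsto_mult tendsto_add F q pw tendsto_exp tendsto_of_real
        tendsto_diff tendsto_const id) (use x y in auto)
  then show False
    by (rule not_integrable_powr_singularity[OF int x _ E, rotated 1])
       (use x y in \<open>auto simp: g_def z_def integrand1_def mult_ac\<close>)
qed

text \<open>Gauss's summation theorem as a limit, by dominated convergence in Euler's integral. From
  1 - v \<le> 1 - z v \<le> 1 the last factor has modulus at most (1 - v)^(- m) with m = max (Re a)
  0, and m < Re d keeps the majorant integrable.\<close>

lemma hyp2F1_Gauss_limit:
  assumes b: "Re b > 0" and d: "Re d > 0" and a: "Re a < Re d"
  shows "((\<lambda>z. hyp2F1 a b (b + d) (of_real z)) \<longlongrightarrow> Beta b (d - a) /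
      Beta b d) (at 1 within {0<..<1::real})"
proof -
  define m where "m = max (Re a) 0"
  have m: "m \<ge> 0" "Re a \<le> m" "m < Re d" using a d by (auto simp: m_def)
  let ?f = "\<lambda>z v. of_real v powr (b - 1) * of_real (1 - v) powr (d - 1) *
      complex_of_real (1 - z * v) powr (- a)"
  have B: "Beta b d \<noteq> 0" unfolding Beta_def using b d
      by (auto simp: Gamma_eq_zero_iff Re_pos_not_nonpos_Ints)
  have "((\<lambda>z. LINT v:{0<..<1}|lborel. ?f z v) \<longlongrightarrow> (LINT v:{0<..<1}|lborel. ?f 1 v))
      (at 1 within {0<..<1::real})"
    unfolding tendsto_at_iff_sequentially o_def
  proof (intro allI impI)
    fix X :: "nat \<Rightarrow> real" assume X: "\<forall>i. X i \<in> {0<..<1} - {1}" "X \<longlonglongrightarrow> 1"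
    have X01: "0 < X n" "X n < 1" for n using X(1) by auto
    have pos: "1 - X n * v > 0" "1 - v \<le> 1 - X n * v" "1 - X n * v \<le> 1" if "v \<in> {0<..<1}" for n v
    proof -
      have "X n * v \<le> 1 * v" "X n * v \<ge> 0" using that X01[of n]
          by (intro mult_right_mono mult_nonneg_nonneg; simp)+
      moreover have "v < 1" using that by simp
      ultimately show "1 - X n * v > 0" "1 - v \<le> 1 - X n * v" "1 - X n * v \<le> 1" by linarith+
    qed
    have meas: "(\<lambda>v. indicator {0<..<1} v *\<^sub>R ?f z v) \<in> borel_measurable lborel"
        if "\<And>v. v \<in> {0<..<1} \<Longrightarrow> 1 - z * v > 0" for z
    proof -
      have "continuous_on {0<..<1} (?f z)" using that
          by (auto intro!: continuous_intros simp del: of_real_diff of_real_mult)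
      from set_borel_measurable_lborel_continuous[OF _ this] show ?thesis
          unfolding set_borel_measurable_def by simp
    qed
    show "(\<lambda>n. LINT v:{0<..<1}|lborel. ?f (X n) v) \<longlonglongrightarrow> (LINT v:{0<..<1}|lborel. ?f 1 v)"
      unfolding set_lebesgue_integral_def
    proof (rule integral_dominated_convergence[where w =
        "\<lambda>v. indicator {0<..<1} v *\<^sub>R (1 * (v powr (Re b - 1) * (1 - v) powr (Re d - 1 - m)))"])
      show "(\<lambda>v. indicator {0<..<1} v *\<^sub>R ?f 1 v) \<in> borel_measurable lborel" by (rule meas) simp
      show "(\<lambda>v. indicator {0<..<1} v *\<^sub>R ?f (X n) v) \<in> borel_measurable lborel" for n
          by (rule meas) (rule pos)
      show "integrable lborel (\<lambda>v. indicator {0<..<1} v *\<^sub>R (1 *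
          (v powr (Re b - 1) * (1 - v) powr (Re d - 1 - m))))"
        using beta_weight_integrable[of 1 "Re b - 1" "Re d - 1 - m" 1] b m
            unfolding set_integrable_def by simp
      show "AE v in lborel. (\<lambda>n. indicator {0<..<1} v *\<^sub>R ?f (X n) v) \<longlonglongrightarrow> indicator {0<..<1} v *\<^sub>R ?f
          1 v"
      proof (rule AE_I2)
        fix v :: real
        have "(\<lambda>n. complex_of_real (1 - X n * v) powr (- a)) \<longlonglongrightarrow> of_real (1 - 1 * v) powr (- a)"
            if "v < 1"
          by (intro tendsto_powr_complex tendsto_of_real tendsto_intros X(2))
              (use that in \<open>auto simp: complex_nonpos_Reals_iff\<close>)
        then show "(\<lambda>n. indicator {0<..<1} v *\<^sub>R ?f (X n) v) \<longlonglongrightarrow> indicator {0<..<1} v *\<^sub>R ?f 1 v"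
          by (cases "v \<in> {0<..<1}") (auto intro!: tendsto_intros simp del: of_real_diff
              of_real_mult)
      qed
      show "AE v in lborel. norm (indicator {0<..<1} v *\<^sub>R ?f (X n) v) \<le>
          indicator {0<..<1} v *\<^sub>R (1 * (v powr (Re b - 1) * (1 - v) powr (Re d - 1 - m)))" for n
      proof (rule AE_I2)
        fix v :: real
        show "norm (indicator {0<..<1} v *\<^sub>R ?f (X n) v) \<le>
            indicator {0<..<1} v *\<^sub>R (1 * (v powr (Re b - 1) * (1 - v) powr (Re d - 1 - m)))"
        proof (cases "v \<in> {0<..<1}")
          case True
          have "(1 - X n * v) powr (- Re a) \<le> (1 - X n * v) powr (- m)"
            using pos[OF True, of n] m by (intro powr_mono') auto
          also have "\<dots> \<le> (1 - v) powr (- m)"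
            using pos[OF True, of n] m True by (intro powr_mono2') auto
          finally have "norm (?f (X n) v) \<le> v powr (Re b - 1) * (1 - v) powr (Re d - 1) *
              (1 - v) powr (- m)"
            using True pos(1)[OF True, of n]
                by (auto simp: norm_mult norm_of_real_powr simp del: of_real_diff of_real_mult
                intro!: mult_left_mono)
          also have "\<dots> = v powr (Re b - 1) * (1 - v) powr (Re d - 1 - m)"
            unfolding mult.assoc powr_add[symmetric] by simp
          finally show ?thesis using True by simp
        qed simp
      qed
    qed
  qed
  moreover have "(LINT v:{0<..<1}|lborel. ?f 1 v) = Beta b (d - a)"
  proof -
    have "(LINT v:{0<..<1}|lborel. ?f 1 v) = (LINT v:{0<..<1}|lborel. of_real v powr (b - 1) *
        of_real (1 - v) powr (d - a - 1))"
    proof (intro set_lebesgue_integral_cong, simp, intro allI impI)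
      fix v :: real assume "v \<in> {0<..<1}"
      have "complex_of_real (1 - v) powr (d - 1) * of_real (1 - v) powr (- a) =
          of_real (1 - v) powr (d - a - 1)"
        unfolding powr_add[symmetric] by (simp add: algebra_simps)
      then show "?f 1 v = of_real v powr (b - 1) * of_real (1 - v) powr (d - a - 1)"
          by (simp only: mult.assoc mult_1_left)
    qed
    then show ?thesis using Beta_integral_complex[of b "d - a"] b a by simp
  qed
  ultimately have "((\<lambda>z. (LINT v:{0<..<1}|lborel. ?f z v) / Beta b d) \<longlongrightarrow> Beta b (d - a) /
      Beta b d) (at 1 within {0<..<1::real})"
    using B by (intro tendsto_divide tendsto_const) auto
  moreover have "eventually (\<lambda>z. (LINT v:{0<..<1}|lborel. ?f z v) / Beta b d =
      hyp2F1 a b (b + d) (of_real z)) (at 1 within {0<..<1::real})"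
    unfolding eventually_at_filter
        by (intro always_eventually) (use Euler_integral[OF b d] B in auto)
  ultimately show ?thesis by (rule Lim_transform_eventually)
qed

text \<open>If Re (\<mu> + \<nu>) \<ge> 0, then as t decreases to x the first hypergeometric
  function has a nonzero Gauss limit, while the second, multiplied by \<open>q\<close>, tends to 0.
  The integrand thus behaves like t - x to a power with real part at most -1.\<close>

lemma Re_mu_nu_less_of_integrable:
  assumes int: "set_integrable lborel {x<..} (integrand2 \<nu> \<mu> p x y)" and x: "x > 0" and y: "y > 0"
    and \<nu>: "Re \<nu> < 1" and \<mu>: "Re \<mu> < 1 + Re \<nu>"
  shows "Re \<mu> < - Re \<nu>"
proof (rule ccontr)
  assume "\<not> Re \<mu> < - Re \<nu>"
  then have S: "Re \<mu> + Re \<nu> \<ge> 0" by simp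
  then have E: "Re (- (2 + \<mu> + \<nu>) / 2) \<le> - 1" by simp
  define z where "z t = x * y / (t * (y - x + t))" for t
  define F1 where "F1 t = hyp2F1 (- \<mu> / 2) ((1 - \<nu>) / 2) (3 / 2) (of_real (z t))" for t
  define F2 where "F2 t = hyp2F1 ((2 - \<mu>) / 2) ((1 - \<nu>) / 2) (3 / 2) (of_real (z t))" for t
  define q where "q t = (t - x) / (y - x + t)" for t
  define g where "g t = exp (- p * of_real t) * of_real t powr ((\<nu> - 1) / 2) *
      of_real (y - x + t) powr (\<mu> / 2)
     * (F1 t - \<mu> / (1 + \<mu>) * (of_real (q t) * F2 t))" for t
  define G where "G = Beta ((1 - \<nu>) / 2) (1 + \<nu> / 2 - (- \<mu> / 2)) / Beta ((1 - \<nu>) / 2) (1 + \<nu> / 2)"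
  \<comment> \<open>Re \<mu> < 1 + Re \<nu> and Re (\<mu> + \<nu>) \<ge> 0 together give Re \<nu> >
    -1/2, hence the second inequality.\<close>
  have b: "Re ((1 - \<nu>) / 2) > 0" "Re (1 + \<nu> / 2) > 0" "Re (- \<mu> / 2) < Re (1 + \<nu> / 2)" using \<nu> \<mu> S
      by auto
  have beta: "Beta u v \<noteq> 0" if "Re u > 0" "Re v > 0" for u v :: complex
    unfolding Beta_def using that by (auto simp: Gamma_eq_zero_iff Re_pos_not_nonpos_Ints)
  have G: "G \<noteq> 0" unfolding G_def using b beta by auto
  have id: "((\<lambda>t::real. t) \<longlongrightarrow> x) (at_right x)" by (rule tendsto_ident_at)
  have tx: "eventually (\<lambda>t. x < t) (at_right x)" by (rule eventually_at_right_less)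
  have z01: "z t \<in> {0<..<1}" if "x < t" for t
  proof -
    have "z t > 0" unfolding z_def using that x y by (intro divide_pos_pos mult_pos_pos) auto
    then show ?thesis using argument_greater_lt_1[OF x that y] by (simp add: z_def)
  qed
  have "(z \<longlongrightarrow> x * y / (x * (y - x + x))) (at_right x)"
    unfolding z_def by (intro tendsto_intros id) (use x y in auto)
  then have z1: "(z \<longlongrightarrow> 1) (at_right x)" using x y by simp
  have zf: "filterlim z (at 1 within {0<..<1}) (at_right x)"
    unfolding filterlim_at using z1 tx by (auto elim!: eventually_mono dest: z01)
  have F1: "(F1 \<longlongrightarrow> G) (at_right x)"
  proof -
    have "(1 - \<nu>) / 2 + (1 + \<nu> / 2) = 3 / 2" by (simp add: field_simps)
    with filterlim_compose[OF hyp2F1_Gauss_limit[OF b] zf] show ?thesis unfolding F1_def G_def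
        by simp
  qed
  have qz: "0 < q t \<and> q t \<le> 1 - z t" if "x < t" for t
  proof -
    have t0: "t > 0" "t - x > 0" "y - x + t > 0" using that x y by auto
    have q0: "q t > 0" using t0 by (simp add: q_def)
    have "1 - z t = q t * ((t + y) / t)"
      unfolding z_def q_def one_minus_argument_greater[OF t0(1,3)] by simp
    moreover have "1 \<le> (t + y) / t" using t0 y by simp
    ultimately show ?thesis using q0 mult_left_mono[of 1 "(t + y) / t" "q t"] by simp
  qed
  \<comment> \<open>Here Re (a + b - c) = - Re (\<mu> + \<nu>)/2 \<le> 0, so 1/2 is admissible as a
    positive exponent; any exponent below 1 is beaten by q \<le> 1 - z.\<close>
  obtain C where C: "C \<ge> 0" "\<And>z. z \<in> {0..<1} \<Longrightarrow>
      norm (hyp2F1 ((2 - \<mu>) / 2) ((1 - \<nu>) / 2) (3 / 2) (complex_of_real z)) \<le> C * (1 - z) powr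
      (- (1 / 2))"
  proof -
    have "1 / 2 > Re ((2 - \<mu>) / 2 + (1 - \<nu>) / 2 - 3 / 2)" using S by (simp add: field_simps)
    from hyp2F1_bound_near_1[OF tendsto_const tendsto_const tendsto_const _ _ this, of sequentially]
        that show thesis by auto
  qed
  have qF: "((\<lambda>t. of_real (q t) * F2 t) \<longlongrightarrow> 0) (at_right x)"
  proof (rule Lim_null_comparison)
    have "((\<lambda>t. C * (1 - z t) powr (1 / 2)) \<longlongrightarrow> C * (1 - 1) powr (1 / 2)) (at_right x)"
      by (intro tendsto_intros z1) (use tx in \<open>auto elim!: eventually_mono dest: z01\<close>)
    then show "((\<lambda>t. C * (1 - z t) powr (1 / 2)) \<longlongrightarrow> 0) (at_right x)" by simp
    from tx show "\<forall>\<^sub>F t in at_right x. norm (of_real (q t) * F2 t) \<le> C * (1 - z t) powr (1 / 2)"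
    proof eventually_elim
      case (elim t)
      have "norm (of_real (q t) * F2 t) = q t * norm (F2 t)" using qz[OF elim]
          by (simp add: norm_mult)
      also have "\<dots> \<le> (1 - z t) * (C * (1 - z t) powr (- (1 / 2)))"
        using qz[OF elim] C(2)[of "z t"] z01[OF elim] unfolding F2_def by (intro mult_mono) auto
      also have "\<dots> = C * ((1 - z t) powr 1 * (1 - z t) powr (- (1 / 2)))" using z01[OF elim] by simp
      also have "(1 - z t) powr 1 * (1 - z t) powr (- (1 / 2)) = (1 - z t) powr (1 / 2)"
        by (simp only: powr_add[symmetric]) simp
      finally show ?case .
    qed
  qed
  have pw: "((\<lambda>t. complex_of_real (f t) powr a) \<longlongrightarrow> of_real l powr a) (at_right x)"
    if "(f \<longlongrightarrow> l) (at_right x)" "l > 0" for f l a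
    by (intro tendsto_powr_complex tendsto_of_real that tendsto_const)
        (use that in \<open>auto simp: complex_nonpos_Reals_iff\<close>)
  define H where "H = exp (- p * of_real x) * of_real x powr ((\<nu> - 1) / 2) *
      of_real (y - x + x) powr (\<mu> / 2) * (G - \<mu> / (1 + \<mu>) * 0)"
  have H0: "H \<noteq> 0" using G x y by (simp add: H_def)
  have gH: "(g \<longlongrightarrow> H) (at_right x)"
    unfolding g_def H_def
    by (intro tendsto_mult tendsto_diff tendsto_add F1 qF pw tendsto_exp tendsto_of_real
        tendsto_const id) (use x y in auto)
  have int': "set_integrable lborel {x<..<x + 1} (integrand2 \<nu> \<mu> p x y)"
      by (rule set_integrable_subset[OF int]) auto
  have fg: "integrand2 \<nu> \<mu> p x y t = of_real (t - x) powr (- (2 + \<mu> + \<nu>) / 2) * g t" for t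
    unfolding integrand2_eq integrand2a_def integrand2b_def g_def F1_def F2_def q_def z_def
    by (simp only: right_diff_distrib mult_ac)
  show False
    by (rule not_integrable_powr_singularity[OF int' _ fg E gH H0]) simp
qed

theorem theorem3p2:
  fixes \<nu> \<mu> p :: complex and x y :: real
  assumes "Re \<nu> < 1"
    and "Re \<mu> < min (1 - Re \<nu>) (2 + Re \<nu>)"
    and "Re p > 0" and "x > 0" and "\<bar>Arg (of_real y)\<bar> < pi" and "y > 0"
  shows "(Re \<mu> < min (- Re \<nu>) (1 + Re \<nu>) \<longrightarrow> integrals_converge \<nu> \<mu> p x y) \<and>
    (integrals_converge \<nu> \<mu> p x y \<longrightarrow>
      (\<mu> \<noteq> -1 \<longrightarrow> lhs \<nu> \<mu> p x y = rhs \<nu> \<mu> p x y) \<and>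
      (\<mu> = -1 \<longrightarrow> ((\<lambda>m. rhs \<nu> m p x y) \<longlongrightarrow> lhs \<nu> \<mu> p x y) (at \<mu>)))"
proof (intro conjI impI)
  assume "Re \<mu> < min (- Re \<nu>) (1 + Re \<nu>)"
  then show "integrals_converge \<nu> \<mu> p x y"
    unfolding integrals_converge_def using assms
        by (auto intro!: integrand1_integrable integrand2_integrable)
next
  assume "integrals_converge \<nu> \<mu> p x y"
  then have int: "set_integrable lborel {0<..<x} (integrand1 \<nu> \<mu> p x y)"
      "set_integrable lborel {x<..} (integrand2 \<nu> \<mu> p x y)"
    by (auto simp: integrals_converge_def)
  \<comment> \<open>Convergence forces the parameters into the region reached by continuation. The
    second divergence argument builds on the first bound.\<close>
  have \<mu>1: "Re \<mu> < 1 + Re \<nu>" by (rule Re_mu_less_of_integrable[OF int(1) assms(4,6)])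
  have \<mu>2: "Re \<mu> < - Re \<nu>" by (rule Re_mu_nu_less_of_integrable[OF int(2) assms(4,6,1) \<mu>1])
  have eq: "lhs \<nu> m p x y = rhs \<nu> m p x y" if "Re m < 1 + Re \<nu>" "Re m < - Re \<nu>" "m \<noteq> - 1" for m
    using lhs_eq_rhs_reg[OF assms(1) that(1,2) assms(3,4,6)]
      rhs_eq_rhs_reg[OF that(3) integrand2_integrable(1,2)[OF assms(1) that(2) assms(3,4,6)]]
          by simp
  show "lhs \<nu> \<mu> p x y = rhs \<nu> \<mu> p x y" if "\<mu> \<noteq> - 1" by (rule eq[OF \<mu>1 \<mu>2 that])
  \<comment> \<open>At points near -1 other than -1 itself the two sides agree, and
    \<open>lhs\<close> is entire in m, so its value is the limit.\<close>
  show "((\<lambda>m. rhs \<nu> m p x y) \<longlongrightarrow> lhs \<nu> \<mu> p x y) (at \<mu>)" if "\<mu> = - 1"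
  proof -
    have "(\<lambda>m. lhs \<nu> m p x y) holomorphic_on UNIV"
      using lhs_holomorphic[of UNIV "\<lambda>_. \<nu>" "\<lambda>m. m"] by (simp add: holomorphic_on_ident)
    then have "((\<lambda>m. lhs \<nu> m p x y) \<longlongrightarrow> lhs \<nu> \<mu> p x y) (nhds \<mu>)"
      by (rule holomorphic_tendsto_nhds) auto
    then have "((\<lambda>m. lhs \<nu> m p x y) \<longlongrightarrow> lhs \<nu> \<mu> p x y) (at \<mu>)"
      by (rule tendsto_mono[rotated]) (simp add: at_within_def)
    moreover have "open {m. Re m < min (1 + Re \<nu>) (- Re \<nu>)}" by (rule open_halfspace_Re_lt)
    then have "eventually (\<lambda>m. m \<in> {m. Re m < min (1 + Re \<nu>) (- Re \<nu>)}) (at \<mu>)"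
      using \<mu>1 \<mu>2 by (intro eventually_at_in_open') auto
    then have "eventually (\<lambda>m. lhs \<nu> m p x y = rhs \<nu> m p x y) (at \<mu>)"
      using eventually_neq_at_within[of \<mu> \<mu> UNIV] by eventually_elim (use eq that in auto)
    ultimately show ?thesis by (rule Lim_transform_eventually)
  qed
qed

end
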